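(* Let $H$ and $L$ be finite dimensional Hopf algebras over a field $\Bbbk$. Let $\lambda:H\to\Bbbk$ be a linear map with $\lambda(1_H)=1_{\Bbbk}$ and $\lambda(h)\lambda(g)=\lambda(h_1)\lambda(h_2g)$ for all $g,h\in H$, and let $z\in L$ satisfy $\varepsilon_L(z)=1_{\Bbbk}$ and $z\otimes z=\Delta_L(z)(1_L\otimes z)$. Regard $L$ as a left partial $H$-module algebra via $h\rightharpoonup x=\lambda(h)x$ and $H$ as a right partial $L$-comodule coalgebra via $\rho(h)=h\otimes z$, and suppose that with these structures $(H,L)$ is a partial matched pair. Then $L\underline{\overline{\#}}H$ is a Hopf algebra and the following statements are equivalent: (i) $L\underline{\overline{\#}}H$ is semisimple; (ii) $L\underline{\overline{\#}}H$ is separable; (iii) $L$ is semisimple, and $\lambda\left(\int_l^H\right)\neq 0$ or $\lambda\left(\int_r^H\right)\neq 0$.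
   Context: Sweedler notation $\Delta(h)=h_1\otimes h_2$ is used; $\int_l^H$ and $\int_r^H$ denote the spaces of left and right integrals in $H$. Left partial $H$-module algebra: a unital algebra $A$ with a linear map $\rightharpoonup:H\otimes A\to A$ such that $1_H\rightharpoonup a=a$; $h\rightharpoonup ab=(h_1\rightharpoonup a)(h_2\rightharpoonup b)$; $h\rightharpoonup(g\rightharpoonup a)=(h_1\rightharpoonup 1_A)(h_2g\rightharpoonup a)$. Right partial $L$-comodule coalgebra: a counital coalgebra $C$ with a linear map $\rho:C\to C\otimes L$, $\rho(c)=c^0\otimes c^1$, such that $(id_C\otimes\varepsilon_L)\rho(c)=c$; $(\Delta_C\otimes id_L)\rho(c)={c_1}^0\otimes{c_2}^0\otimes{c_1}^1{c_2}^1$; $(\rho\otimes id_L)\rho(c)={c_1}^0\otimes({c_1}^1)_1\otimes({c_1}^1)_2\,\varepsilon_C({c_2}^0){c_2}^1$. (The maps $h\rightharpoonup x=\lambda(h)x$ and $\rho(h)=h\otimes z$ satisfy these axioms exactly under the stated conditions on $\lambda$ and $z$.) Partial matched pair $(H,L)$: (i) $L$ is a left partial $H$-module algebra via $\rightharpoonup$; (ii) $H$ is a right partial $L$-comodule coalgebra via $\rho(h)=h^0\otimes h^1$; (iii) for all $h,g\in H$, $x\in L$, $(h_2g)^0\otimes(h_1\rightharpoonup x)_1\otimes(h_1\rightharpoonup x)_2(h_2g)^1={h_3}^0g^0\otimes({h_1}^0\rightharpoonup x_1)\otimes{h_1}^1(h_2\rightharpoonup x_2){h_3}^1(h_4\rightharpoonup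 g^1)$ in $H\otimes L\otimes L$; (iv) $\varepsilon_L(h\rightharpoonup x)=\varepsilon_L(h\rightharpoonup 1_L)\varepsilon_L(x)$; (v) $\rho(1_H)=1_H\otimes\varepsilon_H({1_H}^0){1_H}^1$. In this situation $L\underline{\overline{\#}}H$ denotes the subspace of $L\otimes H$ spanned by the elements $x\underline{\overline{\#}}h:=\lambda(h_1)\,xz\otimes h_2$ ($x\in L$, $h\in H$), with multiplication the restriction of $(x\otimes h)(y\otimes g)=\lambda(h_1)\,xy\otimes h_2g$, unit $1_L\underline{\overline{\#}}1_H=z\otimes 1_H$, comultiplication the restriction of $\Delta(x\otimes h)=(x_1\otimes h_1)\otimes(x_2z\otimes h_2)$, and counit $\varepsilon(x\underline{\overline{\#}}h)=\varepsilon_L(x)\lambda(h)$ (the restriction of $\varepsilon_L\otimes\varepsilon_H$). *)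

theory Defs
  imports Main "HOL.Vector_Spaces" "HOL-Library.Function_Algebras"
begin

(* A k-space is a subspace "carrier V" of a vector space structure (the operation "scale V") on a
   whole type, as in HOL.Vector_Spaces. Explicit carriers are needed because the partial smash
   product is a proper subspace of a tensor product in general. *)

record ('k, 'v) vspace =
  carrier :: "'v set"
  scale :: "'k \<Rightarrow> 'v \<Rightarrow> 'v"  (infixr \<open>*s\<index>\<close> 75)

definition vspace :: "('k::field, 'v::ab_group_add, 'x) vspace_scheme \<Rightarrow> bool" where
  "vspace V \<longleftrightarrow> vector_space (scale V) \<and> module.subspace (scale V) (carrier V)"

definition finite_dim :: "('k::field, 'v::ab_group_add, 'x) vspace_scheme \<Rightarrow> bool" where
  "finite_dim V \<longleftrightarrow> (\<exists>B. finite B \<and> B \<subseteq> carrier V \<and> module.span (scale V) B = carrier V)"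

definition ground :: "('k::field, 'k) vspace" where
  "ground = \<lparr>carrier = UNIV, scale = (*)\<rparr>"

definition linear_on ::
  "('k::field, 'v::ab_group_add, 'x) vspace_scheme \<Rightarrow> ('k, 'w::ab_group_add, 'y) vspace_scheme \<Rightarrow>
   ('v \<Rightarrow> 'w) \<Rightarrow> bool" where
  "linear_on V W f \<longleftrightarrow>
     (\<forall>v \<in> carrier V. f v \<in> carrier W) \<and>
     (\<forall>v \<in> carrier V. \<forall>v' \<in> carrier V. f (v + v') = f v + f v') \<and>
     (\<forall>c. \<forall>v \<in> carrier V. f (c *s\<^bsub>V\<^esub> v) = c *s\<^bsub>W\<^esub> f v)"

definition bilinear_on ::
  "('k::field, 'v::ab_group_add, 'x) vspace_scheme \<Rightarrow> ('k, 'w::ab_group_add, 'y) vspace_scheme \<Rightarrow>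
   ('k, 'u::ab_group_add, 'z) vspace_scheme \<Rightarrow> ('v \<Rightarrow> 'w \<Rightarrow> 'u) \<Rightarrow> bool" where
  "bilinear_on V W U f \<longleftrightarrow>
     (\<forall>w \<in> carrier W. linear_on V U (\<lambda>v. f v w)) \<and> (\<forall>v \<in> carrier V. linear_on W U (f v))"

(* Tensor products. Over a field, bilinear forms separate the points of a tensor product, so the
   tensor product is realised inside the dual of the space of bilinear forms: the pure tensor of v
   and w is evaluation at (v, w). Only the scalar multiplications of the ambient types enter the
   pure tensors, so for subspaces A of V and B of W the tensor product of A and B is literally a
   subspace of that of V and W. The universal property is proved below. *)

type_synonym ('k, 'v, 'w) tensor = "('v \<Rightarrow> 'w \<Rightarrow> 'k) \<Rightarrow> 'k"

definition tscale :: "'k::field \<Rightarrow> ('a \<Rightarrow> 'k) \<Rightarrow> ('a \<Rightarrow> 'k)" where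
  "tscale c t = (\<lambda>b. c * t b)"

definition bilinear_form ::
  "('k::field, 'v::ab_group_add, 'x) vspace_scheme \<Rightarrow> ('k, 'w::ab_group_add, 'y) vspace_scheme \<Rightarrow>
   ('v \<Rightarrow> 'w \<Rightarrow> 'k) \<Rightarrow> bool" where
  "bilinear_form V W b \<longleftrightarrow>
     (\<forall>w. Vector_Spaces.linear (scale V) (*) (\<lambda>v. b v w)) \<and>
     (\<forall>v. Vector_Spaces.linear (scale W) (*) (b v))"

definition tens ::
  "'v::ab_group_add \<Rightarrow> ('k::field, 'v, 'x) vspace_scheme \<Rightarrow> ('k, 'w, 'y) vspace_scheme \<Rightarrow>
   'w::ab_group_add \<Rightarrow> ('k, 'v, 'w) tensor"
  (\<open>(_ \<otimes>\<^bsub>_,_\<^esub> _)\<close> [66, 0, 0, 66] 65) where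
  "v \<otimes>\<^bsub>V,W\<^esub> w = (\<lambda>b. if bilinear_form V W b then b v w else 0)"

definition tensor_space ::
  "('k::field, 'v::ab_group_add, 'x) vspace_scheme \<Rightarrow> ('k, 'w::ab_group_add, 'y) vspace_scheme \<Rightarrow>
   ('k, ('k, 'v, 'w) tensor) vspace"  (infixr \<open>\<Otimes>\<close> 80) where
  "V \<Otimes> W = \<lparr>carrier = module.span tscale {v \<otimes>\<^bsub>V,W\<^esub> w | v w. v \<in> carrier V \<and> w \<in> carrier W},
             scale = tscale\<rparr>"

(* "tlift V W f t" is the value at t of the linear map on the tensor product of V and W induced by
   the bilinear map f: if t is the sum of the pure tensors of v_i and w_i, with v_i and w_i in the
   carriers, it is the sum of the f v_i w_i. It is meaningful only for f bilinear on the carriers;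
   lemma tlift_eq shows that the chosen representation is then irrelevant. *)

definition tlift ::
  "('k::field, 'v::ab_group_add, 'x) vspace_scheme \<Rightarrow> ('k, 'w::ab_group_add, 'y) vspace_scheme \<Rightarrow>
   ('v \<Rightarrow> 'w \<Rightarrow> 'u::ab_group_add) \<Rightarrow> ('k, 'v, 'w) tensor \<Rightarrow> 'u" where
  "tlift V W f t =
     (let ps = (SOME ps. set ps \<subseteq> carrier V \<times> carrier W \<and> t = (\<Sum>(v, w)\<leftarrow>ps. v \<otimes>\<^bsub>V,W\<^esub> w))
      in \<Sum>(v, w)\<leftarrow>ps. f v w)"

lemma vector_space_tscale: "vector_space tscale"
  by unfold_locales (auto simp: tscale_def fun_eq_iff algebra_simps)

lemma vector_space_field: "vector_space ((*) :: 'k::field \<Rightarrow> 'k \<Rightarrow> 'k)"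
  by unfold_locales (auto simp: algebra_simps)

lemma sum_list_fun_apply: "(\<Sum>x\<leftarrow>xs. f x) b = (\<Sum>x\<leftarrow>xs. f x b)"
  for f :: "'a \<Rightarrow> 'b \<Rightarrow> 'k::field"
  by (induction xs) auto

lemma subspace_projection:
  assumes "vspace V"
  obtains p where "Vector_Spaces.linear (scale V) (scale V) p"
    and "\<And>v. p v \<in> carrier V" and "\<And>v. v \<in> carrier V \<Longrightarrow> p v = v"
proof -
  interpret vector_space "scale V" using assms by (simp add: vspace_def)
  interpret vector_space_pair "scale V" "scale V" ..
  have "subspace (carrier V)" using assms by (simp add: vspace_def)
  from linear_exists_left_inverse_on[OF linear_id this]
  obtain p where "range p \<subseteq> carrier V" "\<forall>v \<in> carrier V. p (id v) = v"
    "Vector_Spaces.linear (scale V) (scale V) p" by auto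
  then show ?thesis by (intro that[of p]) auto
qed

lemma functional_separates:
  assumes "vector_space s" and "u \<noteq> 0"
  obtains g :: "'u::ab_group_add \<Rightarrow> 'k::field"
  where "Vector_Spaces.linear s (*) g" and "g u \<noteq> 0"
proof -
  interpret vector_space s by fact
  interpret k: vector_space "(*) :: 'k \<Rightarrow> 'k \<Rightarrow> 'k" by (rule vector_space_field)
  interpret vector_space_pair s "(*) :: 'k \<Rightarrow> 'k \<Rightarrow> 'k" ..
  have "independent {u}" using assms by simp
  from linear_independent_extend[OF this, of "\<lambda>_. 1"]
  show ?thesis using that by force
qed

lemma bilinear_on_sum_list_cong:
  assumes "vspace V" "vspace W" "vspace U" and f: "bilinear_on V W U f"
    and ps: "set ps \<subseteq> carrier V \<times> carrier W" and qs: "set qs \<subseteq> carrier V \<times> carrier W"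
    and eq: "(\<Sum>(v, w)\<leftarrow>ps. v \<otimes>\<^bsub>V,W\<^esub> w) = (\<Sum>(v, w)\<leftarrow>qs. v \<otimes>\<^bsub>V,W\<^esub> w)"
  shows "(\<Sum>(v, w)\<leftarrow>ps. f v w) = (\<Sum>(v, w)\<leftarrow>qs. f v w)"
proof (rule ccontr)
  assume "\<not> ?thesis"
  then have ne: "(\<Sum>(v, w)\<leftarrow>ps. f v w) - (\<Sum>(v, w)\<leftarrow>qs. f v w) \<noteq> 0" by simp
  have vV: "vector_space (scale V)" and vW: "vector_space (scale W)" and vU: "vector_space (scale U)"
    using assms by (auto simp: vspace_def)
  obtain g where g: "Vector_Spaces.linear (scale U) (*) g"
    and gne: "g ((\<Sum>(v, w)\<leftarrow>ps. f v w) - (\<Sum>(v, w)\<leftarrow>qs. f v w)) \<noteq> 0"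
    using functional_separates[OF vU ne] .
  interpret g: Vector_Spaces.linear "scale U" "(*)" g by fact
  obtain p where p: "Vector_Spaces.linear (scale V) (scale V) p" "\<And>v. p v \<in> carrier V"
    "\<And>v. v \<in> carrier V \<Longrightarrow> p v = v" using subspace_projection[OF assms(1)] by blast
  obtain q where q: "Vector_Spaces.linear (scale W) (scale W) q" "\<And>v. q v \<in> carrier W"
    "\<And>v. v \<in> carrier W \<Longrightarrow> q v = v" using subspace_projection[OF assms(2)] by blast
  interpret p: Vector_Spaces.linear "scale V" "scale V" p by fact
  interpret q: Vector_Spaces.linear "scale W" "scale W" q by fact
  define b where "b v w = g (f (p v) (q w))" for v w
  have b: "bilinear_form V W b"
    using f p(2) q(2) vV vW vector_space_field
    by (auto simp: bilinear_form_def linear_iff b_def bilinear_on_def linear_on_def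
        p.add q.add g.add p.scale q.scale g.scale)
  have val: "(\<Sum>(v, w)\<leftarrow>rs. v \<otimes>\<^bsub>V,W\<^esub> w) b = g (\<Sum>(v, w)\<leftarrow>rs. f v w)"
    if "set rs \<subseteq> carrier V \<times> carrier W" for rs
    using that by (induction rs) (auto simp: tens_def b b_def p q g.add)
  show False using gne val[OF ps] val[OF qs] eq by (simp add: g.diff)
qed

lemma tlift_eq:
  assumes "vspace V" "vspace W" "vspace U" and "bilinear_on V W U f"
    and "set ps \<subseteq> carrier V \<times> carrier W"
  shows "tlift V W f (\<Sum>(v, w)\<leftarrow>ps. v \<otimes>\<^bsub>V,W\<^esub> w) = (\<Sum>(v, w)\<leftarrow>ps. f v w)"
proof -
  define qs where "qs = (SOME qs. set qs \<subseteq> carrier V \<times> carrier W \<and>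
    (\<Sum>(v, w)\<leftarrow>ps. v \<otimes>\<^bsub>V,W\<^esub> w) = (\<Sum>(v, w)\<leftarrow>qs. v \<otimes>\<^bsub>V,W\<^esub> w))"
  have qs: "set qs \<subseteq> carrier V \<times> carrier W \<and>
    (\<Sum>(v, w)\<leftarrow>ps. v \<otimes>\<^bsub>V,W\<^esub> w) = (\<Sum>(v, w)\<leftarrow>qs. v \<otimes>\<^bsub>V,W\<^esub> w)"
    unfolding qs_def by (rule someI[of _ ps]) (use assms(5) in simp)
  have "tlift V W f (\<Sum>(v, w)\<leftarrow>ps. v \<otimes>\<^bsub>V,W\<^esub> w) = (\<Sum>(v, w)\<leftarrow>qs. f v w)"
    by (simp add: tlift_def qs_def Let_def)
  with bilinear_on_sum_list_cong[OF assms(1-4), of qs ps] qs assms(5) show ?thesis by simp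
qed

lemma tens_scale_left:
  assumes "vspace V" "vspace W"
  shows "(c *s\<^bsub>V\<^esub> v) \<otimes>\<^bsub>V,W\<^esub> w = tscale c (v \<otimes>\<^bsub>V,W\<^esub> w)"
  by (auto simp: tens_def tscale_def fun_eq_iff bilinear_form_def linear_iff)

lemma tensor_space_sum_list:
  fixes V :: "('k::field, 'v::ab_group_add, 'x) vspace_scheme"
    and W :: "('k, 'w::ab_group_add, 'y) vspace_scheme"
  assumes "vspace V" "vspace W"
  shows "t \<in> carrier (V \<Otimes> W) \<longleftrightarrow>
    (\<exists>ps. set ps \<subseteq> carrier V \<times> carrier W \<and> t = (\<Sum>(v, w)\<leftarrow>ps. v \<otimes>\<^bsub>V,W\<^esub> w))"
proof
  interpret t: vector_space "tscale :: 'k \<Rightarrow> ('k, 'v, 'w) tensor \<Rightarrow> _"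
    by (rule vector_space_tscale)
  assume "t \<in> carrier (V \<Otimes> W)"
  then have "t \<in> t.span {v \<otimes>\<^bsub>V,W\<^esub> w | v w. v \<in> carrier V \<and> w \<in> carrier W}"
    by (simp add: tensor_space_def)
  then show "\<exists>ps. set ps \<subseteq> carrier V \<times> carrier W \<and> t = (\<Sum>(v, w)\<leftarrow>ps. v \<otimes>\<^bsub>V,W\<^esub> w)"
  proof (induction rule: t.span_induct_alt)
    case base
    show ?case by (intro exI[of _ "[]"]) auto
  next
    case (step c x y)
    then obtain v w ps where *: "v \<in> carrier V" "w \<in> carrier W" "x = v \<otimes>\<^bsub>V,W\<^esub> w"
      "set ps \<subseteq> carrier V \<times> carrier W" "y = (\<Sum>(v, w)\<leftarrow>ps. v \<otimes>\<^bsub>V,W\<^esub> w)" by auto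
    have "c *s\<^bsub>V\<^esub> v \<in> carrier V"
      using assms(1) * by (auto simp: vspace_def module_iff_vector_space[symmetric] module.subspace_scale)
    then show ?case using * by (intro exI[of _ "(c *s\<^bsub>V\<^esub> v, w) # ps"]) (auto simp: tens_scale_left assms)
  qed
next
  interpret t: vector_space "tscale :: 'k \<Rightarrow> ('k, 'v, 'w) tensor \<Rightarrow> _"
    by (rule vector_space_tscale)
  assume "\<exists>ps. set ps \<subseteq> carrier V \<times> carrier W \<and> t = (\<Sum>(v, w)\<leftarrow>ps. v \<otimes>\<^bsub>V,W\<^esub> w)"
  then obtain ps where "set ps \<subseteq> carrier V \<times> carrier W" "t = (\<Sum>(v, w)\<leftarrow>ps. v \<otimes>\<^bsub>V,W\<^esub> w)" by auto
  then show "t \<in> carrier (V \<Otimes> W)"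
    unfolding tensor_space_def
    by (induction ps arbitrary: t) (auto simp: t.span_zero intro!: t.span_add intro: t.span_base)
qed

lemma vspace_tensor_space: "vspace (V \<Otimes> W)"
  using vector_space_tscale
  by (auto simp: vspace_def tensor_space_def module_iff_vector_space[symmetric] module.subspace_span)

lemma bilinear_on_tens:
  assumes "vspace V" "vspace W"
  shows "bilinear_on V W (V \<Otimes> W) (\<lambda>v w. v \<otimes>\<^bsub>V,W\<^esub> w)"
proof -
  have "v \<otimes>\<^bsub>V,W\<^esub> w \<in> carrier (V \<Otimes> W)" if "v \<in> carrier V" "w \<in> carrier W" for v w
    unfolding tensor_space_sum_list[OF assms] using that by (intro exI[of _ "[(v, w)]"]) auto
  then show ?thesis
    by (auto simp: bilinear_on_def linear_on_def tensor_space_def tens_def tscale_def fun_eq_iff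
        bilinear_form_def linear_iff)
qed

theorem tensor_universal_property:
  assumes "vspace V" "vspace W" "vspace U" and f: "bilinear_on V W U f"
  shows "linear_on (V \<Otimes> W) U (tlift V W f)"
    and "\<And>v w. v \<in> carrier V \<Longrightarrow> w \<in> carrier W \<Longrightarrow> tlift V W f (v \<otimes>\<^bsub>V,W\<^esub> w) = f v w"
proof -
  note eq = tlift_eq[OF assms]
  show *: "tlift V W f (v \<otimes>\<^bsub>V,W\<^esub> w) = f v w" if "v \<in> carrier V" "w \<in> carrier W" for v w
    using eq[of "[(v, w)]"] that by simp
  have mU: "module (scale U)" "module.subspace (scale U) (carrier U)"
    and mV: "module (scale V)" "module.subspace (scale V) (carrier V)"
    using assms by (auto simp: vspace_def module_iff_vector_space)
  have fin: "f v w \<in> carrier U" if "v \<in> carrier V" "w \<in> carrier W" for v w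
    using f that by (auto simp: bilinear_on_def linear_on_def)
  show "linear_on (V \<Otimes> W) U (tlift V W f)"
    unfolding linear_on_def
  proof (intro conjI ballI allI)
    fix t assume "t \<in> carrier (V \<Otimes> W)"
    then obtain ps where ps: "set ps \<subseteq> carrier V \<times> carrier W" "t = (\<Sum>(v, w)\<leftarrow>ps. v \<otimes>\<^bsub>V,W\<^esub> w)"
      using tensor_space_sum_list[OF assms(1,2)] by blast
    have "(\<Sum>(v, w)\<leftarrow>ps. f v w) \<in> carrier U"
      using ps(1) by (induction ps)
        (auto simp: module.subspace_0[OF mU] intro!: module.subspace_add[OF mU] fin)
    then show "tlift V W f t \<in> carrier U" using eq[OF ps(1)] ps(2) by simp
  next
    fix s t assume "s \<in> carrier (V \<Otimes> W)" "t \<in> carrier (V \<Otimes> W)"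
    then obtain ps qs where ps: "set ps \<subseteq> carrier V \<times> carrier W" "s = (\<Sum>(v, w)\<leftarrow>ps. v \<otimes>\<^bsub>V,W\<^esub> w)"
      and qs: "set qs \<subseteq> carrier V \<times> carrier W" "t = (\<Sum>(v, w)\<leftarrow>qs. v \<otimes>\<^bsub>V,W\<^esub> w)"
      using tensor_space_sum_list[OF assms(1,2)] by metis
    show "tlift V W f (s + t) = tlift V W f s + tlift V W f t"
      using eq[of "ps @ qs"] eq[OF ps(1)] eq[OF qs(1)] ps qs by simp
  next
    fix c t assume "t \<in> carrier (V \<Otimes> W)"
    then obtain ps where ps: "set ps \<subseteq> carrier V \<times> carrier W" "t = (\<Sum>(v, w)\<leftarrow>ps. v \<otimes>\<^bsub>V,W\<^esub> w)"
      using tensor_space_sum_list[OF assms(1,2)] by blast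
    define qs where "qs = map (\<lambda>(v, w). (c *s\<^bsub>V\<^esub> v, w)) ps"
    have qs: "set qs \<subseteq> carrier V \<times> carrier W"
      using ps(1) by (auto simp: qs_def intro!: module.subspace_scale[OF mV])
    have "tscale c t = (\<Sum>(v, w)\<leftarrow>qs. v \<otimes>\<^bsub>V,W\<^esub> w)"
      unfolding qs_def ps(2)
      by (induction ps) (auto simp: tens_scale_left assms tscale_def fun_eq_iff algebra_simps)
    moreover have "(\<Sum>(v, w)\<leftarrow>qs. f v w) = c *s\<^bsub>U\<^esub> (\<Sum>(v, w)\<leftarrow>ps. f v w)"
      unfolding qs_def using ps(1) f
      by (induction ps) (auto simp: module.scale_zero_right[OF mU(1)]
          module.scale_right_distrib[OF mU(1)] bilinear_on_def linear_on_def)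
    ultimately show "tlift V W f (c *s\<^bsub>V \<Otimes> W\<^esub> t) = c *s\<^bsub>U\<^esub> tlift V W f t"
      using eq[OF qs] eq[OF ps(1)] ps(2) by (simp add: tensor_space_def)
  qed
qed

(* A single record type carries the data of algebras, coalgebras and Hopf algebras; each
   predicate below only looks at the components it needs. *)

record ('k, 'v) hopf_data = "('k, 'v) vspace" +
  mult :: "'v \<Rightarrow> 'v \<Rightarrow> 'v"  (infixl \<open>\<cdot>\<index>\<close> 70)
  one :: "'v"  (\<open>\<one>\<index>\<close>)
  comult :: "'v \<Rightarrow> ('k, 'v, 'v) tensor"  (\<open>\<Delta>\<index>\<close>)
  counit :: "'v \<Rightarrow> 'k"  (\<open>\<epsilon>\<index>\<close>)

definition algebra :: "('k::field, 'v::ab_group_add, 'x) hopf_data_scheme \<Rightarrow> bool" where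
  "algebra A \<longleftrightarrow> vspace A \<and> bilinear_on A A A (mult A) \<and>
     (\<forall>a \<in> carrier A. \<forall>b \<in> carrier A. \<forall>c \<in> carrier A. (a \<cdot>\<^bsub>A\<^esub> b) \<cdot>\<^bsub>A\<^esub> c = a \<cdot>\<^bsub>A\<^esub> (b \<cdot>\<^bsub>A\<^esub> c)) \<and>
     \<one>\<^bsub>A\<^esub> \<in> carrier A \<and> (\<forall>a \<in> carrier A. \<one>\<^bsub>A\<^esub> \<cdot>\<^bsub>A\<^esub> a = a \<and> a \<cdot>\<^bsub>A\<^esub> \<one>\<^bsub>A\<^esub> = a)"

(* Sweedler notation: "sweedler C c (\<lambda>c1 c2. f c1 c2)" is the sum of the f(c_1, c_2). *)

definition sweedler ::
  "('k::field, 'v::ab_group_add, 'x) hopf_data_scheme \<Rightarrow> 'v \<Rightarrow> ('v \<Rightarrow> 'v \<Rightarrow> 'u::ab_group_add) \<Rightarrow> 'u" where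
  "sweedler C c f = tlift C C f (\<Delta>\<^bsub>C\<^esub> c)"

definition sweedler4 ::
  "('k::field, 'v::ab_group_add, 'x) hopf_data_scheme \<Rightarrow> 'v \<Rightarrow>
   ('v \<Rightarrow> 'v \<Rightarrow> 'v \<Rightarrow> 'v \<Rightarrow> 'u::ab_group_add) \<Rightarrow> 'u" where
  "sweedler4 C c f =
     sweedler C c (\<lambda>c1 r. sweedler C r (\<lambda>c2 r'. sweedler C r' (\<lambda>c3 c4. f c1 c2 c3 c4)))"

definition coalgebra :: "('k::field, 'v::ab_group_add, 'x) hopf_data_scheme \<Rightarrow> bool" where
  "coalgebra C \<longleftrightarrow> vspace C \<and> linear_on C (C \<Otimes> C) (comult C) \<and> linear_on C ground (counit C) \<and>
     (\<forall>c \<in> carrier C.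
        sweedler C c (\<lambda>a b. sweedler C a (\<lambda>a1 a2. a1 \<otimes>\<^bsub>C, C \<Otimes> C\<^esub> (a2 \<otimes>\<^bsub>C,C\<^esub> b))) =
        sweedler C c (\<lambda>a b. sweedler C b (\<lambda>b1 b2. a \<otimes>\<^bsub>C, C \<Otimes> C\<^esub> (b1 \<otimes>\<^bsub>C,C\<^esub> b2)))) \<and>
     (\<forall>c \<in> carrier C. sweedler C c (\<lambda>a b. \<epsilon>\<^bsub>C\<^esub> a *s\<^bsub>C\<^esub> b) = c \<and>
                      sweedler C c (\<lambda>a b. \<epsilon>\<^bsub>C\<^esub> b *s\<^bsub>C\<^esub> a) = c)"

definition tensor_mult ::
  "('k::field, 'v::ab_group_add, 'x) hopf_data_scheme \<Rightarrow> ('k, 'w::ab_group_add, 'y) hopf_data_scheme \<Rightarrow>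
   ('k, 'v, 'w) tensor \<Rightarrow> ('k, 'v, 'w) tensor \<Rightarrow> ('k, 'v, 'w) tensor" where
  "tensor_mult A B s t =
     tlift A B (\<lambda>a b. tlift A B (\<lambda>a' b'. (a \<cdot>\<^bsub>A\<^esub> a') \<otimes>\<^bsub>A,B\<^esub> (b \<cdot>\<^bsub>B\<^esub> b')) t) s"

definition bialgebra :: "('k::field, 'v::ab_group_add, 'x) hopf_data_scheme \<Rightarrow> bool" where
  "bialgebra H \<longleftrightarrow> algebra H \<and> coalgebra H \<and>
     (\<forall>h \<in> carrier H. \<forall>g \<in> carrier H.
        \<Delta>\<^bsub>H\<^esub> (h \<cdot>\<^bsub>H\<^esub> g) = tensor_mult H H (\<Delta>\<^bsub>H\<^esub> h) (\<Delta>\<^bsub>H\<^esub> g) \<and> \<epsilon>\<^bsub>H\<^esub> (h \<cdot>\<^bsub>H\<^esub> g) = \<epsilon>\<^bsub>H\<^esub> h * \<epsilon>\<^bsub>H\<^esub> g) \<and>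
     \<Delta>\<^bsub>H\<^esub> \<one>\<^bsub>H\<^esub> = \<one>\<^bsub>H\<^esub> \<otimes>\<^bsub>H,H\<^esub> \<one>\<^bsub>H\<^esub> \<and> \<epsilon>\<^bsub>H\<^esub> \<one>\<^bsub>H\<^esub> = 1"

definition hopf_algebra :: "('k::field, 'v::ab_group_add, 'x) hopf_data_scheme \<Rightarrow> bool" where
  "hopf_algebra H \<longleftrightarrow> bialgebra H \<and>
     (\<exists>S. linear_on H H S \<and>
        (\<forall>h \<in> carrier H. sweedler H h (\<lambda>h1 h2. S h1 \<cdot>\<^bsub>H\<^esub> h2) = \<epsilon>\<^bsub>H\<^esub> h *s\<^bsub>H\<^esub> \<one>\<^bsub>H\<^esub> \<and>
                         sweedler H h (\<lambda>h1 h2. h1 \<cdot>\<^bsub>H\<^esub> S h2) = \<epsilon>\<^bsub>H\<^esub> h *s\<^bsub>H\<^esub> \<one>\<^bsub>H\<^esub>))"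

definition left_integrals :: "('k::field, 'v::ab_group_add, 'x) hopf_data_scheme \<Rightarrow> 'v set" where
  "left_integrals H = {t \<in> carrier H. \<forall>h \<in> carrier H. h \<cdot>\<^bsub>H\<^esub> t = \<epsilon>\<^bsub>H\<^esub> h *s\<^bsub>H\<^esub> t}"

definition right_integrals :: "('k::field, 'v::ab_group_add, 'x) hopf_data_scheme \<Rightarrow> 'v set" where
  "right_integrals H = {t \<in> carrier H. \<forall>h \<in> carrier H. t \<cdot>\<^bsub>H\<^esub> h = \<epsilon>\<^bsub>H\<^esub> h *s\<^bsub>H\<^esub> t}"

definition left_ideal :: "('k::field, 'v::ab_group_add, 'x) hopf_data_scheme \<Rightarrow> 'v set \<Rightarrow> bool" where
  "left_ideal A I \<longleftrightarrow> I \<subseteq> carrier A \<and> module.subspace (scale A) I \<and>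
     (\<forall>a \<in> carrier A. \<forall>x \<in> I. a \<cdot>\<^bsub>A\<^esub> x \<in> I)"

(* The left regular module is semisimple: every submodule is a direct summand. *)

definition semisimple :: "('k::field, 'v::ab_group_add, 'x) hopf_data_scheme \<Rightarrow> bool" where
  "semisimple A \<longleftrightarrow>
     (\<forall>I. left_ideal A I \<longrightarrow>
        (\<exists>J. left_ideal A J \<and> I \<inter> J = {0} \<and> carrier A = {x + y | x y. x \<in> I \<and> y \<in> J}))"

(* e is a separability idempotent: m(e) = 1 and a e = e a for all a. *)

definition separable :: "('k::field, 'v::ab_group_add, 'x) hopf_data_scheme \<Rightarrow> bool" where
  "separable A \<longleftrightarrow>
     (\<exists>e \<in> carrier (A \<Otimes> A). tlift A A (mult A) e = \<one>\<^bsub>A\<^esub> \<and>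
        (\<forall>a \<in> carrier A. tlift A A (\<lambda>x y. (a \<cdot>\<^bsub>A\<^esub> x) \<otimes>\<^bsub>A,A\<^esub> y) e = tlift A A (\<lambda>x y. x \<otimes>\<^bsub>A,A\<^esub> (y \<cdot>\<^bsub>A\<^esub> a)) e))"

definition left_partial_module_algebra ::
  "('k::field, 'h::ab_group_add, 'x) hopf_data_scheme \<Rightarrow> ('k, 'a::ab_group_add, 'y) hopf_data_scheme \<Rightarrow>
   ('h \<Rightarrow> 'a \<Rightarrow> 'a) \<Rightarrow> bool" where
  "left_partial_module_algebra H A act \<longleftrightarrow> algebra A \<and> bilinear_on H A A act \<and>
     (\<forall>a \<in> carrier A. act \<one>\<^bsub>H\<^esub> a = a) \<and>
     (\<forall>h \<in> carrier H. \<forall>a \<in> carrier A. \<forall>b \<in> carrier A.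
        act h (a \<cdot>\<^bsub>A\<^esub> b) = sweedler H h (\<lambda>h1 h2. act h1 a \<cdot>\<^bsub>A\<^esub> act h2 b)) \<and>
     (\<forall>h \<in> carrier H. \<forall>g \<in> carrier H. \<forall>a \<in> carrier A.
        act h (act g a) = sweedler H h (\<lambda>h1 h2. act h1 \<one>\<^bsub>A\<^esub> \<cdot>\<^bsub>A\<^esub> act (h2 \<cdot>\<^bsub>H\<^esub> g) a))"

(* Triple tensor products are bracketed to the left here and in partial_matched_pair; cij stands
   for the component j of the coaction on c_i, so that c10, c11 represent the coaction on c_1. *)

definition right_partial_comodule_coalgebra ::
  "('k::field, 'l::ab_group_add, 'x) hopf_data_scheme \<Rightarrow> ('k, 'c::ab_group_add, 'y) hopf_data_scheme \<Rightarrow>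
   ('c \<Rightarrow> ('k, 'c, 'l) tensor) \<Rightarrow> bool" where
  "right_partial_comodule_coalgebra L C \<rho> \<longleftrightarrow> coalgebra C \<and> linear_on C (C \<Otimes> L) \<rho> \<and>
     (\<forall>c \<in> carrier C. tlift C L (\<lambda>c0 c1. \<epsilon>\<^bsub>L\<^esub> c1 *s\<^bsub>C\<^esub> c0) (\<rho> c) = c) \<and>
     (\<forall>c \<in> carrier C.
        tlift C L (\<lambda>c0 c1. \<Delta>\<^bsub>C\<^esub> c0 \<otimes>\<^bsub>C \<Otimes> C, L\<^esub> c1) (\<rho> c) =
        sweedler C c (\<lambda>c1 c2. tlift C L (\<lambda>c10 c11. tlift C L (\<lambda>c20 c21.
          (c10 \<otimes>\<^bsub>C,C\<^esub> c20) \<otimes>\<^bsub>C \<Otimes> C, L\<^esub> (c11 \<cdot>\<^bsub>L\<^esub> c21)) (\<rho> c2)) (\<rho> c1))) \<and>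
     (\<forall>c \<in> carrier C.
        tlift C L (\<lambda>c0 c1. \<rho> c0 \<otimes>\<^bsub>C \<Otimes> L, L\<^esub> c1) (\<rho> c) =
        sweedler C c (\<lambda>c1 c2. tlift C L (\<lambda>c10 c11. tlift C L (\<lambda>c20 c21.
          sweedler L c11 (\<lambda>x1 x2.
            (c10 \<otimes>\<^bsub>C,L\<^esub> x1) \<otimes>\<^bsub>C \<Otimes> L, L\<^esub> (\<epsilon>\<^bsub>C\<^esub> c20 *s\<^bsub>L\<^esub> (x2 \<cdot>\<^bsub>L\<^esub> c21)))) (\<rho> c2)) (\<rho> c1)))"

definition partial_matched_pair ::
  "('k::field, 'h::ab_group_add, 'x) hopf_data_scheme \<Rightarrow> ('k, 'l::ab_group_add, 'y) hopf_data_scheme \<Rightarrow>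
   ('h \<Rightarrow> 'l \<Rightarrow> 'l) \<Rightarrow> ('h \<Rightarrow> ('k, 'h, 'l) tensor) \<Rightarrow> bool" where
  "partial_matched_pair H L act \<rho> \<longleftrightarrow>
     left_partial_module_algebra H L act \<and>
     right_partial_comodule_coalgebra L H \<rho> \<and>
     (\<forall>h \<in> carrier H. \<forall>g \<in> carrier H. \<forall>x \<in> carrier L.
        sweedler H h (\<lambda>h1 h2. sweedler L (act h1 x) (\<lambda>y1 y2. tlift H L (\<lambda>u0 u1.
          (u0 \<otimes>\<^bsub>H,L\<^esub> y1) \<otimes>\<^bsub>H \<Otimes> L, L\<^esub> (y2 \<cdot>\<^bsub>L\<^esub> u1)) (\<rho> (h2 \<cdot>\<^bsub>H\<^esub> g)))) =
        sweedler4 H h (\<lambda>h1 h2 h3 h4. sweedler L x (\<lambda>x1 x2.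
          tlift H L (\<lambda>h10 h11. tlift H L (\<lambda>h30 h31. tlift H L (\<lambda>g0 g1.
            ((h30 \<cdot>\<^bsub>H\<^esub> g0) \<otimes>\<^bsub>H,L\<^esub> act h10 x1) \<otimes>\<^bsub>H \<Otimes> L, L\<^esub>
              (h11 \<cdot>\<^bsub>L\<^esub> act h2 x2 \<cdot>\<^bsub>L\<^esub> h31 \<cdot>\<^bsub>L\<^esub> act h4 g1)) (\<rho> g)) (\<rho> h3)) (\<rho> h1)))) \<and>
     (\<forall>h \<in> carrier H. \<forall>x \<in> carrier L. \<epsilon>\<^bsub>L\<^esub> (act h x) = \<epsilon>\<^bsub>L\<^esub> (act h \<one>\<^bsub>L\<^esub>) * \<epsilon>\<^bsub>L\<^esub> x) \<and>
     \<rho> \<one>\<^bsub>H\<^esub> = tlift H L (\<lambda>u0 u1. \<one>\<^bsub>H\<^esub> \<otimes>\<^bsub>H,L\<^esub> (\<epsilon>\<^bsub>H\<^esub> u0 *s\<^bsub>L\<^esub> u1)) (\<rho> \<one>\<^bsub>H\<^esub>)"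

(* All operations are given on the whole of the tensor product of L and H, as in the formulas they
   are restrictions of; only the carrier is cut down. Since pure tensors depend on the scalar
   multiplication alone, comult takes values in the type required of comultiplications on it. *)

definition partial_smash ::
  "('k::field, 'l::ab_group_add, 'x) hopf_data_scheme \<Rightarrow> ('k, 'h::ab_group_add, 'y) hopf_data_scheme \<Rightarrow>
   ('h \<Rightarrow> 'k) \<Rightarrow> 'l \<Rightarrow> ('k, ('k, 'l, 'h) tensor) hopf_data" where
  "partial_smash L H lam z =
     \<lparr>carrier = module.span tscale
        {sweedler H h (\<lambda>h1 h2. (lam h1 *s\<^bsub>L\<^esub> (x \<cdot>\<^bsub>L\<^esub> z)) \<otimes>\<^bsub>L,H\<^esub> h2) | x h. x \<in> carrier L \<and> h \<in> carrier H},
      scale = tscale,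
      mult = (\<lambda>s t. tlift L H (\<lambda>x h. tlift L H (\<lambda>y g.
        sweedler H h (\<lambda>h1 h2. (lam h1 *s\<^bsub>L\<^esub> (x \<cdot>\<^bsub>L\<^esub> y)) \<otimes>\<^bsub>L,H\<^esub> (h2 \<cdot>\<^bsub>H\<^esub> g))) t) s),
      one = z \<otimes>\<^bsub>L,H\<^esub> \<one>\<^bsub>H\<^esub>,
      comult = tlift L H (\<lambda>x h. sweedler L x (\<lambda>x1 x2. sweedler H h (\<lambda>h1 h2.
        (x1 \<otimes>\<^bsub>L,H\<^esub> h1) \<otimes>\<^bsub>L \<Otimes> H, L \<Otimes> H\<^esub> ((x2 \<cdot>\<^bsub>L\<^esub> z) \<otimes>\<^bsub>L,H\<^esub> h2)))),
      counit = tlift L H (\<lambda>x h. \<epsilon>\<^bsub>L\<^esub> x * \<epsilon>\<^bsub>H\<^esub> h)\<rparr>"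

end

theory Submission
  imports Defs
begin

text \<open>
The partial smash product is, as a set and with all its operations, the tensor product
\<open>M \<otimes> B\<close> of a quotient Hopf algebra \<open>M\<close> of \<open>L\<close> and a Hopf subalgebra \<open>B\<close> of \<open>H\<close>; the theorem
is a statement about integrals of these two factors.

Put \<open>E h = \<lambda>(h\<^sub>1) h\<^sub>2\<close>. The multiplicative axiom of \<open>\<lambda>\<close> makes \<open>E\<close> idempotent and gives
\<open>E (E h g) = E h E g\<close>. The compatibility condition of the matched pair at \<open>g = 1\<close>, \<open>x = 1\<close> says
\<open>\<lambda>(h\<^sub>1) h\<^sub>2 = \<lambda>(h\<^sub>1) h\<^sub>2 \<lambda>(h\<^sub>3)\<close>, and this is what is needed for
\<open>\<Delta> (E h) = E h\<^sub>1 \<otimes> E h\<^sub>2\<close>. So \<open>B = E H\<close> is a sub-bialgebra; it is stable under the antipode because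
\<open>E \<circ> S\<close> is a second convolution inverse of the inclusion of \<open>B\<close> in \<open>H\<close> (lemma \<open>hopf_B\<close>). Dually, the
condition at \<open>h = g = 1\<close> gives \<open>z x z = x z\<close>, so that \<open>\<pi> x = x z\<close> is multiplicative, and
\<open>z \<otimes> z = \<Delta>(z) (1 \<otimes> z)\<close> makes \<open>M = L z\<close> a quotient Hopf algebra of \<open>L\<close> (lemma \<open>hopf_M\<close>). The
spanning elements \<open>\<lambda>(h\<^sub>1) x z \<otimes> h\<^sub>2\<close> of the smash product are the \<open>\<pi> x \<otimes> E h\<close> (lemma \<open>hopf_P\<close>).

For every Hopf algebra, semisimplicity and separability are both equivalent to the existence of a
left integral \<open>t\<close> with \<open>\<epsilon> t = 1\<close>, by Maschke's argument with the separability idempotent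
\<open>t\<^sub>1 \<otimes> S t\<^sub>2\<close> (lemma \<open>semisimple_separable_integral\<close>). Such an integral exists in \<open>M \<otimes> B\<close> if and only
if there is one in \<open>M\<close> and one in \<open>B\<close>. An integral of \<open>M\<close> is an integral of \<open>L\<close>, since \<open>x\<close> and
\<open>x z\<close> act alike on \<open>L z\<close> from the left, and \<open>\<pi>\<close> maps integrals of \<open>L\<close> to integrals of \<open>M\<close>.

For \<open>B\<close> one direction is easy: \<open>E\<close> maps a left integral \<open>t\<close> of \<open>H\<close> to a left integral of \<open>B\<close> with
\<open>\<epsilon> (E t) = \<lambda> t\<close>. Right integrals and the converse need the theorem of Larson and Sweedler. A trace
formula produces a functional \<open>\<phi> \<noteq> 0\<close> with \<open>x\<^sub>1 \<phi>(x\<^sub>2) = \<phi>(x) 1\<close>; the form \<open>\<phi> (x S h)\<close> is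
nondegenerate, so \<open>S\<close> is bijective and some left integral \<open>t\<close> has \<open>\<phi> t = 1\<close>. Bijectivity yields
\<open>S B = B\<close>, hence \<open>\<lambda> \<circ> S = \<lambda>\<close> (lemma \<open>lam_S\<close>), and \<open>S\<close> turns right integrals into left ones with the
same value of \<open>\<lambda>\<close>. Finally \<open>\<phi> (E t) = \<lambda>(1) \<phi>(t) = 1\<close> shows \<open>E t \<noteq> 0\<close>; if \<open>l\<close> is a left integral of
\<open>B\<close> with \<open>\<epsilon> l = 1\<close>, then \<open>S l \<cdot> E t\<close> equals both \<open>E t\<close> and \<open>\<lambda>(t) S l\<close>, so \<open>\<lambda> t \<noteq> 0\<close>
(lemma \<open>exists_integral_lam_ne_0\<close>).
\<close>

text \<open>
Two collections of rules for the simplifier: \<open>lin\<close> proves that a map built from the given operations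
is linear, \<open>mem\<close> that an element lies in a carrier. Together they discharge the side conditions of the
Sweedler calculus.
\<close>

named_theorems lin
named_theorems mem

section \<open>Linear and multilinear maps on carriers\<close>

lemma vspaceD:
  fixes V (structure)
  assumes "vspace V"
  shows "0 \<in> carrier V"
    and "a \<in> carrier V \<Longrightarrow> b \<in> carrier V \<Longrightarrow> a + b \<in> carrier V"
    and "a \<in> carrier V \<Longrightarrow> b \<in> carrier V \<Longrightarrow> a - b \<in> carrier V"
    and "a \<in> carrier V \<Longrightarrow> - a \<in> carrier V"
    and "a \<in> carrier V \<Longrightarrow> c *s a \<in> carrier V"
    and "c *s (x + y) = c *s x + c *s y"
    and "(c + d) *s x = c *s x + d *s x"
    and "c *s (d *s x) = (c * d) *s x"
    and "1 *s x = x" and "c *s 0 = 0" and "0 *s x = 0"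
  using assms unfolding vspace_def module_iff_vector_space[symmetric]
  by (auto simp: module.subspace_0 module.subspace_add module.subspace_diff module.subspace_neg
      module.subspace_scale module.scale_right_distrib module.scale_left_distrib module.scale_scale
      module.scale_one module.scale_zero_right module.scale_zero_left)

lemmas [mem] = vspaceD(1-5)
lemmas [simp] = vspaceD(8-11)

lemma vspace_ground [simp]: "vspace (ground :: ('k::field, 'k) vspace)"
proof -
  have "module ((*) :: 'k \<Rightarrow> 'k \<Rightarrow> 'k)"
    using vector_space_field by (simp add: module_iff_vector_space)
  then show ?thesis
    using vector_space_field by (auto simp: vspace_def ground_def module.subspace_def)
qed

lemma ground_simps [simp]: "carrier ground = UNIV" "scale ground = (*)"
  by (simp_all add: ground_def)

lemmas vspace_tensor_space [simp]

lemma scale_tensor_space: "scale (V \<Otimes> W) = tscale" by (simp add: tensor_space_def)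

lemma linear_onI:
  assumes "\<And>v. v \<in> carrier V \<Longrightarrow> f v \<in> carrier W"
    and "\<And>v v'. v \<in> carrier V \<Longrightarrow> v' \<in> carrier V \<Longrightarrow> f (v + v') = f v + f v'"
    and "\<And>c v. v \<in> carrier V \<Longrightarrow> f (c *s\<^bsub>V\<^esub> v) = c *s\<^bsub>W\<^esub> f v"
  shows "linear_on V W f"
  using assms by (auto simp: linear_on_def)

lemma linear_onD:
  assumes "linear_on V W f"
  shows "v \<in> carrier V \<Longrightarrow> f v \<in> carrier W"
    and "v \<in> carrier V \<Longrightarrow> v' \<in> carrier V \<Longrightarrow> f (v + v') = f v + f v'"
    and "v \<in> carrier V \<Longrightarrow> f (c *s\<^bsub>V\<^esub> v) = c *s\<^bsub>W\<^esub> f v"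
  using assms by (auto simp: linear_on_def)

lemma linear_on_0: "linear_on V W f \<Longrightarrow> vspace V \<Longrightarrow> vspace W \<Longrightarrow> f 0 = 0"
  using linear_onD(3)[of V W f 0 0] by (simp add: mem)

lemma linear_on_diff:
  assumes "linear_on V W f" "vspace V" "v \<in> carrier V" "v' \<in> carrier V"
  shows "f (v - v') = f v - f v'"
  using linear_onD(2)[OF assms(1), of "v - v'" v'] assms by (simp add: mem)

lemma linear_on_compose:
  "linear_on V W g \<Longrightarrow> linear_on U V f \<Longrightarrow> linear_on U W (\<lambda>x. g (f x))"
  by (auto simp: linear_on_def)

lemma linear_on_id [lin]: "linear_on V V (\<lambda>x. x)" by (simp add: linear_on_def)

lemma linear_on_scale_const [lin]:
  "vspace W \<Longrightarrow> linear_on V W f \<Longrightarrow> linear_on V W (\<lambda>x. c *s\<^bsub>W\<^esub> f x)"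
  by (auto simp: linear_on_def mem vspaceD mult.commute)

lemma linear_on_scale_fun [lin]:
  "vspace W \<Longrightarrow> w \<in> carrier W \<Longrightarrow> linear_on V ground f \<Longrightarrow> linear_on V W (\<lambda>x. f x *s\<^bsub>W\<^esub> w)"
  by (auto simp: linear_on_def mem vspaceD)

lemma linear_on_times [lin]:
  "linear_on V ground f \<Longrightarrow> linear_on V ground (\<lambda>x. c * f x)"
  "linear_on V ground f \<Longrightarrow> linear_on V ground (\<lambda>x. f x * c)"
  by (auto simp: linear_on_def algebra_simps)

lemmas [lin] = linear_on_times(1)[OF linear_on_id] linear_on_scale_const[OF _ linear_on_id]

lemma bilinear_onI [lin]:
  assumes "\<And>w. w \<in> carrier W \<Longrightarrow> linear_on V U (\<lambda>v. f v w)"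
    and "\<And>v. v \<in> carrier V \<Longrightarrow> linear_on W U (f v)"
  shows "bilinear_on V W U f"
  using assms by (simp add: bilinear_on_def)

lemma bilinear_onD:
  assumes "bilinear_on V W U f"
  shows "w \<in> carrier W \<Longrightarrow> linear_on V U (\<lambda>v. f v w)"
    and "v \<in> carrier V \<Longrightarrow> linear_on W U (f v)"
    and "v \<in> carrier V \<Longrightarrow> w \<in> carrier W \<Longrightarrow> f v w \<in> carrier U"
  using assms by (auto simp: bilinear_on_def linear_on_def)

lemma bilinear_on_compose:
  assumes "bilinear_on V W U f"
  shows "w \<in> carrier W \<Longrightarrow> linear_on X V g \<Longrightarrow> linear_on X U (\<lambda>x. f (g x) w)"
    and "v \<in> carrier V \<Longrightarrow> linear_on X W h \<Longrightarrow> linear_on X U (\<lambda>x. f v (h x))"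
  using assms unfolding bilinear_on_def linear_on_def by auto

lemma tens_in [mem]:
  "vspace V \<Longrightarrow> vspace W \<Longrightarrow> v \<in> carrier V \<Longrightarrow> w \<in> carrier W \<Longrightarrow> v \<otimes>\<^bsub>V,W\<^esub> w \<in> carrier (V \<Otimes> W)"
  using bilinear_onD(3)[OF bilinear_on_tens] by blast

lemma linear_on_tens [lin]:
  assumes "vspace V" "vspace W"
  shows "w \<in> carrier W \<Longrightarrow> linear_on X V g \<Longrightarrow> linear_on X (V \<Otimes> W) (\<lambda>x. g x \<otimes>\<^bsub>V,W\<^esub> w)"
    and "v \<in> carrier V \<Longrightarrow> linear_on X W h \<Longrightarrow> linear_on X (V \<Otimes> W) (\<lambda>x. v \<otimes>\<^bsub>V,W\<^esub> h x)"
  using bilinear_on_compose[OF bilinear_on_tens[OF assms]] by blast+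

lemmas linear_on_tens_left [lin] = linear_on_tens(2)[OF _ _ _ linear_on_id]

lemma tens_cong:
  "scale V = scale V' \<Longrightarrow> scale W = scale W' \<Longrightarrow> v \<otimes>\<^bsub>V,W\<^esub> w = v \<otimes>\<^bsub>V',W'\<^esub> w"
  by (simp add: tens_def bilinear_form_def)

text \<open>
One representation of a tensor by pure tensors, independent of the bilinear map applied to it. It
turns every application of \<open>tlift\<close> to a fixed tensor into a sum over one and the same list, so that
congruence, additivity and exchange of two such sums hold for arbitrary, not only bilinear, maps.
\<close>
definition tensor_rep where
  "tensor_rep V W t =
     (SOME ps. set ps \<subseteq> carrier V \<times> carrier W \<and> t = (\<Sum>(v, w)\<leftarrow>ps. v \<otimes>\<^bsub>V,W\<^esub> w))"

lemma tlift_tensor_rep: "tlift V W f t = (\<Sum>(v, w)\<leftarrow>tensor_rep V W t. f v w)"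
  by (simp add: tlift_def tensor_rep_def)

lemma tensor_rep:
  assumes "vspace V" "vspace W" "t \<in> carrier (V \<Otimes> W)"
  shows "set (tensor_rep V W t) \<subseteq> carrier V \<times> carrier W"
    and "t = (\<Sum>(v, w)\<leftarrow>tensor_rep V W t. v \<otimes>\<^bsub>V,W\<^esub> w)"
proof -
  have "\<exists>ps. set ps \<subseteq> carrier V \<times> carrier W \<and> t = (\<Sum>(v, w)\<leftarrow>ps. v \<otimes>\<^bsub>V,W\<^esub> w)"
    using tensor_space_sum_list[OF assms(1,2)] assms(3) by blast
  from someI_ex[OF this] show "set (tensor_rep V W t) \<subseteq> carrier V \<times> carrier W"
    and "t = (\<Sum>(v, w)\<leftarrow>tensor_rep V W t. v \<otimes>\<^bsub>V,W\<^esub> w)"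
    unfolding tensor_rep_def by blast+
qed

lemma tensor_rep_mem:
  assumes "vspace V" "vspace W" "t \<in> carrier (V \<Otimes> W)" "(v, w) \<in> set (tensor_rep V W t)"
  shows "v \<in> carrier V" "w \<in> carrier W"
  using tensor_rep(1)[OF assms(1-3)] assms(4) by auto

text \<open>
The memberships of \<open>v\<close> and \<open>w\<close> are offered under the conditions that imply them. This keeps the rule
itself free of side conditions, so that the simplifier can use it everywhere.
\<close>
lemma tlift_cong:
  assumes "s = t"
    and "\<And>v w. (vspace V \<and> vspace W \<and> t \<in> carrier (V \<Otimes> W) \<longrightarrow> v \<in> carrier V \<and> w \<in> carrier W) \<Longrightarrow>
             f v w = g v w"
  shows "tlift V W f s = tlift V W g t"
proof -
  have "f v w = g v w" if "(v, w) \<in> set (tensor_rep V W t)" for v w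
    by (rule assms(2)) (use tensor_rep(1)[of V W t] that in auto)
  then have "map (\<lambda>(v, w). f v w) (tensor_rep V W t) = map (\<lambda>(v, w). g v w) (tensor_rep V W t)" by auto
  then show ?thesis by (simp only: tlift_tensor_rep assms(1))
qed

lemma sum_list_in:
  assumes "vspace U" "\<And>x. x \<in> set xs \<Longrightarrow> f x \<in> carrier U"
  shows "sum_list (map f xs) \<in> carrier U"
  using assms(2) by (induction xs) (auto simp: mem assms(1))

lemma sum_list_linear_on:
  assumes "vspace U" "vspace X" "linear_on U X g" "\<And>x. x \<in> set xs \<Longrightarrow> f x \<in> carrier U"
  shows "g (sum_list (map f xs)) = sum_list (map (\<lambda>x. g (f x)) xs)"
  using assms(4)
proof (induction xs)
  case (Cons a xs)
  then have "sum_list (map f xs) \<in> carrier U" by (intro sum_list_in assms(1)) auto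
  with Cons show ?case by (simp add: linear_onD[OF assms(3)])
qed (use assms in \<open>simp add: linear_on_0\<close>)

lemma tlift_in [mem]:
  assumes "vspace V" "vspace W" "vspace U" "t \<in> carrier (V \<Otimes> W)"
    and "\<And>v w. v \<in> carrier V \<Longrightarrow> w \<in> carrier W \<Longrightarrow> f v w \<in> carrier U"
  shows "tlift V W f t \<in> carrier U"
  unfolding tlift_tensor_rep using tensor_rep_mem[OF assms(1,2,4)] by (auto intro!: sum_list_in assms(3,5))

lemma tlift_out:
  assumes "linear_on U X g" "vspace V" "vspace W" "vspace U" "vspace X" "t \<in> carrier (V \<Otimes> W)"
    and "\<And>v w. v \<in> carrier V \<Longrightarrow> w \<in> carrier W \<Longrightarrow> f v w \<in> carrier U"
  shows "g (tlift V W f t) = tlift V W (\<lambda>v w. g (f v w)) t"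
  unfolding tlift_tensor_rep
  using tensor_rep_mem[OF assms(2,3,6)]
  by (subst sum_list_linear_on[OF assms(4,5,1)]) (auto intro!: assms(7) simp: case_prod_beta')

lemma sum_list_swap_monoid:
  fixes f :: "'a \<Rightarrow> 'b \<Rightarrow> 'c::comm_monoid_add"
  shows "(\<Sum>x\<leftarrow>xs. \<Sum>y\<leftarrow>ys. f x y) = (\<Sum>y\<leftarrow>ys. \<Sum>x\<leftarrow>xs. f x y)"
  by (induction xs) (simp_all add: sum_list_addf)

lemma tlift_swap:
  "tlift V W (\<lambda>v w. tlift V' W' (f v w) t') t = tlift V' W' (\<lambda>v' w'. tlift V W (\<lambda>v w. f v w v' w') t) t'"
  unfolding tlift_tensor_rep case_prod_beta' by (rule sum_list_swap_monoid)

lemma tlift_sum: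
  "tlift V W (\<lambda>v w. \<Sum>i\<in>I. f i v w) t = (\<Sum>i\<in>I. tlift V W (f i) t)"
proof -
  have "(\<Sum>x\<leftarrow>xs. \<Sum>i\<in>I. f i (fst x) (snd x)) = (\<Sum>i\<in>I. \<Sum>x\<leftarrow>xs. f i (fst x) (snd x))" for xs
    by (induction xs) (simp_all add: sum.distrib)
  then show ?thesis unfolding tlift_tensor_rep case_prod_beta' .
qed

lemma tlift_add_fun:
  "tlift V W (\<lambda>v w. f v w + g v w) t = tlift V W f t + tlift V W g t"
  unfolding tlift_tensor_rep case_prod_beta' by (rule sum_list_addf)

lemma linear_on_tlift_arg [lin]:
  assumes "vspace V" "vspace W" "vspace X" "linear_on U (V \<Otimes> W) t"
    and "\<And>w. w \<in> carrier W \<Longrightarrow> linear_on V X (\<lambda>v. f v w)"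
    and "\<And>v. v \<in> carrier V \<Longrightarrow> linear_on W X (f v)"
  shows "linear_on U X (\<lambda>x. tlift V W f (t x))"
  by (rule linear_on_compose[OF tensor_universal_property(1)[OF assms(1-3)] assms(4)])
    (rule bilinear_onI[OF assms(5,6)])

lemma linear_on_tlift_fun [lin]:
  assumes "vspace V" "vspace W" "vspace X" "t \<in> carrier (V \<Otimes> W)"
    and "\<And>v w. v \<in> carrier V \<Longrightarrow> w \<in> carrier W \<Longrightarrow> linear_on U X (\<lambda>x. f x v w)"
  shows "linear_on U X (\<lambda>x. tlift V W (\<lambda>v w. f x v w) t)"
proof (rule linear_onI)
  fix v assume v: "v \<in> carrier U"
  show "tlift V W (f v) t \<in> carrier X"
    by (rule tlift_in[OF assms(1-4)]) (rule linear_onD(1)[OF assms(5) v])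
next
  fix v v' assume v: "v \<in> carrier U" "v' \<in> carrier U"
  have "tlift V W (f (v + v')) t = tlift V W (\<lambda>a b. f v a b + f v' a b) t"
    by (rule tlift_cong[OF refl]) (simp add: assms(1-4) linear_onD(2)[OF assms(5) v])
  then show "tlift V W (f (v + v')) t = tlift V W (f v) t + tlift V W (f v') t"
    by (simp add: tlift_add_fun)
next
  fix c v assume v: "v \<in> carrier U"
  have "tlift V W (f (c *s\<^bsub>U\<^esub> v)) t = tlift V W (\<lambda>a b. c *s\<^bsub>X\<^esub> f v a b) t"
    by (rule tlift_cong[OF refl]) (simp add: assms(1-4) linear_onD(3)[OF assms(5) v])
  also have "\<dots> = c *s\<^bsub>X\<^esub> tlift V W (f v) t"
    by (rule tlift_out[symmetric, OF linear_on_scale_const[OF assms(3) linear_on_id]])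
      (rule assms linear_onD(1)[OF assms(5) v] | assumption)+
  finally show "tlift V W (f (c *s\<^bsub>U\<^esub> v)) t = c *s\<^bsub>X\<^esub> tlift V W (f v) t" .
qed

lemmas tlift_tens = tensor_universal_property(2)

lemma tlift_ident:
  assumes "vspace V" "vspace W" "t \<in> carrier (V \<Otimes> W)"
  shows "tlift V W (\<lambda>v w. v \<otimes>\<^bsub>V,W\<^esub> w) t = t"
  unfolding tlift_tensor_rep using tensor_rep(2)[OF assms] by simp

lemma tlift_tlift:
  assumes "vspace V" "vspace W" "vspace X" "vspace Y" "vspace U" "bilinear_on X Y U g"
    "t \<in> carrier (V \<Otimes> W)"
    and "\<And>v w. v \<in> carrier V \<Longrightarrow> w \<in> carrier W \<Longrightarrow> f v w \<in> carrier (X \<Otimes> Y)"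
  shows "tlift X Y g (tlift V W f t) = tlift V W (\<lambda>v w. tlift X Y g (f v w)) t"
  by (rule tlift_out[OF tensor_universal_property(1)]) (use assms in auto)

text \<open>
The main tool for identities on a tensor product: check them on pure tensors.
\<close>
lemma tensor_ext:
  assumes "vspace V" "vspace W" "vspace U" "linear_on (V \<Otimes> W) U f" "linear_on (V \<Otimes> W) U g"
    "\<And>v w. v \<in> carrier V \<Longrightarrow> w \<in> carrier W \<Longrightarrow> f (v \<otimes>\<^bsub>V,W\<^esub> w) = g (v \<otimes>\<^bsub>V,W\<^esub> w)"
    "t \<in> carrier (V \<Otimes> W)"
  shows "f t = g t"
proof -
  have *: "h t = tlift V W (\<lambda>v w. h (v \<otimes>\<^bsub>V,W\<^esub> w)) t" if "linear_on (V \<Otimes> W) U h" for h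
    using tlift_out[OF that assms(1,2) _ assms(3,7), of "\<lambda>v w. v \<otimes>\<^bsub>V,W\<^esub> w"]
    by (simp add: tlift_ident assms mem)
  show ?thesis unfolding *[OF assms(4)] *[OF assms(5)]
    by (rule tlift_cong[OF refl]) (use assms in auto)
qed

text \<open>
A pure tensor depends on the scalar multiplications alone, so a tensor over two subspaces may be
evaluated in the ambient spaces.
\<close>
lemma tlift_mono:
  assumes "vspace V" "vspace W" "vspace V'" "vspace W'" "vspace U" "scale V = scale V'" "scale W = scale W'"
    "carrier V' \<subseteq> carrier V" "carrier W' \<subseteq> carrier W" "bilinear_on V W U f" "t \<in> carrier (V' \<Otimes> W')"
  shows "tlift V W f t = tlift V' W' f t"
proof -
  have t: "t = (\<Sum>(v, w)\<leftarrow>tensor_rep V' W' t. v \<otimes>\<^bsub>V,W\<^esub> w)"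
    unfolding tens_cong[OF assms(6,7)] by (rule tensor_rep(2)[OF assms(3,4,11)])
  have "tlift V W f t = tlift V W f (\<Sum>(v, w)\<leftarrow>tensor_rep V' W' t. v \<otimes>\<^bsub>V,W\<^esub> w)"
    by (rule arg_cong[OF t])
  also have "tlift V W f (\<Sum>(v, w)\<leftarrow>tensor_rep V' W' t. v \<otimes>\<^bsub>V,W\<^esub> w) = (\<Sum>(v, w)\<leftarrow>tensor_rep V' W' t. f v w)"
    by (rule tlift_eq) (use assms tensor_rep(1)[OF assms(3,4,11)] in auto)
  finally show ?thesis by (simp only: tlift_tensor_rep[of V' W'])
qed

section \<open>Algebras, coalgebras and Sweedler sums\<close>

lemma algebraD:
  fixes A (structure)
  assumes "algebra A"
  shows "vspace A" "bilinear_on A A A (mult A)" "\<one> \<in> carrier A"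
    "a \<in> carrier A \<Longrightarrow> b \<in> carrier A \<Longrightarrow> a \<cdot> b \<in> carrier A"
    "a \<in> carrier A \<Longrightarrow> b \<in> carrier A \<Longrightarrow> c \<in> carrier A \<Longrightarrow> (a \<cdot> b) \<cdot> c = a \<cdot> (b \<cdot> c)"
    "a \<in> carrier A \<Longrightarrow> \<one> \<cdot> a = a" "a \<in> carrier A \<Longrightarrow> a \<cdot> \<one> = a"
  using assms by (auto simp: algebra_def dest: bilinear_onD(3))

lemmas [simp] = algebraD(1,6,7)
lemmas [mem] = algebraD(3,4)

lemma linear_on_mult [lin]:
  "algebra A \<Longrightarrow> a \<in> carrier A \<Longrightarrow> linear_on V A f \<Longrightarrow> linear_on V A (\<lambda>x. f x \<cdot>\<^bsub>A\<^esub> a)"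
  "algebra A \<Longrightarrow> a \<in> carrier A \<Longrightarrow> linear_on V A f \<Longrightarrow> linear_on V A (\<lambda>x. a \<cdot>\<^bsub>A\<^esub> f x)"
  using bilinear_on_compose[OF algebraD(2)] by blast+

lemmas linear_on_mult_left [lin] = linear_on_mult(2)[OF _ _ linear_on_id]

lemma mult_scale:
  fixes A (structure)
  assumes "algebra A" "a \<in> carrier A" "b \<in> carrier A"
  shows "(c *s a) \<cdot> b = c *s (a \<cdot> b)" "a \<cdot> (c *s b) = c *s (a \<cdot> b)"
  using assms bilinear_onD(1,2)[OF algebraD(2)[OF assms(1)]] by (auto simp: linear_on_def)

lemma coalgebraD:
  fixes C (structure)
  assumes "coalgebra C"
  shows "vspace C" "linear_on C (C \<Otimes> C) (comult C)" "linear_on C ground (counit C)"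
    "c \<in> carrier C \<Longrightarrow> \<Delta> c \<in> carrier (C \<Otimes> C)"
  using assms by (auto simp: coalgebra_def dest: linear_onD(1))

lemmas [simp] = coalgebraD(1)
lemmas [mem] = coalgebraD(4)

lemma linear_on_comult [lin]: "coalgebra C \<Longrightarrow> linear_on V C f \<Longrightarrow> linear_on V (C \<Otimes> C) (\<lambda>x. \<Delta>\<^bsub>C\<^esub> (f x))"
  by (rule linear_on_compose[OF coalgebraD(2)])

lemma linear_on_counit [lin]: "coalgebra C \<Longrightarrow> linear_on V C f \<Longrightarrow> linear_on V ground (\<lambda>x. \<epsilon>\<^bsub>C\<^esub> (f x))"
  by (rule linear_on_compose[OF coalgebraD(3)])

text \<open>
This rule lets the simplifier rewrite below a Sweedler sum, knowing that the two bound variables are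
elements of the coalgebra; see the remark on \<open>tlift_cong\<close>.
\<close>
lemma sweedler_cong [cong]:
  assumes "c = d"
    and "\<And>a b. (coalgebra C \<and> d \<in> carrier C \<longrightarrow> a \<in> carrier C \<and> b \<in> carrier C) \<Longrightarrow> f a b = g a b"
  shows "sweedler C c f = sweedler C d g"
  unfolding sweedler_def assms(1) by (rule tlift_cong[OF refl]) (use assms(2) in \<open>auto simp: mem\<close>)

lemma sweedler_in [mem]:
  assumes "coalgebra C" "c \<in> carrier C" "vspace U"
    and "\<And>v w. v \<in> carrier C \<Longrightarrow> w \<in> carrier C \<Longrightarrow> f v w \<in> carrier U"
  shows "sweedler C c f \<in> carrier U"
  unfolding sweedler_def using assms by (auto intro!: tlift_in simp: mem)

lemma sweedler_out:
  assumes "linear_on U X g" "coalgebra C" "vspace U" "vspace X" "c \<in> carrier C"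
    and "\<And>v w. v \<in> carrier C \<Longrightarrow> w \<in> carrier C \<Longrightarrow> f v w \<in> carrier U"
  shows "g (sweedler C c f) = sweedler C c (\<lambda>v w. g (f v w))"
  unfolding sweedler_def using assms by (auto intro!: tlift_out[of U X] simp: mem)

lemma sweedler_swap:
  "sweedler C c (\<lambda>v w. sweedler D d (f v w)) = sweedler D d (\<lambda>v' w'. sweedler C c (\<lambda>v w. f v w v' w'))"
  unfolding sweedler_def by (rule tlift_swap)

lemma sweedler_sum: "sweedler C c (\<lambda>v w. \<Sum>i\<in>I. f i v w) = (\<Sum>i\<in>I. sweedler C c (f i))"
  unfolding sweedler_def by (rule tlift_sum)

lemma linear_on_sweedler_arg [lin]:
  assumes "coalgebra C" "vspace X" "linear_on U C t"
    and "\<And>w. w \<in> carrier C \<Longrightarrow> linear_on C X (\<lambda>v. f v w)"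
    and "\<And>v. v \<in> carrier C \<Longrightarrow> linear_on C X (f v)"
  shows "linear_on U X (\<lambda>x. sweedler C (t x) f)"
  unfolding sweedler_def using assms by (intro linear_on_tlift_arg linear_on_comult) auto

lemma linear_on_sweedler_fun [lin]:
  assumes "coalgebra C" "vspace X" "c \<in> carrier C"
    and "\<And>v w. v \<in> carrier C \<Longrightarrow> w \<in> carrier C \<Longrightarrow> linear_on U X (\<lambda>x. f x v w)"
  shows "linear_on U X (\<lambda>x. sweedler C c (\<lambda>v w. f x v w))"
  unfolding sweedler_def using assms by (intro linear_on_tlift_fun) (auto simp: mem)

text \<open>
Apply the linear map induced by a trilinear \<open>f\<close> to the two sides of the coassociativity axiom.
\<close>
lemma coassoc:
  assumes C: "coalgebra C" and c: "c \<in> carrier C" and U: "vspace U"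
    and f: "\<And>a b. a \<in> carrier C \<Longrightarrow> b \<in> carrier C \<Longrightarrow> linear_on C U (\<lambda>x. f x a b)"
      "\<And>a b. a \<in> carrier C \<Longrightarrow> b \<in> carrier C \<Longrightarrow> linear_on C U (\<lambda>x. f a x b)"
      "\<And>a b. a \<in> carrier C \<Longrightarrow> b \<in> carrier C \<Longrightarrow> linear_on C U (\<lambda>x. f a b x)"
  shows "sweedler C c (\<lambda>a b. sweedler C a (\<lambda>a1 a2. f a1 a2 b)) =
         sweedler C c (\<lambda>a b. sweedler C b (\<lambda>b1 b2. f a b1 b2))"
proof -
  note [simp] = C c U f coalgebraD(1)[OF C]
  define g where "g = tlift C (C \<Otimes> C) (\<lambda>a t. tlift C C (f a) t)"
  have bil: "bilinear_on C (C \<Otimes> C) U (\<lambda>a t. tlift C C (f a) t)" by (simp add: lin)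
  have g: "linear_on (C \<Otimes> C \<Otimes> C) U g"
    unfolding g_def by (rule tensor_universal_property(1)[OF _ _ _ bil]) simp_all
  have gt: "g (x \<otimes>\<^bsub>C, C \<Otimes> C\<^esub> (y \<otimes>\<^bsub>C,C\<^esub> w)) = f x y w"
    if "x \<in> carrier C" "y \<in> carrier C" "w \<in> carrier C" for x y w
    unfolding g_def using that
    by (simp add: bil mem tlift_tens[where U = U]) (simp add: lin tlift_tens[where U = U])
  have "sweedler C c (\<lambda>a b. sweedler C a (\<lambda>a1 a2. f a1 a2 b)) =
     g (sweedler C c (\<lambda>a b. sweedler C a (\<lambda>a1 a2. a1 \<otimes>\<^bsub>C, C \<Otimes> C\<^esub> (a2 \<otimes>\<^bsub>C,C\<^esub> b))))"
    by (simp add: sweedler_out[OF g] mem gt)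
  also have "sweedler C c (\<lambda>a b. sweedler C a (\<lambda>a1 a2. a1 \<otimes>\<^bsub>C, C \<Otimes> C\<^esub> (a2 \<otimes>\<^bsub>C,C\<^esub> b))) =
     sweedler C c (\<lambda>a b. sweedler C b (\<lambda>b1 b2. a \<otimes>\<^bsub>C, C \<Otimes> C\<^esub> (b1 \<otimes>\<^bsub>C,C\<^esub> b2)))"
    using C c unfolding coalgebra_def by blast
  also have "g \<dots> = sweedler C c (\<lambda>a b. sweedler C b (\<lambda>b1 b2. f a b1 b2))"
    by (simp add: sweedler_out[OF g] mem gt)
  finally show ?thesis .
qed

lemma counit_left:
  fixes C (structure)
  assumes "coalgebra C" "c \<in> carrier C" "vspace U" "linear_on C U f"
  shows "sweedler C c (\<lambda>a b. \<epsilon> a *s\<^bsub>U\<^esub> f b) = f c"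
proof -
  note [simp] = assms coalgebraD(1)[OF assms(1)]
  have "f c = f (sweedler C c (\<lambda>a b. \<epsilon> a *s b))"
    using assms by (simp add: coalgebra_def)
  also have "\<dots> = sweedler C c (\<lambda>a b. \<epsilon> a *s\<^bsub>U\<^esub> f b)"
    by (simp add: sweedler_out[OF assms(4)] mem linear_onD[OF assms(4)])
  finally show ?thesis ..
qed

lemma counit_right:
  fixes C (structure)
  assumes "coalgebra C" "c \<in> carrier C" "vspace U" "linear_on C U f"
  shows "sweedler C c (\<lambda>a b. \<epsilon> b *s\<^bsub>U\<^esub> f a) = f c"
proof -
  note [simp] = assms coalgebraD(1)[OF assms(1)]
  have "f c = f (sweedler C c (\<lambda>a b. \<epsilon> b *s a))"
    using assms by (simp add: coalgebra_def)
  also have "\<dots> = sweedler C c (\<lambda>a b. \<epsilon> b *s\<^bsub>U\<^esub> f a)"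
    by (simp add: sweedler_out[OF assms(4)] mem linear_onD[OF assms(4)])
  finally show ?thesis ..
qed

lemma bialgebraD [simp]:
  fixes H (structure)
  assumes "bialgebra H"
  shows "algebra H" "coalgebra H" "\<epsilon> \<one> = 1"
    "\<Delta> \<one> = \<one> \<otimes>\<^bsub>H,H\<^esub> \<one>"
    "h \<in> carrier H \<Longrightarrow> g \<in> carrier H \<Longrightarrow> \<epsilon> (h \<cdot> g) = \<epsilon> h * \<epsilon> g"
  using assms by (auto simp: bialgebra_def)

lemma tensor_mult_tens:
  assumes "algebra A" "algebra B" "a \<in> carrier A" "a' \<in> carrier A" "b \<in> carrier B" "b' \<in> carrier B"
  shows "tensor_mult A B (a \<otimes>\<^bsub>A,B\<^esub> b) (a' \<otimes>\<^bsub>A,B\<^esub> b') = (a \<cdot>\<^bsub>A\<^esub> a') \<otimes>\<^bsub>A,B\<^esub> (b \<cdot>\<^bsub>B\<^esub> b')"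
  unfolding tensor_mult_def using assms by (simp add: tlift_tens[where U = "A \<Otimes> B"] lin mem)

lemma sweedler_mult:
  fixes H (structure)
  assumes "bialgebra H" "h \<in> carrier H" "g \<in> carrier H" "vspace U"
    and "bilinear_on H H U f"
  shows "sweedler H (h \<cdot> g) f =
    sweedler H h (\<lambda>h1 h2. sweedler H g (\<lambda>g1 g2. f (h1 \<cdot> g1) (h2 \<cdot> g2)))"
proof -
  note [simp] = assms bilinear_onD(3)[OF assms(5)]
  have "sweedler H (h \<cdot> g) f = tlift H H f (tensor_mult H H (\<Delta> h) (\<Delta> g))"
    using assms(1-3) unfolding sweedler_def bialgebra_def by metis
  also have "\<dots> = tlift H H (\<lambda>h1 h2. tlift H H (\<lambda>g1 g2. f (h1 \<cdot> g1) (h2 \<cdot> g2)) (\<Delta> g)) (\<Delta> h)"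
    by (simp add: tensor_mult_def tlift_tlift[where U = U] tlift_tens[where U = U] mem
        cong: tlift_cong)
  finally show ?thesis by (simp add: sweedler_def)
qed

lemma sweedler_one:
  assumes "bialgebra H" "vspace U" "bilinear_on H H U f"
  shows "sweedler H \<one>\<^bsub>H\<^esub> f = f \<one>\<^bsub>H\<^esub> \<one>\<^bsub>H\<^esub>"
  using assms by (simp add: sweedler_def tlift_tens[where U = U] mem)

text \<open>
In the convolution monoid of linear maps from a coalgebra to an algebra, a left inverse of \<open>Y\<close>
equals a right inverse. This yields the compatibility of antipodes with products and coproducts, and
their passage to \<open>B\<close> and to \<open>M\<close>.
\<close>
lemma convolution_inverse_unique:
  fixes A (structure)
  assumes C: "coalgebra C" and A: "algebra A"
    and X: "linear_on C A X" and Y: "linear_on C A Y" and Z: "linear_on C A Z"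
    and XY: "\<And>c. c \<in> carrier C \<Longrightarrow> sweedler C c (\<lambda>a b. X a \<cdot> Y b) = \<epsilon>\<^bsub>C\<^esub> c *s \<one>"
    and YZ: "\<And>c. c \<in> carrier C \<Longrightarrow> sweedler C c (\<lambda>a b. Y a \<cdot> Z b) = \<epsilon>\<^bsub>C\<^esub> c *s \<one>"
    and c: "c \<in> carrier C"
  shows "X c = Z c"
proof -
  note [simp] = C A X Y Z c XY YZ linear_onD(1)[OF X] linear_onD(1)[OF Y] linear_onD(1)[OF Z]
  note [lin] = linear_on_compose[OF X] linear_on_compose[OF Y] linear_on_compose[OF Z]
  have "X c = sweedler C c (\<lambda>a b. \<epsilon>\<^bsub>C\<^esub> b *s X a)"
    by (simp add: counit_right)
  also have "\<dots> = sweedler C c (\<lambda>a b. X a \<cdot> sweedler C b (\<lambda>b1 b2. Y b1 \<cdot> Z b2))"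
    by (simp add: mult_scale mem)
  also have "\<dots> = sweedler C c (\<lambda>a b. sweedler C b (\<lambda>b1 b2. X a \<cdot> (Y b1 \<cdot> Z b2)))"
    by (simp del: YZ add: sweedler_out[OF linear_on_mult(2)[OF A _ linear_on_id]] mem)
  also have "\<dots> = sweedler C c (\<lambda>a b. sweedler C a (\<lambda>a1 a2. X a1 \<cdot> (Y a2 \<cdot> Z b)))"
    by (rule coassoc[symmetric, where U = A]) (simp_all add: lin mem)
  also have "\<dots> = sweedler C c (\<lambda>a b. sweedler C a (\<lambda>a1 a2. X a1 \<cdot> Y a2) \<cdot> Z b)"
    by (simp del: XY add: sweedler_out[OF linear_on_mult(1)[OF A _ linear_on_id]] mem algebraD(5)[OF A])
  also have "\<dots> = sweedler C c (\<lambda>a b. \<epsilon>\<^bsub>C\<^esub> a *s Z b)"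
    by (simp add: mult_scale mem)
  also have "\<dots> = Z c"
    by (simp add: counit_left)
  finally show ?thesis .
qed

section \<open>Tensor products of algebras, coalgebras and bialgebras\<close>

definition tensor_hopf where
  "tensor_hopf A B = \<lparr>carrier = carrier (A \<Otimes> B), scale = scale (A \<Otimes> B), mult = tensor_mult A B,
     one = \<one>\<^bsub>A\<^esub> \<otimes>\<^bsub>A,B\<^esub> \<one>\<^bsub>B\<^esub>,
     comult = tlift A B (\<lambda>x h. sweedler A x (\<lambda>x1 x2. sweedler B h (\<lambda>h1 h2.
        (x1 \<otimes>\<^bsub>A,B\<^esub> h1) \<otimes>\<^bsub>A \<Otimes> B, A \<Otimes> B\<^esub> (x2 \<otimes>\<^bsub>A,B\<^esub> h2)))),
     counit = tlift A B (\<lambda>x h. \<epsilon>\<^bsub>A\<^esub> x * \<epsilon>\<^bsub>B\<^esub> h)\<rparr>"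

lemma tensor_hopf_simps [simp]:
  "carrier (tensor_hopf A B) = carrier (A \<Otimes> B)" "scale (tensor_hopf A B) = scale (A \<Otimes> B)"
  "mult (tensor_hopf A B) = tensor_mult A B" "one (tensor_hopf A B) = \<one>\<^bsub>A\<^esub> \<otimes>\<^bsub>A,B\<^esub> \<one>\<^bsub>B\<^esub>"
  by (simp_all add: tensor_hopf_def)

lemma comult_tensor_hopf:
  "comult (tensor_hopf A B) = tlift A B (\<lambda>x h. sweedler A x (\<lambda>x1 x2. sweedler B h (\<lambda>h1 h2.
     (x1 \<otimes>\<^bsub>A,B\<^esub> h1) \<otimes>\<^bsub>A \<Otimes> B, A \<Otimes> B\<^esub> (x2 \<otimes>\<^bsub>A,B\<^esub> h2))))"
  by (simp add: tensor_hopf_def)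

lemma counit_tensor_hopf: "counit (tensor_hopf A B) = tlift A B (\<lambda>x h. \<epsilon>\<^bsub>A\<^esub> x * \<epsilon>\<^bsub>B\<^esub> h)"
  by (simp add: tensor_hopf_def)

lemma counit_tensor_hopf_tens:
  assumes "coalgebra A" "coalgebra B" "a \<in> carrier A" "b \<in> carrier B"
  shows "\<epsilon>\<^bsub>tensor_hopf A B\<^esub> (a \<otimes>\<^bsub>A,B\<^esub> b) = \<epsilon>\<^bsub>A\<^esub> a * \<epsilon>\<^bsub>B\<^esub> b"
  unfolding counit_tensor_hopf using assms by (simp add: tlift_tens[where U = ground] lin)

text \<open>
Linear maps and tensor products only see the carrier and the scalar multiplication, which
\<open>tensor_hopf A B\<close> shares with the tensor product space.
\<close>
lemma vspace_eq_transfer: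
  assumes "carrier V = carrier V'" "scale V = scale V'"
  shows "vspace V = vspace V'" "linear_on V W = linear_on V' W" "linear_on W V = linear_on W V'"
    "bilinear_on V X Y = bilinear_on V' X Y" "bilinear_on X V Y = bilinear_on X V' Y"
    "bilinear_on X Y V = bilinear_on X Y V'"
    "V \<Otimes> X = V' \<Otimes> X" "X \<Otimes> V = X \<Otimes> V'" "tlift V X = tlift V' X" "tlift X V = tlift X V'"
    "v \<otimes>\<^bsub>V,X\<^esub> x = v \<otimes>\<^bsub>V',X\<^esub> x" "x \<otimes>\<^bsub>X,V\<^esub> v = x \<otimes>\<^bsub>X,V'\<^esub> v"
proof -
  show 1: "v \<otimes>\<^bsub>V,X\<^esub> x = v \<otimes>\<^bsub>V',X\<^esub> x" "x \<otimes>\<^bsub>X,V\<^esub> v = x \<otimes>\<^bsub>X,V'\<^esub> v" for X v x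
    using assms by (auto intro: tens_cong)
  show "vspace V = vspace V'" "linear_on V W = linear_on V' W" "linear_on W V = linear_on W V'"
    "bilinear_on V X Y = bilinear_on V' X Y" "bilinear_on X V Y = bilinear_on X V' Y"
    "bilinear_on X Y V = bilinear_on X Y V'"
    by (auto intro!: ext simp add: vspace_def linear_on_def bilinear_on_def assms)
  show "V \<Otimes> X = V' \<Otimes> X" "X \<Otimes> V = X \<Otimes> V'"
    unfolding tensor_space_def 1 assms by (rule refl)+
  show "tlift V X = tlift V' X" "tlift X V = tlift X V'"
    by (auto simp: fun_eq_iff tlift_def 1 assms)
qed

lemmas tensor_hopf_transfer [simp] =
  vspace_eq_transfer[of "tensor_hopf A B" "A \<Otimes> B", OF tensor_hopf_simps(1,2)] for A B

lemma linear_on_tensor_mult [lin]: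
  assumes "algebra A" "algebra B" "t \<in> carrier (A \<Otimes> B)" "linear_on V (A \<Otimes> B) f"
  shows "linear_on V (A \<Otimes> B) (\<lambda>x. tensor_mult A B (f x) t)"
    and "linear_on V (A \<Otimes> B) (\<lambda>x. tensor_mult A B t (f x))"
  unfolding tensor_mult_def using assms by (simp_all add: lin mem)

lemma tensor_mult_in [mem]:
  assumes "algebra A" "algebra B" "s \<in> carrier (A \<Otimes> B)" "t \<in> carrier (A \<Otimes> B)"
  shows "tensor_mult A B s t \<in> carrier (A \<Otimes> B)"
  using assms by (simp add: tensor_mult_def mem)

context
  fixes A :: "('k::field, 'v::ab_group_add, 'x) hopf_data_scheme"
    and B :: "('k, 'w::ab_group_add, 'y) hopf_data_scheme"
begin

abbreviation (input) tens_AB (infix \<open>\<otimes>\<close> 65) where "a \<otimes> b \<equiv> a \<otimes>\<^bsub>A,B\<^esub> b"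

lemma algebra_tensor_hopf:
  assumes A: "algebra A" and B: "algebra B"
  shows "algebra (tensor_hopf A B)"
proof -
  let ?one = "\<one>\<^bsub>A\<^esub> \<otimes> \<one>\<^bsub>B\<^esub>"
  let ?m = "tensor_mult A B"
  note [simp] = A B
  note ext = tensor_ext[of A B "A \<Otimes> B"]
  have assoc: "?m (?m s t) u = ?m s (?m t u)"
    if s: "s \<in> carrier (A \<Otimes> B)" and t: "t \<in> carrier (A \<Otimes> B)" and u: "u \<in> carrier (A \<Otimes> B)" for s t u
  proof (rule ext[of "\<lambda>s. ?m (?m s t) u" "\<lambda>s. ?m s (?m t u)"])
    fix a b assume [simp]: "a \<in> carrier A" "b \<in> carrier B"
    show "?m (?m (a \<otimes> b) t) u = ?m (a \<otimes> b) (?m t u)"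
    proof (rule ext[of "\<lambda>t. ?m (?m (a \<otimes> b) t) u" "\<lambda>t. ?m (a \<otimes> b) (?m t u)"])
      fix a' b' assume [simp]: "a' \<in> carrier A" "b' \<in> carrier B"
      show "?m (?m (a \<otimes> b) (a' \<otimes> b')) u = ?m (a \<otimes> b) (?m (a' \<otimes> b') u)"
        by (rule ext[of "\<lambda>u. ?m (?m (a \<otimes> b) (a' \<otimes> b')) u" "\<lambda>u. ?m (a \<otimes> b) (?m (a' \<otimes> b') u)"])
         (simp_all add: lin mem u tensor_mult_tens algebraD(5))
    qed (simp_all add: lin mem t u)
  qed (simp_all add: lin mem s t u)
  have unit1: "?m ?one s = s" if s: "s \<in> carrier (A \<Otimes> B)" for s
    by (rule ext[of "\<lambda>s. ?m ?one s" "\<lambda>s. s"])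
      (simp_all add: lin mem tensor_mult_tens s)
  have unit2: "?m s ?one = s" if s: "s \<in> carrier (A \<Otimes> B)" for s
    by (rule ext[of "\<lambda>s. ?m s ?one" "\<lambda>s. s"])
      (simp_all add: lin mem tensor_mult_tens s)
  have "bilinear_on (A \<Otimes> B) (A \<Otimes> B) (A \<Otimes> B) ?m"
    by (rule bilinear_onI) (simp_all add: lin)
  then show ?thesis unfolding algebra_def
    by (simp add: assoc unit1 unit2 mem lin)
qed

lemma sweedler_tensor_hopf:
  assumes A: "coalgebra A" and B: "coalgebra B" and "a \<in> carrier A" "b \<in> carrier B" "vspace U"
    and f: "bilinear_on (A \<Otimes> B) (A \<Otimes> B) U f"
  shows "sweedler (tensor_hopf A B) (a \<otimes> b) f =
    sweedler A a (\<lambda>a1 a2. sweedler B b (\<lambda>b1 b2. f (a1 \<otimes> b1) (a2 \<otimes> b2)))"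
proof -
  note [simp] = assms
  let ?T = "(A \<Otimes> B) \<Otimes> (A \<Otimes> B)"
  note out = sweedler_out[OF tensor_universal_property(1)[OF _ _ _ f]]
  show ?thesis
    unfolding sweedler_def[of "tensor_hopf A B"] comult_tensor_hopf
    by (simp add: tlift_tens[where U = ?T] tlift_tens[where U = U] lin mem out)
qed

lemma coalgebra_tensor_hopf:
  assumes A: "coalgebra A" and B: "coalgebra B"
  shows "coalgebra (tensor_hopf A B)"
proof -
  note [simp] = A B
  let ?T = "tensor_hopf A B"
  let ?eps = "counit ?T"
  let ?com = "comult ?T"
  let ?V = "A \<Otimes> B"
  have comult: "linear_on ?V (?V \<Otimes> ?V) ?com"
    unfolding comult_tensor_hopf by (simp add: tensor_universal_property(1) lin mem)
  have counit: "linear_on ?V ground ?eps"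
    unfolding counit_tensor_hopf by (simp add: tensor_universal_property(1) lin mem)
  have com: "?com t \<in> carrier (?V \<Otimes> ?V)" if "t \<in> carrier ?V" for t
    by (rule linear_onD(1)[OF comult that])
  note sw = sweedler_tensor_hopf[OF A B]
  have arg: "linear_on X U (\<lambda>x. sweedler ?T (g x) f)"
    if "vspace U" "linear_on X ?V g"
      "\<And>w. w \<in> carrier ?V \<Longrightarrow> linear_on ?V U (\<lambda>v. f v w)" "\<And>v. v \<in> carrier ?V \<Longrightarrow> linear_on ?V U (f v)"
    for X f g and U :: "('k, 'u::ab_group_add, 'z) vspace_scheme"
    unfolding sweedler_def tensor_hopf_transfer
    by (rule linear_on_tlift_arg) (use that linear_on_compose[OF comult that(2)] in auto)
  have fun': "linear_on X U (\<lambda>x. sweedler ?T t (\<lambda>v w. f x v w))"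
    if "vspace U" "t \<in> carrier ?V" "\<And>v w. v \<in> carrier ?V \<Longrightarrow> w \<in> carrier ?V \<Longrightarrow> linear_on X U (\<lambda>x. f x v w)"
    for X t f and U :: "('k, 'u::ab_group_add, 'z) vspace_scheme"
    unfolding sweedler_def tensor_hopf_transfer
    by (rule linear_on_tlift_fun) (use that com in auto)
  let ?l = "\<lambda>t. sweedler ?T t (\<lambda>a b. sweedler ?T a (\<lambda>a1 a2. a1 \<otimes>\<^bsub>?V, ?V \<Otimes> ?V\<^esub> (a2 \<otimes>\<^bsub>?V,?V\<^esub> b)))"
  let ?r = "\<lambda>t. sweedler ?T t (\<lambda>a b. sweedler ?T b (\<lambda>b1 b2. a \<otimes>\<^bsub>?V, ?V \<Otimes> ?V\<^esub> (b1 \<otimes>\<^bsub>?V,?V\<^esub> b2)))"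
  have coass: "?l t = ?r t" if t: "t \<in> carrier ?V" for t
  proof (rule tensor_ext[of A B "?V \<Otimes> ?V \<Otimes> ?V" ?l ?r])
    fix a b assume [simp]: "a \<in> carrier A" "b \<in> carrier B"
    let ?F = "\<lambda>a1 b1 a2 b2 a3 b3. (a1 \<otimes> b1) \<otimes>\<^bsub>?V, ?V \<Otimes> ?V\<^esub> ((a2 \<otimes> b2) \<otimes>\<^bsub>?V,?V\<^esub> (a3 \<otimes> b3))"
    have "?l (a \<otimes> b) = sweedler A a (\<lambda>a1 a2. sweedler B b (\<lambda>b1 b2.
        sweedler A a1 (\<lambda>x1 x2. sweedler B b1 (\<lambda>y1 y2. ?F x1 y1 x2 y2 a2 b2))))"
      by (simp add: sw[where U = "?V \<Otimes> ?V \<Otimes> ?V"] lin mem arg fun')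
    also have "\<dots> = sweedler A a (\<lambda>a1 a2. sweedler A a1 (\<lambda>x1 x2. sweedler B b (\<lambda>b1 b2.
        sweedler B b1 (\<lambda>y1 y2. ?F x1 y1 x2 y2 a2 b2))))"
      by (simp add: sweedler_swap[of B b A])
    also have "\<dots> = sweedler A a (\<lambda>a1 a2. sweedler A a1 (\<lambda>x1 x2. sweedler B b (\<lambda>b1 b2.
        sweedler B b2 (\<lambda>y1 y2. ?F x1 b1 x2 y1 a2 y2))))"
      by (simp add: coassoc[where U = "?V \<Otimes> ?V \<Otimes> ?V"] lin mem)
    also have "\<dots> = sweedler A a (\<lambda>a1 a2. sweedler A a2 (\<lambda>x1 x2. sweedler B b (\<lambda>b1 b2.
        sweedler B b2 (\<lambda>y1 y2. ?F a1 b1 x1 y1 x2 y2))))"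
      by (subst coassoc[where U = "?V \<Otimes> ?V \<Otimes> ?V"]) (simp_all add: lin mem)
    also have "\<dots> = sweedler A a (\<lambda>a1 a2. sweedler B b (\<lambda>b1 b2. sweedler A a2 (\<lambda>x1 x2.
        sweedler B b2 (\<lambda>y1 y2. ?F a1 b1 x1 y1 x2 y2))))"
      by (simp add: sweedler_swap[of A _ B b])
    also have "\<dots> = ?r (a \<otimes> b)"
      by (simp add: sw[where U = "?V \<Otimes> ?V \<Otimes> ?V"] lin mem arg fun')
    finally show "?l (a \<otimes> b) = ?r (a \<otimes> b)" .
  qed (simp_all add: t arg fun' lin mem)
  note epslin = linear_on_compose[OF counit]
  let ?l = "\<lambda>t. sweedler ?T t (\<lambda>a b. ?eps a *s\<^bsub>?V\<^esub> b)"
  have l: "?l t = t" if t: "t \<in> carrier ?V" for t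
  proof (rule tensor_ext[of A B ?V ?l "\<lambda>t. t"])
    fix a b assume [simp]: "a \<in> carrier A" "b \<in> carrier B"
    have "?l (a \<otimes> b) = sweedler A a (\<lambda>a1 a2. sweedler B b (\<lambda>b1 b2.
        \<epsilon>\<^bsub>A\<^esub> a1 *s\<^bsub>?V\<^esub> (\<epsilon>\<^bsub>B\<^esub> b1 *s\<^bsub>?V\<^esub> (a2 \<otimes> b2))))"
      by (simp add: sw[where U = ?V] lin mem arg fun' epslin counit_tensor_hopf_tens)
    also have "\<dots> = sweedler A a (\<lambda>a1 a2. \<epsilon>\<^bsub>A\<^esub> a1 *s\<^bsub>?V\<^esub> (a2 \<otimes> b))"
      by (simp add: sweedler_out[OF linear_on_scale_const[OF _ linear_on_id], symmetric] lin mem counit_left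
         del: vspaceD(8))
    also have "\<dots> = a \<otimes> b" by (simp add: counit_left lin)
    finally show "?l (a \<otimes> b) = a \<otimes> b" .
  qed (simp_all add: t arg fun' lin mem epslin)
  let ?l = "\<lambda>t. sweedler ?T t (\<lambda>a b. ?eps b *s\<^bsub>?V\<^esub> a)"
  have r: "?l t = t" if t: "t \<in> carrier ?V" for t
  proof (rule tensor_ext[of A B ?V ?l "\<lambda>t. t"])
    fix a b assume [simp]: "a \<in> carrier A" "b \<in> carrier B"
    have "?l (a \<otimes> b) = sweedler A a (\<lambda>a1 a2. sweedler B b (\<lambda>b1 b2.
        \<epsilon>\<^bsub>A\<^esub> a2 *s\<^bsub>?V\<^esub> (\<epsilon>\<^bsub>B\<^esub> b2 *s\<^bsub>?V\<^esub> (a1 \<otimes> b1))))"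
      by (simp add: sw[where U = ?V] lin mem arg fun' epslin counit_tensor_hopf_tens)
    also have "\<dots> = sweedler A a (\<lambda>a1 a2. \<epsilon>\<^bsub>A\<^esub> a2 *s\<^bsub>?V\<^esub> (a1 \<otimes> b))"
      by (simp add: sweedler_out[OF linear_on_scale_const[OF _ linear_on_id], symmetric] lin mem counit_right
         del: vspaceD(8))
    also have "\<dots> = a \<otimes> b" by (simp add: counit_right lin)
    finally show "?l (a \<otimes> b) = a \<otimes> b" .
  qed (simp_all add: t arg fun' lin mem epslin)
  show ?thesis unfolding coalgebra_def
    using comult counit coass l r by simp
qed

lemma linear_on_sweedler:
  assumes "coalgebra C" "vspace U" "bilinear_on C C U f"
  shows "linear_on C U (\<lambda>c. sweedler C c f)"
  using assms by (simp add: lin bilinear_onD)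

lemma bialgebra_tensor_hopf:
  assumes A: "bialgebra A" and B: "bialgebra B"
  shows "bialgebra (tensor_hopf A B)"
proof -
  let ?m = "tensor_mult A B"
  note [simp] = A B
  let ?T = "tensor_hopf A B"
  let ?one = "\<one>\<^bsub>A\<^esub> \<otimes> \<one>\<^bsub>B\<^esub>"
  let ?eps = "counit ?T"
  let ?com = "comult ?T"
  let ?V = "A \<Otimes> B"
  have aT: "algebra ?T" and cT: "coalgebra ?T"
    by (simp_all add: algebra_tensor_hopf coalgebra_tensor_hopf)
  have com: "?com t \<in> carrier (?V \<Otimes> ?V)" if "t \<in> carrier ?V" for t
    using coalgebraD(4)[OF cT, of t] that by simp
  note comlin = linear_on_comult[OF cT, simplified tensor_hopf_transfer tensor_hopf_simps(1)]
  note epslin = linear_on_counit[OF cT, simplified tensor_hopf_transfer tensor_hopf_simps(1)]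
  have delta: "?com (a \<otimes> b) = sweedler A a (\<lambda>a1 a2. sweedler B b (\<lambda>b1 b2.
      (a1 \<otimes> b1) \<otimes>\<^bsub>?V,?V\<^esub> (a2 \<otimes> b2)))" if "a \<in> carrier A" "b \<in> carrier B" for a b
    unfolding comult_tensor_hopf using that by (simp add: tlift_tens[where U = "?V \<Otimes> ?V"] lin mem)
  note tmlin = linear_on_tensor_mult[OF aT aT, simplified tensor_hopf_transfer tensor_hopf_simps(1)]
  have eq: "?com (?m s t) = tensor_mult ?T ?T (?com s) (?com t)"
    if s: "s \<in> carrier ?V" and t: "t \<in> carrier ?V" for s t
  proof (rule tensor_ext[of A B "?V \<Otimes> ?V" "\<lambda>s. ?com (?m s t)"
        "\<lambda>s. tensor_mult ?T ?T (?com s) (?com t)"])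
    fix a b assume [simp]: "a \<in> carrier A" "b \<in> carrier B"
    show "?com (?m (a \<otimes> b) t) = tensor_mult ?T ?T (?com (a \<otimes> b)) (?com t)"
    proof (rule tensor_ext[of A B "?V \<Otimes> ?V" "\<lambda>t. ?com (?m (a \<otimes> b) t)"
        "\<lambda>t. tensor_mult ?T ?T (?com (a \<otimes> b)) (?com t)"])
      fix a' b' assume [simp]: "a' \<in> carrier A" "b' \<in> carrier B"
      let ?G = "\<lambda>a1 a2 b1 b2 a1' a2' b1' b2'.
        ((a1 \<cdot>\<^bsub>A\<^esub> a1') \<otimes> (b1 \<cdot>\<^bsub>B\<^esub> b1')) \<otimes>\<^bsub>?V,?V\<^esub> ((a2 \<cdot>\<^bsub>A\<^esub> a2') \<otimes> (b2 \<cdot>\<^bsub>B\<^esub> b2'))"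
      have tm: "tensor_mult ?T ?T ((x \<otimes> y) \<otimes>\<^bsub>?V,?V\<^esub> (u \<otimes> v))
          ((x' \<otimes> y') \<otimes>\<^bsub>?V,?V\<^esub> (u' \<otimes> v')) = ?G x u y v x' u' y' v'"
        if "x \<in> carrier A" "y \<in> carrier B" "u \<in> carrier A" "v \<in> carrier B"
          "x' \<in> carrier A" "y' \<in> carrier B" "u' \<in> carrier A" "v' \<in> carrier B" for x y u v x' y' u' v'
        using tensor_mult_tens[OF aT aT, of "x \<otimes> y" "x' \<otimes> y'" "u \<otimes> v" "u' \<otimes> v'"] that
        by (simp add: tensor_mult_tens mem)
      have "?com (?m (a \<otimes> b) (a' \<otimes> b')) =
         sweedler A a (\<lambda>a1 a2. sweedler A a' (\<lambda>a1' a2'. sweedler B b (\<lambda>b1 b2. sweedler B b' (\<lambda>b1' b2'.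
           ?G a1 a2 b1 b2 a1' a2' b1' b2'))))"
        by (simp add: tensor_mult_tens delta sweedler_mult[where U = "?V \<Otimes> ?V"] lin mem)
      also have "\<dots> = sweedler A a' (\<lambda>a1' a2'. sweedler B b' (\<lambda>b1' b2'. sweedler A a (\<lambda>a1 a2. sweedler B b (\<lambda>b1 b2.
           ?G a1 a2 b1 b2 a1' a2' b1' b2'))))"
        by (simp add: sweedler_swap[of B b B b'] sweedler_swap[of A a A a'] sweedler_swap[of A a B b'])
      also have "\<dots> = tensor_mult ?T ?T (?com (a \<otimes> b)) (?com (a' \<otimes> b'))"
        by (simp add: delta sweedler_out[OF tmlin(1)[OF _ linear_on_id]] sweedler_out[OF tmlin(2)[OF _ linear_on_id]] tm mem)
      finally show "?com (?m (a \<otimes> b) (a' \<otimes> b')) =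
         tensor_mult ?T ?T (?com (a \<otimes> b)) (?com (a' \<otimes> b'))" .
    qed (simp_all add: t lin mem comlin tmlin com)
  qed (simp_all add: s t lin mem comlin tmlin com)
  have em: "?eps (?m s t) = ?eps s * ?eps t"
    if s: "s \<in> carrier ?V" and t: "t \<in> carrier ?V" for s t
  proof (rule tensor_ext[of A B ground "\<lambda>s. ?eps (?m s t)" "\<lambda>s. ?eps s * ?eps t"])
    fix a b assume [simp]: "a \<in> carrier A" "b \<in> carrier B"
    show "?eps (?m (a \<otimes> b) t) = ?eps (a \<otimes> b) * ?eps t"
      by (rule tensor_ext[of A B ground "\<lambda>t. ?eps (?m (a \<otimes> b) t)" "\<lambda>t. ?eps (a \<otimes> b) * ?eps t"])
       (simp_all add: t lin mem epslin counit_tensor_hopf_tens tensor_mult_tens)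
  qed (simp_all add: s t lin mem epslin)
  have "?com ?one = ?one \<otimes>\<^bsub>?V,?V\<^esub> ?one" "?eps ?one = 1"
    by (simp_all add: delta counit_tensor_hopf_tens sweedler_one[where U = "?V \<Otimes> ?V"] mem lin)
  then show ?thesis
    unfolding bialgebra_def using aT cT eq em by simp
qed

end

section \<open>Antipodes\<close>

definition antipode where
  "antipode H S \<longleftrightarrow> linear_on H H S \<and>
     (\<forall>h \<in> carrier H. sweedler H h (\<lambda>h1 h2. S h1 \<cdot>\<^bsub>H\<^esub> h2) = \<epsilon>\<^bsub>H\<^esub> h *s\<^bsub>H\<^esub> \<one>\<^bsub>H\<^esub> \<and>
                      sweedler H h (\<lambda>h1 h2. h1 \<cdot>\<^bsub>H\<^esub> S h2) = \<epsilon>\<^bsub>H\<^esub> h *s\<^bsub>H\<^esub> \<one>\<^bsub>H\<^esub>)"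

lemma hopf_algebra_iff: "hopf_algebra H \<longleftrightarrow> bialgebra H \<and> (\<exists>S. antipode H S)"
  by (simp add: hopf_algebra_def antipode_def)

locale hopf =
  fixes H :: "('k::field, 'v::ab_group_add, 'x) hopf_data_scheme" (structure) and S
  assumes bialgebra [simp]: "bialgebra H" and antipode: "antipode H S"
begin

abbreviation (input) tens_H (infix \<open>\<otimes>\<close> 65) where "a \<otimes> b \<equiv> a \<otimes>\<^bsub>H,H\<^esub> b"

lemma linear_S: "linear_on H H S" using antipode by (simp add: antipode_def)
lemmas linear_S' [lin] = linear_S linear_on_compose[OF linear_S]
lemmas S_in [mem] = linear_onD(1)[OF linear_S]

lemma antipode_conv [simp]:
  "h \<in> carrier H \<Longrightarrow> sweedler H h (\<lambda>h1 h2. S h1 \<cdot> h2) = \<epsilon> h *s \<one>"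
  "h \<in> carrier H \<Longrightarrow> sweedler H h (\<lambda>h1 h2. h1 \<cdot> S h2) = \<epsilon> h *s \<one>"
  using antipode by (auto simp: antipode_def)

lemma
  assumes "h \<in> carrier H" "vspace U" "linear_on H U f"
  shows antipode_left: "sweedler H h (\<lambda>h1 h2. f (S h1 \<cdot> h2)) = \<epsilon> h *s\<^bsub>U\<^esub> f \<one>"
    and antipode_right: "sweedler H h (\<lambda>h1 h2. f (h1 \<cdot> S h2)) = \<epsilon> h *s\<^bsub>U\<^esub> f \<one>"
  using assms by (simp_all add: sweedler_out[OF assms(3), symmetric] mem linear_onD(3)[OF assms(3)])

lemma S_one: "S \<one> = \<one>"
  using antipode_conv(1)[of "\<one>"] by (simp add: sweedler_one[where U = H] lin mem)

lemma counit_S: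
  assumes [simp]: "h \<in> carrier H"
  shows "\<epsilon> (S h) = \<epsilon> h"
proof -
  have "\<epsilon> h = \<epsilon> (sweedler H h (\<lambda>h1 h2. S h1 \<cdot> h2))"
    using linear_onD(3)[OF coalgebraD(3), of H "\<one>"] by (simp add: mem)
  also have "\<dots> = sweedler H h (\<lambda>h1 h2. \<epsilon> h2 * \<epsilon> (S h1))"
    by (subst sweedler_out[OF coalgebraD(3)]) (simp_all add: mem mult.commute)
  also have "\<dots> = \<epsilon> (S h)"
    using counit_right[where U = ground and C = H and c = h and f = "\<lambda>h. \<epsilon> (S h)"] by (simp add: lin)
  finally show ?thesis ..
qed

text \<open>
Both \<open>S (h g)\<close> and \<open>S g S h\<close> are convolution inverse to the multiplication, as maps from the
coalgebra \<open>H \<otimes> H\<close> to \<open>H\<close>.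
\<close>
lemma S_mult:
  assumes [simp]: "h \<in> carrier H" "g \<in> carrier H"
  shows "S (h \<cdot> g) = S g \<cdot> S h"
proof -
  let ?T = "tensor_hopf H H"
  let ?X = "tlift H H (\<lambda>h g. S (h \<cdot> g))" and ?Y = "tlift H H (mult H)" and ?Z = "tlift H H (\<lambda>h g. S g \<cdot> S h)"
  have T: "coalgebra ?T" by (simp add: coalgebra_tensor_hopf)
  have X: "linear_on (H \<Otimes> H) H ?X" and Y: "linear_on (H \<Otimes> H) H ?Y" and Z: "linear_on (H \<Otimes> H) H ?Z"
    by (simp_all add: tensor_universal_property(1) lin mem)
  have pure: "?X (h \<otimes> g) = S (h \<cdot> g)" "?Y (h \<otimes> g) = h \<cdot> g" "?Z (h \<otimes> g) = S g \<cdot> S h"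
    if "h \<in> carrier H" "g \<in> carrier H" for h g
    using that by (simp_all add: tlift_tens[where U = H] lin mem)
  note [lin] = linear_on_compose[OF X] linear_on_compose[OF Y] linear_on_compose[OF Z]
  note XYZin [mem] = linear_onD(1)[OF X] linear_onD(1)[OF Y] linear_onD(1)[OF Z]
  note slin = linear_on_sweedler[OF T, simplified tensor_hopf_transfer]
  have elin: "linear_on (H \<Otimes> H) H (\<lambda>t. \<epsilon>\<^bsub>?T\<^esub> t *s \<one>)"
    using coalgebraD(3)[OF T] by (simp add: lin mem)
  have XY: "sweedler ?T t (\<lambda>a b. ?X a \<cdot> ?Y b) = \<epsilon>\<^bsub>?T\<^esub> t *s \<one>" if "t \<in> carrier (H \<Otimes> H)" for t
  proof (rule tensor_ext[of H H H "\<lambda>t. sweedler ?T t (\<lambda>a b. ?X a \<cdot> ?Y b)" "\<lambda>t. \<epsilon>\<^bsub>?T\<^esub> t *s \<one>"])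
    fix h g assume [simp]: "h \<in> carrier H" "g \<in> carrier H"
    have "sweedler ?T (h \<otimes> g) (\<lambda>a b. ?X a \<cdot> ?Y b) = sweedler H (h \<cdot> g) (\<lambda>a b. S a \<cdot> b)"
      by (simp add: sweedler_tensor_hopf[where U = H] sweedler_mult[where U = H] lin mem pure del: antipode_conv)
    then show "sweedler ?T (h \<otimes> g) (\<lambda>a b. ?X a \<cdot> ?Y b) = \<epsilon>\<^bsub>?T\<^esub> (h \<otimes> g) *s \<one>"
      by (simp add: counit_tensor_hopf_tens mem)
  qed (simp_all add: slin lin mem elin that)
  have YZ: "sweedler ?T t (\<lambda>a b. ?Y a \<cdot> ?Z b) = \<epsilon>\<^bsub>?T\<^esub> t *s \<one>" if "t \<in> carrier (H \<Otimes> H)" for t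
  proof (rule tensor_ext[of H H H "\<lambda>t. sweedler ?T t (\<lambda>a b. ?Y a \<cdot> ?Z b)" "\<lambda>t. \<epsilon>\<^bsub>?T\<^esub> t *s \<one>"])
    fix h g assume [simp]: "h \<in> carrier H" "g \<in> carrier H"
    have "sweedler ?T (h \<otimes> g) (\<lambda>a b. ?Y a \<cdot> ?Z b) = sweedler H h (\<lambda>h1 h2. sweedler H g (\<lambda>g1 g2.
        h1 \<cdot> ((g1 \<cdot> S g2) \<cdot> S h2)))"
      by (simp add: sweedler_tensor_hopf[where U = H] lin mem pure algebraD(5))
    also have "\<dots> = \<epsilon>\<^bsub>?T\<^esub> (h \<otimes> g) *s \<one>"
      by (simp add: antipode_right[where U = H and f = "\<lambda>x. _ \<cdot> (x \<cdot> _)"]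
        sweedler_out[OF linear_on_scale_const[OF _ linear_on_id], symmetric] lin mem counit_tensor_hopf_tens mult.commute)
    finally show "sweedler ?T (h \<otimes> g) (\<lambda>a b. ?Y a \<cdot> ?Z b) = \<epsilon>\<^bsub>?T\<^esub> (h \<otimes> g) *s \<one>" .
  qed (simp_all add: slin lin mem elin that)
  have "?X (h \<otimes> g) = ?Z (h \<otimes> g)"
    by (rule convolution_inverse_unique[OF T, of H ?X ?Y ?Z])
      (use X Y Z XY YZ in \<open>simp_all add: mem\<close>)
  then show ?thesis by (simp add: pure)
qed

lemma comult_sweedler: "h \<in> carrier H \<Longrightarrow> \<Delta> h = sweedler H h (\<lambda>a b. a \<otimes> b)"
  unfolding sweedler_def by (rule tlift_ident[symmetric]) (simp_all add: mem)

text \<open>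
Both sides are convolution inverse to \<open>\<Delta>\<close>, as maps from \<open>H\<close> to the algebra \<open>H \<otimes> H\<close>.
\<close>
lemma comult_S:
  assumes [simp]: "h \<in> carrier H"
  shows "\<Delta> (S h) = sweedler H h (\<lambda>a b. S b \<otimes> S a)"
proof (rule convolution_inverse_unique[of H "tensor_hopf H H" "\<lambda>h. \<Delta> (S h)" "comult H" "\<lambda>h. sweedler H h (\<lambda>a b. S b \<otimes> S a)"])
  let ?T = "tensor_hopf H H"
  have tm: "tensor_mult H H (\<Delta> a) (\<Delta> b) = \<Delta> (a \<cdot> b)" if "a \<in> carrier H" "b \<in> carrier H" for a b
    using bialgebra that unfolding bialgebra_def by metis
  have dl: "linear_on H (H \<Otimes> H) (comult H)" by (rule coalgebraD) simp
  fix c assume [simp]: "c \<in> carrier H"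
  show "sweedler H c (\<lambda>a b. \<Delta> (S a) \<cdot>\<^bsub>?T\<^esub> \<Delta> b) = \<epsilon> c *s\<^bsub>?T\<^esub> \<one>\<^bsub>?T\<^esub>"
    by (simp add: tm mem sweedler_out[OF dl, symmetric] linear_onD(3)[OF dl])
  have "sweedler H c (\<lambda>a b. \<Delta> a \<cdot>\<^bsub>?T\<^esub> sweedler H b (\<lambda>a b. S b \<otimes> S a)) =
    sweedler H c (\<lambda>a r. sweedler H r (\<lambda>u v. sweedler H a (\<lambda>p q. (p \<cdot> S v) \<otimes> (q \<cdot> S u))))"
    by (simp add: comult_sweedler sweedler_out[OF linear_on_tensor_mult(1)[OF _ _ _ linear_on_id]]
       sweedler_out[OF linear_on_tensor_mult(2)[OF _ _ _ linear_on_id]] tensor_mult_tens mem)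
  also have "\<dots> = sweedler H c (\<lambda>a r. sweedler H a (\<lambda>p q. sweedler H r (\<lambda>u v. (p \<cdot> S v) \<otimes> (q \<cdot> S u))))"
    by (rule sweedler_cong[OF refl], rule sweedler_swap)
  also have "\<dots> = sweedler H c (\<lambda>p r. sweedler H r (\<lambda>q r. sweedler H r (\<lambda>u v. (p \<cdot> S v) \<otimes> (q \<cdot> S u))))"
    by (rule coassoc[where U = "H \<Otimes> H"]) (simp_all add: lin mem)
  also have "\<dots> = sweedler H c (\<lambda>p r. sweedler H r (\<lambda>q v. sweedler H q (\<lambda>q u. (p \<cdot> S v) \<otimes> (q \<cdot> S u))))"
    by (simp add: coassoc[where U = "H \<Otimes> H"] lin mem)
  also have "\<dots> = sweedler H c (\<lambda>p r. sweedler H r (\<lambda>q v. \<epsilon> q *s\<^bsub>H \<Otimes> H\<^esub> ((p \<cdot> S v) \<otimes> \<one>)))"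
    by (simp add: antipode_right[where U = "H \<Otimes> H"] lin mem)
  also have "\<dots> = \<epsilon> c *s\<^bsub>H \<Otimes> H\<^esub> (\<one> \<otimes> \<one>)"
    by (simp add: counit_left antipode_right[where U = "H \<Otimes> H" and f = "\<lambda>x. x \<otimes> \<one>"] lin mem)
  finally show "sweedler H c (\<lambda>a b. \<Delta> a \<cdot>\<^bsub>?T\<^esub> sweedler H b (\<lambda>a b. S b \<otimes> S a)) = \<epsilon> c *s\<^bsub>?T\<^esub> \<one>\<^bsub>?T\<^esub>"
    by simp
qed (simp_all add: algebra_tensor_hopf lin mem coalgebraD(2))

lemma sweedler_S:
  assumes [simp]: "h \<in> carrier H" "vspace U" and f: "bilinear_on H H U f"
  shows "sweedler H (S h) f = sweedler H h (\<lambda>a b. f (S b) (S a))"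
  unfolding sweedler_def[of H "S h"] comult_S[OF assms(1)]
  by (simp add: sweedler_out[OF tensor_universal_property(1)[OF _ _ _ f]] tlift_tens[where U = U] f mem)

end

section \<open>Antipode and integrals of a tensor product\<close>

context
  fixes A :: "('k::field, 'v::ab_group_add, 'x) hopf_data_scheme"
    and B :: "('k, 'w::ab_group_add, 'y) hopf_data_scheme"
begin

abbreviation (input) tens_factors (infix \<open>\<otimes>\<close> 65) where "a \<otimes> b \<equiv> a \<otimes>\<^bsub>A,B\<^esub> b"

lemma hopf_tensor_hopf:
  assumes "hopf A SA" and "hopf B SB"
  shows "hopf (tensor_hopf A B) (tlift A B (\<lambda>a b. SA a \<otimes> SB b))"
proof -
  interpret A: hopf A SA by fact
  interpret B: hopf B SB by fact
  let ?T = "tensor_hopf A B"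
  let ?one = "\<one>\<^bsub>A\<^esub> \<otimes> \<one>\<^bsub>B\<^esub>"
  let ?eps = "counit ?T"
  let ?V = "A \<Otimes> B"
  let ?S = "tlift A B (\<lambda>a b. SA a \<otimes> SB b)"
  have T: "bialgebra ?T" by (simp add: bialgebra_tensor_hopf)
  have S: "linear_on ?V ?V ?S" by (simp add: tensor_universal_property(1) lin mem)
  note [lin] = linear_on_compose[OF S] S
  note [mem] = linear_onD(1)[OF S]
  have pure: "?S (a \<otimes> b) = SA a \<otimes> SB b" if "a \<in> carrier A" "b \<in> carrier B" for a b
    using that by (simp_all add: tlift_tens[where U = ?V] lin mem)
  have cT: "coalgebra ?T" using T by simp
  note slin = linear_on_sweedler[OF cT, simplified tensor_hopf_transfer]
  have elin: "linear_on ?V ?V (\<lambda>t. ?eps t *s\<^bsub>?V\<^esub> ?one)"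
    using coalgebraD(3)[OF cT] by (simp add: lin mem)
  have l: "sweedler ?T t (\<lambda>a b. tensor_mult A B (?S a) b) = ?eps t *s\<^bsub>?V\<^esub> ?one"
    if t: "t \<in> carrier ?V" for t
  proof (rule tensor_ext[of A B ?V "\<lambda>t. sweedler ?T t (\<lambda>a b. tensor_mult A B (?S a) b)"
        "\<lambda>t. ?eps t *s\<^bsub>?V\<^esub> ?one"])
    fix a b assume [simp]: "a \<in> carrier A" "b \<in> carrier B"
    have "sweedler ?T (a \<otimes> b) (\<lambda>a b. tensor_mult A B (?S a) b) =
      sweedler A a (\<lambda>a1 a2. sweedler B b (\<lambda>b1 b2. (SA a1 \<cdot>\<^bsub>A\<^esub> a2) \<otimes> (SB b1 \<cdot>\<^bsub>B\<^esub> b2)))"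
      by (simp add: sweedler_tensor_hopf[where U = ?V] lin mem pure tensor_mult_tens)
    also have "\<dots> = ?eps (a \<otimes> b) *s\<^bsub>?V\<^esub> ?one"
      by (simp add: A.antipode_left[where U = ?V and f = "\<lambda>x. c *s\<^bsub>?V\<^esub> (x \<otimes> _)" for c] B.antipode_left[where U = ?V] lin mem counit_tensor_hopf_tens)
    finally show "sweedler ?T (a \<otimes> b) (\<lambda>a b. tensor_mult A B (?S a) b) = ?eps (a \<otimes> b) *s\<^bsub>?V\<^esub> ?one" .
  qed (simp_all add: slin lin mem elin t)
  have r: "sweedler ?T t (\<lambda>a b. tensor_mult A B a (?S b)) = ?eps t *s\<^bsub>?V\<^esub> ?one"
    if t: "t \<in> carrier ?V" for t
  proof (rule tensor_ext[of A B ?V "\<lambda>t. sweedler ?T t (\<lambda>a b. tensor_mult A B a (?S b))"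
        "\<lambda>t. ?eps t *s\<^bsub>?V\<^esub> ?one"])
    fix a b assume [simp]: "a \<in> carrier A" "b \<in> carrier B"
    have "sweedler ?T (a \<otimes> b) (\<lambda>a b. tensor_mult A B a (?S b)) =
      sweedler A a (\<lambda>a1 a2. sweedler B b (\<lambda>b1 b2. (a1 \<cdot>\<^bsub>A\<^esub> SA a2) \<otimes> (b1 \<cdot>\<^bsub>B\<^esub> SB b2)))"
      by (simp add: sweedler_tensor_hopf[where U = ?V] lin mem pure tensor_mult_tens)
    also have "\<dots> = ?eps (a \<otimes> b) *s\<^bsub>?V\<^esub> ?one"
      by (simp add: A.antipode_right[where U = ?V and f = "\<lambda>x. c *s\<^bsub>?V\<^esub> (x \<otimes> _)" for c] B.antipode_right[where U = ?V] lin mem counit_tensor_hopf_tens)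
    finally show "sweedler ?T (a \<otimes> b) (\<lambda>a b. tensor_mult A B a (?S b)) = ?eps (a \<otimes> b) *s\<^bsub>?V\<^esub> ?one" .
  qed (simp_all add: slin lin mem elin t)
  show ?thesis
    by (rule hopf.intro) (use T S l r in \<open>simp_all add: antipode_def\<close>)
qed

text \<open>
The maps \<open>id \<otimes> \<epsilon>\<close> and \<open>\<epsilon> \<otimes> id\<close> send integrals of the tensor product to integrals of the factors;
conversely, integrals \<open>a\<close> and \<open>b\<close> give the integral \<open>a \<otimes> b\<close>.
\<close>
lemma tensor_hopf_normalized_integral:
  assumes A [simp]: "bialgebra A" and B [simp]: "bialgebra B"
  shows "(\<exists>t \<in> left_integrals (tensor_hopf A B). \<epsilon>\<^bsub>tensor_hopf A B\<^esub> t = 1) \<longleftrightarrow>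
    (\<exists>a \<in> left_integrals A. \<epsilon>\<^bsub>A\<^esub> a = 1) \<and> (\<exists>b \<in> left_integrals B. \<epsilon>\<^bsub>B\<^esub> b = 1)"
proof
  let ?T = "tensor_hopf A B"
  let ?eps = "counit ?T"
  let ?V = "A \<Otimes> B"
  have cT: "coalgebra ?T" by (simp add: coalgebra_tensor_hopf)
  have epsT: "linear_on ?V ground ?eps" using coalgebraD(3)[OF cT] by simp
  have eA: "linear_on A ground (counit A)" and eB: "linear_on B ground (counit B)" by (simp_all add: coalgebraD(3))
  {
    assume "\<exists>t \<in> left_integrals ?T. ?eps t = 1"
    then obtain t where t: "t \<in> left_integrals ?T" and et: "?eps t = 1" by blast
    have tV [simp]: "t \<in> carrier ?V" using t by (simp add: left_integrals_def)
    have ti: "tensor_mult A B s t = ?eps s *s\<^bsub>?V\<^esub> t" if "s \<in> carrier ?V" for s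
      using t that by (simp add: left_integrals_def)
    let ?p = "tlift A B (\<lambda>a b. \<epsilon>\<^bsub>B\<^esub> b *s\<^bsub>A\<^esub> a)" and ?q = "tlift A B (\<lambda>a b. \<epsilon>\<^bsub>A\<^esub> a *s\<^bsub>B\<^esub> b)"
    have p: "linear_on ?V A ?p" and q: "linear_on ?V B ?q"
      by (simp_all add: tensor_universal_property(1) lin)
    have pp: "?p (a \<otimes> b) = \<epsilon>\<^bsub>B\<^esub> b *s\<^bsub>A\<^esub> a" and qq: "?q (a \<otimes> b) = \<epsilon>\<^bsub>A\<^esub> a *s\<^bsub>B\<^esub> b"
      if "a \<in> carrier A" "b \<in> carrier B" for a b
      using that by (simp_all add: tlift_tens[where U = A] tlift_tens[where U = B] lin)
    note [lin] = linear_on_compose[OF p] linear_on_compose[OF q] p q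
    note [mem] = linear_onD(1)[OF p] linear_onD(1)[OF q]
    have ep: "\<epsilon>\<^bsub>A\<^esub> (?p t) = ?eps t"
      by (rule tensor_ext[of A B ground "\<lambda>t. \<epsilon>\<^bsub>A\<^esub> (?p t)" ?eps])
        (simp_all add: epsT lin mem pp counit_tensor_hopf_tens linear_onD(3)[OF eA] ac_simps)
    have eq: "\<epsilon>\<^bsub>B\<^esub> (?q t) = ?eps t"
      by (rule tensor_ext[of A B ground "\<lambda>t. \<epsilon>\<^bsub>B\<^esub> (?q t)" ?eps])
        (simp_all add: epsT lin mem qq counit_tensor_hopf_tens linear_onD(3)[OF eB] ac_simps)
    have "a \<cdot>\<^bsub>A\<^esub> ?p t = \<epsilon>\<^bsub>A\<^esub> a *s\<^bsub>A\<^esub> ?p t" if [simp]: "a \<in> carrier A" for a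
    proof -
      have "a \<cdot>\<^bsub>A\<^esub> ?p t = ?p (tensor_mult A B (a \<otimes> \<one>\<^bsub>B\<^esub>) t)"
        by (rule tensor_ext[of A B A "\<lambda>t. a \<cdot>\<^bsub>A\<^esub> ?p t" "\<lambda>t. ?p (tensor_mult A B (a \<otimes> \<one>\<^bsub>B\<^esub>) t)"])
          (simp_all add: lin mem pp tensor_mult_tens mult_scale)
      then show ?thesis by (simp add: ti mem counit_tensor_hopf_tens linear_onD(3)[OF p])
    qed
    moreover have "b \<cdot>\<^bsub>B\<^esub> ?q t = \<epsilon>\<^bsub>B\<^esub> b *s\<^bsub>B\<^esub> ?q t" if [simp]: "b \<in> carrier B" for b
    proof -
      have "b \<cdot>\<^bsub>B\<^esub> ?q t = ?q (tensor_mult A B (\<one>\<^bsub>A\<^esub> \<otimes> b) t)"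
        by (rule tensor_ext[of A B B "\<lambda>t. b \<cdot>\<^bsub>B\<^esub> ?q t" "\<lambda>t. ?q (tensor_mult A B (\<one>\<^bsub>A\<^esub> \<otimes> b) t)"])
          (simp_all add: lin mem qq tensor_mult_tens mult_scale)
      then show ?thesis by (simp add: ti mem counit_tensor_hopf_tens linear_onD(3)[OF q])
    qed
    ultimately have "?p t \<in> left_integrals A" "?q t \<in> left_integrals B"
      by (simp_all add: left_integrals_def mem)
    then show "(\<exists>a \<in> left_integrals A. \<epsilon>\<^bsub>A\<^esub> a = 1) \<and> (\<exists>b \<in> left_integrals B. \<epsilon>\<^bsub>B\<^esub> b = 1)"
      using ep eq et by metis
  next
    assume "(\<exists>a \<in> left_integrals A. \<epsilon>\<^bsub>A\<^esub> a = 1) \<and> (\<exists>b \<in> left_integrals B. \<epsilon>\<^bsub>B\<^esub> b = 1)"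
    then obtain a b where ab: "a \<in> left_integrals A" "\<epsilon>\<^bsub>A\<^esub> a = 1" "b \<in> left_integrals B" "\<epsilon>\<^bsub>B\<^esub> b = 1" by blast
    have [simp]: "a \<in> carrier A" "b \<in> carrier B"
      and ai: "\<And>x. x \<in> carrier A \<Longrightarrow> x \<cdot>\<^bsub>A\<^esub> a = \<epsilon>\<^bsub>A\<^esub> x *s\<^bsub>A\<^esub> a" and bi: "\<And>y. y \<in> carrier B \<Longrightarrow> y \<cdot>\<^bsub>B\<^esub> b = \<epsilon>\<^bsub>B\<^esub> y *s\<^bsub>B\<^esub> b"
      using ab by (auto simp: left_integrals_def)
    let ?t = "a \<otimes> b"
    have ts: "(k *s\<^bsub>A\<^esub> a) \<otimes> y = k *s\<^bsub>?V\<^esub> (a \<otimes> y)" "a \<otimes> (k *s\<^bsub>B\<^esub> b) = k *s\<^bsub>?V\<^esub> (a \<otimes> b)"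
      if "y \<in> carrier B" for k y
      using linear_onD(3)[OF linear_on_tens(1)[OF _ _ _ linear_on_id, of A B y], of a k]
        linear_onD(3)[OF linear_on_tens_left[of A B a], of b k] that by simp_all
    have "tensor_mult A B s ?t = ?eps s *s\<^bsub>?V\<^esub> ?t" if "s \<in> carrier ?V" for s
      by (rule tensor_ext[of A B ?V "\<lambda>s. tensor_mult A B s ?t" "\<lambda>s. ?eps s *s\<^bsub>?V\<^esub> ?t"])
        (use that in \<open>simp_all add: lin mem epsT tensor_mult_tens counit_tensor_hopf_tens ai bi ts\<close>)
    then have "?t \<in> left_integrals ?T" by (simp add: left_integrals_def mem)
    moreover have "?eps ?t = 1" using ab counit_tensor_hopf_tens[of A B a b] by simp
    ultimately show "\<exists>t \<in> left_integrals ?T. ?eps t = 1" by blast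
  }
qed

end

section \<open>Integrals, semisimplicity and separability\<close>

lemma left_idealD:
  fixes A (structure)
  assumes "left_ideal A I" "vspace A"
  shows "x \<in> I \<Longrightarrow> x \<in> carrier A" "0 \<in> I" "x \<in> I \<Longrightarrow> y \<in> I \<Longrightarrow> x + y \<in> I" "x \<in> I \<Longrightarrow> y \<in> I \<Longrightarrow> x - y \<in> I"
    "x \<in> I \<Longrightarrow> c *s x \<in> I" "a \<in> carrier A \<Longrightarrow> x \<in> I \<Longrightarrow> a \<cdot> x \<in> I"
proof -
  have V: "vspace \<lparr>carrier = I, scale = scale A\<rparr>"
    using assms by (simp add: vspace_def left_ideal_def)
  show "x \<in> I \<Longrightarrow> x \<in> carrier A" "a \<in> carrier A \<Longrightarrow> x \<in> I \<Longrightarrow> a \<cdot> x \<in> I"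
    using assms by (auto simp: left_ideal_def)
  show "0 \<in> I" "x \<in> I \<Longrightarrow> y \<in> I \<Longrightarrow> x + y \<in> I" "x \<in> I \<Longrightarrow> y \<in> I \<Longrightarrow> x - y \<in> I"
    "x \<in> I \<Longrightarrow> c *s x \<in> I"
    using vspaceD(1-3,5)[OF V] by auto
qed

lemma left_idealI:
  fixes A (structure)
  assumes "vspace A" "I \<subseteq> carrier A" "0 \<in> I" "\<And>x y. x \<in> I \<Longrightarrow> y \<in> I \<Longrightarrow> x + y \<in> I"
    "\<And>c x. x \<in> I \<Longrightarrow> c *s x \<in> I" "\<And>a x. a \<in> carrier A \<Longrightarrow> x \<in> I \<Longrightarrow> a \<cdot> x \<in> I"
  shows "left_ideal A I"
proof -
  have "module (scale A)" using assms(1) by (simp add: vspace_def module_iff_vector_space)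
  then show ?thesis using assms by (simp add: left_ideal_def module.subspace_def)
qed

lemma left_ideal_kernel:
  fixes A (structure)
  assumes "algebra A" "vspace U" "linear_on A U f"
    and "\<And>a x. a \<in> carrier A \<Longrightarrow> x \<in> carrier A \<Longrightarrow> f x = 0 \<Longrightarrow> f (a \<cdot> x) = 0"
  shows "left_ideal A {x \<in> carrier A. f x = 0}"
  by (rule left_idealI)
    (use assms in \<open>auto simp: mem linear_onD[OF assms(3)] linear_on_0[OF assms(3)]\<close>)

text \<open>
The kernel of \<open>\<epsilon>\<close> is a left ideal. In a complement \<open>J\<close> of it take the component \<open>t\<close> of the unit: then
\<open>h t - \<epsilon>(h) t\<close> lies both in \<open>J\<close> and in the kernel.
\<close>
lemma semisimple_imp_normalized_integral:
  fixes H (structure)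
  assumes H: "bialgebra H" and ss: "semisimple H"
  shows "\<exists>t \<in> left_integrals H. \<epsilon> t = 1"
proof -
  note [simp] = H
  have e: "linear_on H ground (counit H)" by (simp add: coalgebraD(3))
  let ?K = "{x \<in> carrier H. \<epsilon> x = 0}"
  have "left_ideal H ?K"
    by (rule left_ideal_kernel[of H ground]) (simp_all add: e)
  from ss[unfolded semisimple_def, rule_format, OF this]
  obtain J where J: "left_ideal H J" "?K \<inter> J = {0}" "carrier H = {x + y | x y. x \<in> ?K \<and> y \<in> J}"
    by (elim exE conjE)
  have "\<one> \<in> carrier H" by (simp add: mem)
  from subsetD[OF equalityD1[OF J(3)] this]
  have "\<exists>x t. \<one> = x + t \<and> x \<in> ?K \<and> t \<in> J" by (rule CollectD)
  then obtain x t where xt: "\<one> = x + t" "x \<in> ?K" "t \<in> J" by (elim exE conjE)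
  note JD = left_idealD[OF J(1)]
  have t: "t \<in> carrier H" using JD(1) xt by simp
  have et: "\<epsilon> t = 1"
  proof -
    have "\<epsilon> (x + t) = 1" using xt(1) H by (metis bialgebraD(3))
    then show ?thesis using xt(2) t by (simp add: linear_onD(2)[OF e])
  qed
  have "h \<cdot> t = \<epsilon> h *s t" if h: "h \<in> carrier H" for h
  proof -
    have "h \<cdot> t - \<epsilon> h *s t \<in> J" using h xt(3) by (simp add: JD)
    moreover have "\<epsilon> (h \<cdot> t - \<epsilon> h *s t) = 0"
      using h t et by (simp add: linear_on_diff[OF e] linear_onD(3)[OF e] mem)
    moreover have "h \<cdot> t - \<epsilon> h *s t \<in> carrier H" using h t by (simp add: mem)
    ultimately have "h \<cdot> t - \<epsilon> h *s t \<in> ?K \<inter> J" by blast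
    then show ?thesis using J(2) by simp
  qed
  then show ?thesis using t et by (auto simp: left_integrals_def)
qed

text \<open>
The separability idempotent is \<open>t\<^sub>1 \<otimes> S t\<^sub>2\<close>. It commutes with \<open>a\<close> because
\<open>a t\<^sub>1 \<otimes> S t\<^sub>2 = a\<^sub>1 t\<^sub>1 \<otimes> S (a\<^sub>2 t\<^sub>2) a\<^sub>3\<close>, where \<open>a\<^sub>1 t\<close> may be replaced by \<open>\<epsilon>(a\<^sub>1) t\<close>.
\<close>
lemma (in hopf) normalized_integral_imp_separable:
  assumes t: "t \<in> left_integrals H" and et: "\<epsilon> t = 1"
  shows "separable H"
proof -
  have [simp]: "t \<in> carrier H" using t by (simp add: left_integrals_def)
  have ht: "h \<cdot> t = \<epsilon> h *s t" if "h \<in> carrier H" for h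
    using t that by (simp add: left_integrals_def)
  let ?V = "H \<Otimes> H"
  let ?e = "sweedler H t (\<lambda>a b. a \<otimes> S b)"
  have e: "?e \<in> carrier ?V" by (simp add: mem)
  have ev: "tlift H H f ?e = sweedler H t (\<lambda>a b. f a (S b))" if [simp]: "vspace U" and f: "bilinear_on H H U f"
    for f and U :: "('k, 'u::ab_group_add, 'z) vspace_scheme"
    by (simp add: sweedler_out[OF tensor_universal_property(1)[OF _ _ _ f]] tlift_tens[where U = U] f mem)
  have one: "tlift H H (mult H) ?e = \<one>"
    by (simp add: ev[of H] lin et)
  have eq: "tlift H H (\<lambda>x y. (a \<cdot> x) \<otimes> y) ?e = tlift H H (\<lambda>x y. x \<otimes> (y \<cdot> a)) ?e"
    if [simp]: "a \<in> carrier H" for a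
  proof -
    have "tlift H H (\<lambda>x y. (a \<cdot> x) \<otimes> y) ?e = sweedler H t (\<lambda>t1 t2. (a \<cdot> t1) \<otimes> S t2)"
      by (simp add: ev[of ?V] lin mem)
    also have "\<dots> = sweedler H t (\<lambda>t1 t2. sweedler H a (\<lambda>a1 a2. \<epsilon> a2 *s\<^bsub>?V\<^esub> ((a1 \<cdot> t1) \<otimes> S t2)))"
      by (simp add: counit_right[where U = ?V] lin mem)
    also have "\<dots> = sweedler H t (\<lambda>t1 t2. sweedler H a (\<lambda>a1 a2. sweedler H a2 (\<lambda>p q.
        (a1 \<cdot> t1) \<otimes> (S t2 \<cdot> (S p \<cdot> q)))))"
      by (simp add: antipode_left[where U = ?V and f = "\<lambda>x. _ \<otimes> (_ \<cdot> x)"] lin mem)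
    also have "\<dots> = sweedler H t (\<lambda>t1 t2. sweedler H a (\<lambda>r a3. sweedler H r (\<lambda>a1 a2.
        (a1 \<cdot> t1) \<otimes> (S t2 \<cdot> (S a2 \<cdot> a3)))))"
      by (simp add: coassoc[where U = ?V] lin mem)
    also have "\<dots> = sweedler H a (\<lambda>r a3. sweedler H r (\<lambda>a1 a2. sweedler H t (\<lambda>t1 t2.
        (a1 \<cdot> t1) \<otimes> (S t2 \<cdot> (S a2 \<cdot> a3)))))"
      by (simp add: sweedler_swap[of H t])
    also have "\<dots> = sweedler H a (\<lambda>r a3. sweedler H (r \<cdot> t) (\<lambda>x y. x \<otimes> (S y \<cdot> a3)))"
      by (simp add: sweedler_mult[where U = ?V] S_mult algebraD(5) lin mem)
    also have "\<dots> = sweedler H a (\<lambda>r a3. \<epsilon> r *s\<^bsub>?V\<^esub> sweedler H t (\<lambda>x y. x \<otimes> (S y \<cdot> a3)))"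
      by (simp add: ht linear_onD(3)[OF linear_on_sweedler[of H ?V]] lin mem)
    also have "\<dots> = sweedler H t (\<lambda>x y. x \<otimes> (S y \<cdot> a))"
      by (simp add: counit_left lin mem)
    also have "\<dots> = tlift H H (\<lambda>x y. x \<otimes> (y \<cdot> a)) ?e"
      by (simp add: ev[of ?V] lin mem)
    finally show ?thesis .
  qed
  show ?thesis unfolding separable_def using e one eq by blast
qed

text \<open>
Maschke's averaging: if \<open>p\<close> is a linear projection onto the left ideal \<open>I\<close> and \<open>e\<close> is the sum of the
\<open>x \<otimes> y\<close>, then \<open>a \<mapsto> x p(y a)\<close> is a left linear projection onto \<open>I\<close>, and its kernel is a complement.
\<close>
lemma separable_imp_semisimple:
  fixes A (structure)
  assumes A: "algebra A" and sep: "separable A"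
  shows "semisimple A"
  unfolding semisimple_def
proof (intro allI impI)
  fix I assume I: "left_ideal A I"
  note [simp] = A
  note ID = left_idealD[OF I algebraD(1)[OF A]]
  obtain e where e [simp]: "e \<in> carrier (A \<Otimes> A)" and e1: "tlift A A (mult A) e = \<one>"
    and ea: "\<And>a. a \<in> carrier A \<Longrightarrow>
      tlift A A (\<lambda>x y. (a \<cdot> x) \<otimes>\<^bsub>A,A\<^esub> y) e = tlift A A (\<lambda>x y. x \<otimes>\<^bsub>A,A\<^esub> (y \<cdot> a)) e"
    using sep unfolding separable_def by blast
  let ?I = "\<lparr>carrier = I, scale = scale A\<rparr>"
  have V [simp]: "vspace ?I" using I algebraD(1)[OF A] by (simp add: vspace_def left_ideal_def)
  obtain p where p: "Vector_Spaces.linear (scale A) (scale A) p" "\<And>v. p v \<in> I" "\<And>v. v \<in> I \<Longrightarrow> p v = v"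
    using subspace_projection[OF V] by auto
  interpret p: Vector_Spaces.linear "scale A" "scale A" p by fact
  have plin: "linear_on A A p"
    using p(2) ID(1) by (auto simp: linear_on_def p.add p.scale)
  note [lin] = plin linear_on_compose[OF plin]
  note [mem] = linear_onD(1)[OF plin]
  define P where "P a = tlift A A (\<lambda>x y. x \<cdot> p (y \<cdot> a)) e" for a
  have Plin: "linear_on A A P" unfolding P_def by (simp add: lin mem)
  have PI: "P a \<in> I" if "a \<in> carrier A" for a
    using tlift_in[of A A ?I e "\<lambda>x y. x \<cdot> p (y \<cdot> a)"] p(2) ID(6) by (simp add: P_def)
  have Pid: "P a = a" if a: "a \<in> I" for a
  proof -
    have [simp]: "a \<in> carrier A" using ID(1) a .
    have "P a = tlift A A (\<lambda>x y. (x \<cdot> y) \<cdot> a) e"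
      unfolding P_def by (rule tlift_cong[OF refl]) (simp add: p(3) ID(6) a algebraD(5))
    also have "\<dots> = tlift A A (mult A) e \<cdot> a"
      by (rule tlift_out[symmetric, of A A "\<lambda>x. x \<cdot> a"]) (simp_all add: lin mem)
    finally show ?thesis by (simp add: e1)
  qed
  have Pmult: "P (b \<cdot> a) = b \<cdot> P a" if [simp]: "a \<in> carrier A" "b \<in> carrier A" for a b
  proof -
    let ?f = "\<lambda>x y. x \<cdot> p (y \<cdot> a)"
    have f: "bilinear_on A A A ?f" by (simp add: lin mem)
    have "P (b \<cdot> a) = tlift A A ?f (tlift A A (\<lambda>x y. x \<otimes>\<^bsub>A,A\<^esub> (y \<cdot> b)) e)"
      unfolding P_def by (simp add: tlift_tlift[where U = A, OF _ _ _ _ _ f] tlift_tens[where U = A] f mem algebraD(5) cong: tlift_cong)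
    also have "\<dots> = tlift A A ?f (tlift A A (\<lambda>x y. (b \<cdot> x) \<otimes>\<^bsub>A,A\<^esub> y) e)"
      by (simp add: ea)
    also have "\<dots> = tlift A A (\<lambda>x y. b \<cdot> ?f x y) e"
      by (simp add: tlift_tlift[where U = A, OF _ _ _ _ _ f] tlift_tens[where U = A] f mem algebraD(5) cong: tlift_cong)
    also have "\<dots> = b \<cdot> P a"
      unfolding P_def by (rule tlift_out[symmetric, of A A "mult A b"]) (simp_all add: lin mem)
    finally show ?thesis .
  qed
  let ?J = "{x \<in> carrier A. P x = 0}"
  have J: "left_ideal A ?J"
    by (rule left_ideal_kernel[of A A]) (simp_all add: Plin Pmult linear_on_0[OF linear_on_mult_left])
  have IJ: "I \<inter> ?J = {0}" using Pid ID(2) linear_on_0[OF Plin] ID(1) by auto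
  have "x \<in> {x + y | x y. x \<in> I \<and> y \<in> ?J}" if x: "x \<in> carrier A" for x
  proof -
    have "x - P x \<in> ?J"
      using x linear_on_diff[OF Plin _ x, of "P x"] Pid[OF PI[OF x]] PI[OF x] ID(1) by (simp add: mem)
    then show ?thesis using PI[OF x] by (intro CollectI exI[of _ "P x"] exI[of _ "x - P x"]) simp
  qed
  moreover have "x + y \<in> carrier A" if "x \<in> I" "y \<in> ?J" for x y
    using that ID(1) by (simp add: mem)
  ultimately have "carrier A = {x + y | x y. x \<in> I \<and> y \<in> ?J}" by blast
  with J IJ show "\<exists>J. left_ideal A J \<and> I \<inter> J = {0} \<and> carrier A = {x + y | x y. x \<in> I \<and> y \<in> J}"
    by blast
qed

section \<open>Sums, coordinates and finite dimension\<close>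

lemma linear_on_sum [lin]:
  assumes "vspace V" "vspace W" "\<And>i. i \<in> I \<Longrightarrow> linear_on V W (f i)"
  shows "linear_on V W (\<lambda>x. \<Sum>i\<in>I. f i x)"
  using assms(3)
proof (induction I rule: infinite_finite_induct)
  case (insert i I)
  then show ?case
    using linear_onD[of V W "f i"]
    by (auto simp: linear_on_def mem assms vspaceD(6)[OF assms(2)] algebra_simps)
qed (auto simp: linear_on_def mem assms)

lemma sum_in [mem]: "vspace V \<Longrightarrow> (\<And>i. i \<in> I \<Longrightarrow> f i \<in> carrier V) \<Longrightarrow> (\<Sum>i\<in>I. f i) \<in> carrier V"
  by (induction I rule: infinite_finite_induct) (auto simp: mem)

lemma sum_out:
  assumes "linear_on V W g" "vspace V" "vspace W" "\<And>i. i \<in> I \<Longrightarrow> f i \<in> carrier V"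
  shows "g (\<Sum>i\<in>I. f i) = (\<Sum>i\<in>I. g (f i))"
  using assms(4)
  by (induction I rule: infinite_finite_induct)
    (auto simp: linear_on_0[OF assms(1-3)] linear_onD(2)[OF assms(1)] mem assms)

lemma scale_sum_left:
  assumes "vspace V" shows "(\<Sum>i\<in>I. c i) *s\<^bsub>V\<^esub> v = (\<Sum>i\<in>I. c i *s\<^bsub>V\<^esub> v)"
  by (induction I rule: infinite_finite_induct) (auto simp: assms vspaceD(7)[OF assms])

text \<open>
A finite basis \<open>I\<close> with its coordinate functionals: \<open>c i x\<close> is the coordinate of \<open>x\<close> at \<open>i \<in> I\<close>.
\<close>
definition coord_basis where
  "coord_basis V I c \<longleftrightarrow> finite I \<and> I \<subseteq> carrier V \<and> (\<forall>i. linear_on V ground (c i)) \<and>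
     (\<forall>x \<in> carrier V. (\<Sum>i\<in>I. c i x *s\<^bsub>V\<^esub> i) = x) \<and>
     (\<forall>i \<in> I. \<forall>j \<in> I. c i j = (if i = j then 1 else 0))"

lemma finite_dim_coord_basis:
  assumes "vspace V" "finite_dim V"
  shows "\<exists>I c. coord_basis V I c"
proof -
  interpret vector_space "scale V" using assms(1) by (simp add: vspace_def)
  obtain B where B: "finite B" "B \<subseteq> carrier V" "span B = carrier V"
    using assms(2) unfolding finite_dim_def by blast
  obtain I where I: "I \<subseteq> B" "independent I" "B \<subseteq> span I"
    using maximal_independent_subset[of B] by blast
  have sI: "span I = carrier V" using I B by (metis span_minimal span_mono subset_antisym subspace_span)
  have "finite I" using I B finite_subset by blast
  moreover have "linear_on V ground (\<lambda>x. representation I x i)" for i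
    using I sI by (auto simp: linear_on_def representation_add representation_scale)
  moreover have "(\<Sum>i\<in>I. representation I x i *s\<^bsub>V\<^esub> i) = x" if "x \<in> carrier V" for x
    using sum_representation_eq[OF I(2), of x I] that sI \<open>finite I\<close> by simp
  moreover have "representation I j i = (if i = j then 1 else 0)" if "i \<in> I" "j \<in> I" for i j
    using representation_basis[OF I(2) that(2)] by simp
  ultimately have "coord_basis V I (\<lambda>i x. representation I x i)"
    using I B by (auto simp: coord_basis_def)
  then show ?thesis by blast
qed

lemma linear_inj_imp_surj:
  assumes "vspace V" "finite_dim V" "linear_on V V f" "\<And>v. v \<in> carrier V \<Longrightarrow> f v = 0 \<Longrightarrow> v = 0"
  shows "f ` carrier V = carrier V"
proof -
  interpret vector_space "scale V" using assms(1) by (simp add: vspace_def)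
  interpret vp: vector_space_pair "scale V" "scale V" ..
  obtain B where B: "finite B" "B \<subseteq> carrier V" "span B = carrier V"
    using assms(2) unfolding finite_dim_def by blast
  obtain I where I: "I \<subseteq> B" "independent I" "B \<subseteq> span I"
    using maximal_independent_subset[of B] by blast
  have sI: "span I = carrier V" using I B by (metis span_minimal span_mono subset_antisym subspace_span)
  have fI: "finite I" using I B finite_subset by blast
  obtain g where g: "Vector_Spaces.linear (scale V) (scale V) g" "\<forall>x\<in>I. g x = f x"
    using vp.linear_independent_extend[OF I(2), of f] by blast
  interpret g: Vector_Spaces.linear "scale V" "scale V" g by fact
  have gf': "x \<in> carrier V \<and> g x = f x" if "x \<in> span I" for x
    using that
  proof (induction rule: span_induct_alt)
    case base
    then show ?case using linear_on_0[OF assms(3) assms(1) assms(1)] by (simp add: mem assms(1))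
  next
    case (step c x y)
    then have "x \<in> carrier V" using I B by auto
    then show ?case using step g(2) linear_onD[OF assms(3)]
      by (simp add: g.add g.scale mem assms(1))
  qed
  then have gf: "g x = f x" if "x \<in> span I" for x using that by blast
  have inj: "inj_on g (span I)"
    using assms(1,4) gf sI by (subst g.inj_on_iff_eq_0) (auto simp: vspace_def)
  have ind: "independent (g ` I)"
    by (rule g.independent_injective_image[OF I(2) inj])
  have sub: "g ` I \<subseteq> carrier V" using I(1) B gf sI linear_onD(1)[OF assms(3)] by (auto simp: span_base)
  have card: "card (g ` I) = card I" using inj by (meson card_image inj_on_subset span_superset)
  have "carrier V \<subseteq> span (g ` I)"
  proof
    fix v assume v: "v \<in> carrier V"
    show "v \<in> span (g ` I)"
    proof (rule ccontr)
      assume n: "v \<notin> span (g ` I)"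
      then have "independent (insert v (g ` I))" using ind independent_insertI by blast
      moreover have "insert v (g ` I) \<subseteq> span I" using sub v sI by auto
      ultimately have "card (insert v (g ` I)) \<le> card I" using independent_span_bound[OF fI] by blast
      moreover have "v \<notin> g ` I" using n span_base by blast
      ultimately show False using card fI by simp
    qed
  qed
  also have "span (g ` I) = g ` carrier V" by (simp add: g.span_image sI)
  finally show ?thesis using gf sI linear_onD(1)[OF assms(3)] by (auto simp: image_def)
qed

section \<open>Integrals on a finite dimensional Hopf algebra, after Larson and Sweedler\<close>

locale hopf_basis = hopf H S for H :: "('k::field, 'v::ab_group_add, 'x) hopf_data_scheme" (structure) and S +
  fixes I :: "'v set" and c :: "'v \<Rightarrow> 'v \<Rightarrow> 'k"
  assumes basis: "coord_basis H I c"
begin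

lemma c_linear: "linear_on H ground (c i)" using basis by (simp add: coord_basis_def)
lemmas c_linear' [lin] = c_linear linear_on_compose[OF c_linear]

lemma finite_I [simp]: "finite I" using basis by (simp add: coord_basis_def)

lemma I_in [mem]: "i \<in> I \<Longrightarrow> i \<in> carrier H"
  using basis by (auto simp: coord_basis_def)

lemma c_basis: "i \<in> I \<Longrightarrow> j \<in> I \<Longrightarrow> c i j = (if i = j then 1 else 0)"
  using basis by (simp add: coord_basis_def)

lemma expand: "x \<in> carrier H \<Longrightarrow> (\<Sum>i\<in>I. c i x *s i) = x"
  using basis by (simp add: coord_basis_def)

lemma expand_linear:
  assumes "linear_on H U f" "vspace U" "x \<in> carrier H"
  shows "(\<Sum>i\<in>I. c i x *s\<^bsub>U\<^esub> f i) = f x"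
proof -
  have "f x = f (\<Sum>i\<in>I. c i x *s i)" by (simp add: expand assms)
  also have "\<dots> = (\<Sum>i\<in>I. c i x *s\<^bsub>U\<^esub> f i)"
    by (subst sum_out[OF assms(1)]) (auto intro!: sum.cong simp: linear_onD(3)[OF assms(1)] mem assms)
  finally show ?thesis ..
qed

lemmas expand_form = expand_linear[where U = ground, simplified]

text \<open>
The structure constants of the comultiplication; \<open>sweedler_expand\<close> writes a Sweedler sum with them.
\<close>
definition comult_coeff where "comult_coeff j k y = sweedler H y (\<lambda>u v. c j u * c k v)"

lemma comult_coeff_linear [lin]: "linear_on V H f \<Longrightarrow> linear_on V ground (\<lambda>x. comult_coeff j k (f x))"
  unfolding comult_coeff_def by (simp add: lin)

lemma sweedler_expand:
  assumes "y \<in> carrier H" "vspace U" "bilinear_on H H U Q"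
  shows "sweedler H y Q = (\<Sum>j\<in>I. \<Sum>k\<in>I. comult_coeff j k y *s\<^bsub>U\<^esub> Q j k)"
proof -
  note [simp] = assms(1,2) bilinear_onD(3)[OF assms(3)]
  have "sweedler H y Q = sweedler H y (\<lambda>u v. \<Sum>j\<in>I. \<Sum>k\<in>I. (c j u * c k v) *s\<^bsub>U\<^esub> Q j k)"
  proof (rule sweedler_cong[OF refl])
    fix u v assume "coalgebra H \<and> y \<in> carrier H \<longrightarrow> u \<in> carrier H \<and> v \<in> carrier H"
    then have [simp]: "u \<in> carrier H" "v \<in> carrier H" by auto
    have "Q u v = (\<Sum>j\<in>I. c j u *s\<^bsub>U\<^esub> Q j v)"
      by (rule expand_linear[symmetric]) (simp_all add: bilinear_onD(1)[OF assms(3)])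
    also have "\<dots> = (\<Sum>j\<in>I. c j u *s\<^bsub>U\<^esub> (\<Sum>k\<in>I. c k v *s\<^bsub>U\<^esub> Q j k))"
      by (intro sum.cong refl arg_cong[where f = "scale U _"] expand_linear[symmetric])
        (simp_all add: bilinear_onD(2)[OF assms(3)] mem)
    also have "\<dots> = (\<Sum>j\<in>I. \<Sum>k\<in>I. (c j u * c k v) *s\<^bsub>U\<^esub> Q j k)"
      by (intro sum.cong refl, subst sum_out[OF linear_on_scale_const[OF _ linear_on_id]]) (simp_all add: mem)
    finally show "Q u v = (\<Sum>j\<in>I. \<Sum>k\<in>I. (c j u * c k v) *s\<^bsub>U\<^esub> Q j k)" .
  qed
  also have "\<dots> = (\<Sum>j\<in>I. \<Sum>k\<in>I. comult_coeff j k y *s\<^bsub>U\<^esub> Q j k)"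
    by (simp add: sweedler_sum comult_coeff_def, intro sum.cong refl, subst sweedler_out[of ground U, where g = "\<lambda>x. x *s\<^bsub>U\<^esub> _"])
      (simp_all add: lin mem)
  finally show ?thesis .
qed

text \<open>
This is the trace of the endomorphism \<open>y \<mapsto> w\<^sub>1 f(w\<^sub>2)\<close> of \<open>H\<close>, where \<open>w = x S\<^sup>2(y)\<close>. It arises from
the projection \<open>f\<^sub>0 S(f\<^sub>1)\<close> of the dual of \<open>H\<close>, seen as a Hopf module over \<open>H\<close>, onto its coinvariants,
which are the functionals of the kind described by \<open>trace_integral\<close> below.
\<close>
definition trace_integral :: "('v \<Rightarrow> 'k) \<Rightarrow> 'v \<Rightarrow> 'k" where
  "trace_integral f x = (\<Sum>i\<in>I. sweedler H (x \<cdot> S (S i)) (\<lambda>a b. c i a * f b))"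

lemma linear_on_trace_integral:
  assumes "linear_on H ground f"
  shows "linear_on H ground (trace_integral f)"
proof -
  note [lin] = linear_on_compose[OF assms] assms
  show ?thesis unfolding trace_integral_def by (simp add: lin mem)
qed

text \<open>
Read from right to left, the factor \<open>S\<^sup>2(y\<^sub>2) S(y\<^sub>1)\<close>, which collapses to \<open>\<epsilon>(y)\<close>, is inserted next to
\<open>x\<^sub>1\<close>, so as to make \<open>x\<^sub>1\<close> and \<open>x\<^sub>2 S\<^sup>2(y)\<close> the two legs of one coproduct.
\<close>
lemma translate_comult:
  assumes [simp]: "x \<in> carrier H" "y \<in> carrier H" "vspace U" and g: "bilinear_on H H U g"
  shows "sweedler H y (\<lambda>y1 y2. sweedler H (x \<cdot> S (S y2)) (\<lambda>w1 w2. g (w1 \<cdot> S y1) w2)) =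
    sweedler H x (\<lambda>x1 x2. g x1 (x2 \<cdot> S (S y)))"
proof -
  note [lin] = bilinear_on_compose[OF g]
  have "sweedler H y (\<lambda>y1 y2. sweedler H (x \<cdot> S (S y2)) (\<lambda>w1 w2. g (w1 \<cdot> S y1) w2)) =
    sweedler H y (\<lambda>y1 r. sweedler H x (\<lambda>x1 x2. sweedler H r (\<lambda>p q.
      g ((x1 \<cdot> S (S p)) \<cdot> S y1) (x2 \<cdot> S (S q)))))"
    by (simp add: sweedler_mult[where U = U] sweedler_S[where U = U] lin mem)
  also have "\<dots> = sweedler H x (\<lambda>x1 x2. sweedler H y (\<lambda>y1 r. sweedler H r (\<lambda>p q.
      g ((x1 \<cdot> S (S p)) \<cdot> S y1) (x2 \<cdot> S (S q)))))"
    by (simp add: sweedler_swap[of H y H x])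
  also have "\<dots> = sweedler H x (\<lambda>x1 x2. sweedler H y (\<lambda>r q. sweedler H r (\<lambda>y1 p.
      g (x1 \<cdot> S (y1 \<cdot> S p)) (x2 \<cdot> S (S q)))))"
    by (simp add: coassoc[where U = U] lin mem S_mult algebraD(5))
  also have "\<dots> = sweedler H x (\<lambda>x1 x2. sweedler H y (\<lambda>r q. \<epsilon> r *s\<^bsub>U\<^esub> g x1 (x2 \<cdot> S (S q))))"
    by (simp add: antipode_right[where U = U and f = "\<lambda>z. g (_ \<cdot> S z) _"] lin mem S_one)
  also have "\<dots> = sweedler H x (\<lambda>x1 x2. g x1 (x2 \<cdot> S (S y)))"
    by (simp add: counit_left[where U = U] lin mem)
  finally show ?thesis .
qed

text \<open>
After \<open>translate_comult\<close> the sum runs over the four legs of the threefold coproduct of a single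
\<open>w = x S\<^sup>2(y)\<close>, with an additional factor \<open>S(u)\<close> for the first leg \<open>u\<close> of the summation variable. By the
cyclic property of the trace, expressed by the structure constants, \<open>u\<close> may be replaced by the second
leg of \<open>w\<close>, and \<open>w\<^sub>1 S(w\<^sub>2)\<close> collapses.
\<close>
lemma trace_integral:
  assumes f: "linear_on H ground f" and [simp]: "x \<in> carrier H"
  shows "sweedler H x (\<lambda>x1 x2. trace_integral f x2 *s x1) = trace_integral f x *s \<one>"
proof -
  note [lin] = linear_on_compose[OF f] f
  let ?K = "\<lambda>i u v. sweedler H (x \<cdot> S (S v)) (\<lambda>w1 w2. sweedler H w2 (\<lambda>a b. (c i a * f b) *s (w1 \<cdot> S u)))"
  have sc: "linear_on ground H (\<lambda>k. k *s v)" if "v \<in> carrier H" for v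
    using that by (simp add: lin)
  have "sweedler H x (\<lambda>x1 x2. trace_integral f x2 *s x1) =
    (\<Sum>i\<in>I. sweedler H x (\<lambda>x1 x2. sweedler H (x2 \<cdot> S (S i)) (\<lambda>a b. (c i a * f b) *s x1)))"
    unfolding trace_integral_def
    by (simp add: scale_sum_left sweedler_sum[symmetric] sweedler_out[OF sc] mem)
  also have "\<dots> = (\<Sum>i\<in>I. sweedler H i (?K i))"
    by (intro sum.cong refl, rule translate_comult[symmetric, where U = H and
        g = "\<lambda>u v. sweedler H v (\<lambda>a b. (c _ a * f b) *s u)"]) (simp_all add: lin mem)
  \<comment> \<open>Expand the coproduct of the basis element \<open>i\<close>, then use that the structure constants are linear in
    it to carry them over to the leg \<open>a\<close>, to which the coordinate functional of \<open>i\<close> is applied.\<close>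
  also have "\<dots> = (\<Sum>i\<in>I. \<Sum>j\<in>I. \<Sum>k\<in>I. comult_coeff j k i *s ?K i j k)"
    by (intro sum.cong refl sweedler_expand) (simp_all add: lin mem)
  also have "\<dots> = (\<Sum>j\<in>I. \<Sum>k\<in>I. \<Sum>i\<in>I. comult_coeff j k i *s ?K i j k)"
    by (subst sum.swap, rule sum.cong[OF refl], rule sum.swap)
  also have "\<dots> = (\<Sum>j\<in>I. \<Sum>k\<in>I. sweedler H (x \<cdot> S (S k)) (\<lambda>w1 w2. sweedler H w2 (\<lambda>a b.
      \<Sum>i\<in>I. (comult_coeff j k i * (c i a * f b)) *s (w1 \<cdot> S j))))"
    by (intro sum.cong refl)
      (simp add: sweedler_out[OF linear_on_scale_const[OF _ linear_on_id]] sweedler_sum mem)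
  also have "\<dots> = (\<Sum>j\<in>I. \<Sum>k\<in>I. sweedler H (x \<cdot> S (S k)) (\<lambda>w1 w2. sweedler H w2 (\<lambda>a b.
      (comult_coeff j k a * f b) *s (w1 \<cdot> S j))))"
  proof -
    have *: "(\<Sum>i\<in>I. (comult_coeff j k i * (c i a * r)) *s w) = (comult_coeff j k a * r) *s w" if "a \<in> carrier H" for j k a r w
    proof -
      have "comult_coeff j k a = (\<Sum>i\<in>I. c i a * comult_coeff j k i)"
        by (rule expand_form[symmetric]) (use that in \<open>simp_all add: lin\<close>)
      then show ?thesis by (simp add: scale_sum_left[symmetric] sum_distrib_left ac_simps)
    qed
    show ?thesis by (simp add: * mem)
  qed
  also have "\<dots> = (\<Sum>j\<in>I. \<Sum>k\<in>I. sweedler H (x \<cdot> S (S k)) (\<lambda>w1 w2. sweedler H w2 (\<lambda>a b. sweedler H a (\<lambda>u v.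
      (c k v * f b) *s (w1 \<cdot> S (c j u *s j))))))"
  proof -
    have *: "(comult_coeff j k a * r) *s (w \<cdot> S j) =
        sweedler H a (\<lambda>u v. (c k v * r) *s (w \<cdot> S (c j u *s j)))"
      if [simp]: "a \<in> carrier H" "w \<in> carrier H" "j \<in> carrier H" for j k a r w
      unfolding comult_coeff_def
      by (subst sweedler_out[where g = "\<lambda>z. (z * r) *s (w \<cdot> S j)" and U = ground and X = H])
        (simp_all add: lin mem mult_scale linear_onD(3)[OF linear_S] ac_simps)
    show ?thesis by (intro sum.cong refl) (simp add: * mem)
  qed
  also have "\<dots> = (\<Sum>k\<in>I. sweedler H (x \<cdot> S (S k)) (\<lambda>w1 w2. sweedler H w2 (\<lambda>a b. sweedler H a (\<lambda>u v.
      (c k v * f b) *s (w1 \<cdot> S u)))))"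
  proof -
    have *: "(\<Sum>j\<in>I. r *s (w \<cdot> S (c j u *s j))) = r *s (w \<cdot> S u)"
      if "u \<in> carrier H" "w \<in> carrier H" for r w u
      using sum_out[where g = "\<lambda>z. r *s (w \<cdot> S z)" and f = "\<lambda>j. c j u *s j" and I = I and V = H and W = H] that
      by (simp add: lin mem expand)
    show ?thesis
      by (subst sum.swap) (simp add: sweedler_sum[symmetric] * mem)
  qed
  also have "\<dots> = (\<Sum>k\<in>I. sweedler H (x \<cdot> S (S k)) (\<lambda>m r. sweedler H m (\<lambda>w1 u. sweedler H r (\<lambda>v b.
      (c k v * f b) *s (w1 \<cdot> S u)))))"
    by (simp add: coassoc[where U = H] lin mem)
  also have "\<dots> = (\<Sum>k\<in>I. sweedler H (x \<cdot> S (S k)) (\<lambda>m r. \<epsilon> m *s sweedler H r (\<lambda>v b.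
      (c k v * f b) *s \<one>)))"
    by (simp add: antipode_right[where U = H and f = "\<lambda>z. sweedler H _ (\<lambda>v b. _ v b *s z)"] lin mem)
  also have "\<dots> = trace_integral f x *s \<one>"
    unfolding trace_integral_def
    by (simp add: counit_left[where U = H] lin mem scale_sum_left sweedler_out[OF sc])
  finally show ?thesis .
qed

text \<open>
The Hopf module identity \<open>f = f\<^sub>0 S(f\<^sub>1) f\<^sub>2\<close>: every functional is recovered from the trace integrals,
which therefore cannot all vanish. Carrying both sums over the basis to one coproduct produces the
factor \<open>S(S(k\<^sub>1) k\<^sub>2)\<close>, which collapses.
\<close>
lemma expand_trace_integral:
  assumes f: "linear_on H ground f" and [simp]: "x \<in> carrier H"
  shows "f x = (\<Sum>j\<in>I. trace_integral (\<lambda>b. sweedler H b (\<lambda>u v. c j u * f v)) (x \<cdot> S j))"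
proof -
  note [lin] = linear_on_compose[OF f] f
  have "(\<Sum>j\<in>I. trace_integral (\<lambda>b. sweedler H b (\<lambda>u v. c j u * f v)) (x \<cdot> S j)) =
    (\<Sum>j\<in>I. \<Sum>i\<in>I. sweedler H (x \<cdot> S (S i \<cdot> j)) (\<lambda>a b. sweedler H b (\<lambda>u v. c i a * (c j u * f v))))"
    unfolding trace_integral_def
    by (simp add: S_mult algebraD(5) mem sweedler_out[where g = "(*) _" and U = ground and X = ground] lin)
  also have "\<dots> = (\<Sum>j\<in>I. \<Sum>i\<in>I. sweedler H (x \<cdot> S (S i \<cdot> j)) (\<lambda>m v. sweedler H m (\<lambda>a u. c i a * (c j u * f v))))"
    by (simp add: coassoc[where U = ground] lin mem)
  also have "\<dots> = (\<Sum>j\<in>I. \<Sum>i\<in>I. sweedler H (x \<cdot> S (S i \<cdot> j)) (\<lambda>m v. \<Sum>k\<in>I. comult_coeff i j k * (c k m * f v)))"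
  proof -
    have *: "sweedler H m (\<lambda>a u. c i a * (c j u * r)) = (\<Sum>k\<in>I. comult_coeff i j k * (c k m * r))" if "m \<in> carrier H" for i j m r
    proof -
      have "sweedler H m (\<lambda>a u. c i a * (c j u * r)) = comult_coeff i j m * r"
        unfolding comult_coeff_def using that
        by (subst sweedler_out[where g = "\<lambda>z. z * r" and U = ground and X = ground]) (simp_all add: lin ac_simps)
      also have "comult_coeff i j m = (\<Sum>k\<in>I. c k m * comult_coeff i j k)"
        by (rule expand_form[symmetric]) (use that in \<open>simp_all add: lin\<close>)
      finally show ?thesis by (simp add: sum_distrib_left ac_simps)
    qed
    show ?thesis by (simp add: * mem)
  qed
  also have "\<dots> = (\<Sum>k\<in>I. \<Sum>i\<in>I. \<Sum>j\<in>I. comult_coeff i j k * sweedler H (x \<cdot> S (S i \<cdot> j)) (\<lambda>m v. c k m * f v))"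
    (is "?A = ?B")
  proof -
    have "?A = (\<Sum>j\<in>I. \<Sum>i\<in>I. \<Sum>k\<in>I. comult_coeff i j k * sweedler H (x \<cdot> S (S i \<cdot> j)) (\<lambda>m v. c k m * f v))"
      by (simp add: sweedler_sum sweedler_out[where g = "(*) _" and U = ground and X = ground] lin mem)
    also have "\<dots> = (\<Sum>i\<in>I. \<Sum>j\<in>I. \<Sum>k\<in>I. comult_coeff i j k * sweedler H (x \<cdot> S (S i \<cdot> j)) (\<lambda>m v. c k m * f v))"
      by (rule sum.swap)
    also have "\<dots> = (\<Sum>i\<in>I. \<Sum>k\<in>I. \<Sum>j\<in>I. comult_coeff i j k * sweedler H (x \<cdot> S (S i \<cdot> j)) (\<lambda>m v. c k m * f v))"
      by (rule sum.cong[OF refl], rule sum.swap)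
    also have "\<dots> = ?B" by (rule sum.swap)
    finally show ?thesis .
  qed
  also have "\<dots> = (\<Sum>k\<in>I. sweedler H k (\<lambda>p q. sweedler H (x \<cdot> S (S p \<cdot> q)) (\<lambda>m v. c k m * f v)))"
    by (intro sum.cong refl, subst sweedler_expand[where U = ground]) (simp_all add: lin mem)
  also have "\<dots> = (\<Sum>k\<in>I. \<epsilon> k * sweedler H x (\<lambda>m v. c k m * f v))"
    using antipode_left[where U = ground and f = "\<lambda>z. sweedler H (x \<cdot> S z) (\<lambda>m v. c _ m * f v)"]
    by (simp add: lin mem S_one)
  also have "\<dots> = sweedler H x (\<lambda>m v. (\<Sum>k\<in>I. c k m * \<epsilon> k) * f v)"
    by (simp add: sweedler_out[where g = "(*) _" and U = ground and X = ground] lin sweedler_sum[symmetric]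
        sum_distrib_left ac_simps)
  also have "\<dots> = sweedler H x (\<lambda>m v. \<epsilon> m * f v)"
    by (simp add: expand_form lin)
  also have "\<dots> = f x"
    using counit_left[where U = ground and f = f and C = H and c = x] f by simp
  finally show ?thesis ..
qed

lemma exists_left_integral_form:
  "\<exists>\<phi>. linear_on H ground \<phi> \<and> (\<exists>x \<in> carrier H. \<phi> x \<noteq> 0) \<and>
     (\<forall>x \<in> carrier H. sweedler H x (\<lambda>x1 x2. \<phi> x2 *s x1) = \<phi> x *s \<one>)"
proof -
  let ?f = "\<lambda>j b. sweedler H b (\<lambda>u v. c j u * \<epsilon> v)"
  have f: "linear_on H ground (?f j)" for j by (simp add: lin)
  have "\<exists>j\<in>I. trace_integral (?f j) (\<one> \<cdot> S j) \<noteq> 0"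
  proof (rule ccontr)
    assume "\<not> ?thesis"
    then have "\<epsilon> \<one> = 0"
      using expand_trace_integral[of "counit H" "\<one>"] by (simp add: coalgebraD(3) mem)
    then show False by simp
  qed
  then obtain j where j: "j \<in> I" "trace_integral (?f j) (\<one> \<cdot> S j) \<noteq> 0" by blast
  have "\<one> \<cdot> S j \<in> carrier H" using j(1) by (simp add: mem)
  then show ?thesis
    using j(2) linear_on_trace_integral[OF f] trace_integral[OF f] by blast
qed

end

locale hopf_integral_form = hopf_basis H S I c
  for H :: "('k::field, 'v::ab_group_add, 'x) hopf_data_scheme" (structure) and S and I and c +
  fixes \<phi> :: "'v \<Rightarrow> 'k"
  assumes phi: "linear_on H ground \<phi>" and phi_ne: "\<exists>x \<in> carrier H. \<phi> x \<noteq> 0"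
    and phi_integral: "x \<in> carrier H \<Longrightarrow> sweedler H x (\<lambda>x1 x2. \<phi> x2 *s x1) = \<phi> x *s \<one>"
begin

lemmas phi_linear' [lin] = phi linear_on_compose[OF phi]

text \<open>
Let \<open>K\<close> be the set of all \<open>h\<close> with \<open>\<phi> (x S h) = 0\<close> for all \<open>x\<close>. The lemma says that \<open>K\<close> is a right
coideal: the integral property of \<open>\<phi>\<close> at \<open>x S(h\<^sub>1)\<close> gives
\<open>\<phi>(x S h\<^sub>1) h\<^sub>2 = x\<^sub>1 S(h\<^sub>2) h\<^sub>3 \<phi>(x\<^sub>2 S h\<^sub>1) = x\<^sub>1 \<phi>(x\<^sub>2 S h)\<close>.
\<close>
lemma form_coideal:
  assumes [simp]: "h \<in> carrier H" and h: "\<And>x. x \<in> carrier H \<Longrightarrow> \<phi> (x \<cdot> S h) = 0"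
    and [simp]: "x \<in> carrier H"
  shows "sweedler H h (\<lambda>a b. \<phi> (x \<cdot> S a) *s b) = 0"
proof -
  have "sweedler H h (\<lambda>a b. \<phi> (x \<cdot> S a) *s b) =
    sweedler H h (\<lambda>a b. sweedler H (x \<cdot> S a) (\<lambda>w1 w2. \<phi> w2 *s w1) \<cdot> b)"
    by (simp add: phi_integral mem mult_scale)
  also have "\<dots> = sweedler H h (\<lambda>a b. sweedler H x (\<lambda>x1 x2. sweedler H a (\<lambda>p q.
      \<phi> (x2 \<cdot> S p) *s (x1 \<cdot> (S q \<cdot> b)))))"
    by (simp add: sweedler_mult[where U = H] sweedler_S[where U = H]
      sweedler_out[where g = "\<lambda>z. z \<cdot> _" and U = H and X = H] lin mem mult_scale algebraD(5))
  also have "\<dots> = sweedler H x (\<lambda>x1 x2. sweedler H h (\<lambda>a b. sweedler H a (\<lambda>p q.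
      \<phi> (x2 \<cdot> S p) *s (x1 \<cdot> (S q \<cdot> b)))))"
    by (rule sweedler_swap)
  also have "\<dots> = sweedler H x (\<lambda>x1 x2. sweedler H h (\<lambda>p r. sweedler H r (\<lambda>q b.
      \<phi> (x2 \<cdot> S p) *s (x1 \<cdot> (S q \<cdot> b)))))"
    by (simp add: coassoc[where U = H] lin mem)
  also have "\<dots> = sweedler H x (\<lambda>x1 x2. sweedler H h (\<lambda>p r. \<epsilon> r *s (\<phi> (x2 \<cdot> S p) *s x1)))"
    by (simp add: antipode_left[where U = H and f = "\<lambda>z. _ *s (_ \<cdot> z)"] lin mem)
  also have "\<dots> = sweedler H x (\<lambda>x1 x2. \<phi> (x2 \<cdot> S h) *s x1)"
    by (simp add: counit_right[where U = H and f = "\<lambda>p. \<phi> (_ \<cdot> S p) *s _"] lin mem del: vspaceD(8))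
  also have "\<dots> = sweedler H x (\<lambda>x1 x2. 0)"
    by (simp add: h)
  also have "\<dots> = 0"
    by (simp add: sweedler_def tlift_tensor_rep case_prod_beta')
  finally show ?thesis .
qed

text \<open>
The set \<open>K\<close> is also a right ideal, so it contains \<open>h\<^sub>1 S(h\<^sub>2) = \<epsilon>(h) 1\<close>; but the unit is not in \<open>K\<close>.
\<close>
lemma form_counit:
  assumes [simp]: "h \<in> carrier H" and h: "\<And>x. x \<in> carrier H \<Longrightarrow> \<phi> (x \<cdot> S h) = 0"
  shows "\<epsilon> h = 0"
proof -
  obtain x where [simp]: "x \<in> carrier H" and x: "\<phi> x \<noteq> 0" using phi_ne by blast
  have "\<epsilon> h * \<phi> x = sweedler H h (\<lambda>a b. \<phi> (x \<cdot> (S (S b) \<cdot> S a)))"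
    using antipode_right[where U = ground and h = h and f = "\<lambda>z. \<phi> (x \<cdot> S z)"]
    by (simp add: lin mem S_mult S_one)
  also have "\<dots> = sweedler H h (\<lambda>a b. \<Sum>i\<in>I. c i (S (S b)) * \<phi> ((x \<cdot> i) \<cdot> S a))"
  proof -
    have "\<phi> (x \<cdot> (S (S b) \<cdot> S a)) = (\<Sum>i\<in>I. c i (S (S b)) * \<phi> ((x \<cdot> i) \<cdot> S a))"
      if "a \<in> carrier H" "b \<in> carrier H" for a b
      using expand_form[of "\<lambda>z. \<phi> ((x \<cdot> z) \<cdot> S a)" "S (S b)"] that by (simp add: lin mem algebraD(5))
    then show ?thesis by simp
  qed
  also have "\<dots> = (\<Sum>i\<in>I. c i (S (S (sweedler H h (\<lambda>a b. \<phi> ((x \<cdot> i) \<cdot> S a) *s b)))))"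
    unfolding sweedler_sum
    by (intro sum.cong refl, subst sweedler_out[where g = "\<lambda>z. c _ (S (S z))" and U = H and X = ground])
      (simp_all add: lin mem linear_onD(3)[OF linear_S] linear_onD(3)[OF c_linear] ac_simps)
  also have "\<dots> = 0"
    by (simp add: form_coideal h mem linear_on_0[OF linear_S] linear_on_0[OF c_linear])
  finally show ?thesis using x by simp
qed

text \<open>
If \<open>h\<close> is in \<open>K\<close>, so is \<open>h\<^sub>1 g(h\<^sub>2)\<close> for every functional \<open>g\<close>, and \<open>\<epsilon>\<close> maps it to \<open>g(h)\<close>.
\<close>
lemma form_nondegenerate:
  assumes [simp]: "h \<in> carrier H" and h: "\<And>x. x \<in> carrier H \<Longrightarrow> \<phi> (x \<cdot> S h) = 0"
  shows "h = 0"
proof -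
  have "c i h = 0" for i
  proof -
    let ?k = "sweedler H h (\<lambda>a b. c i b *s a)"
    have "\<phi> (x \<cdot> S ?k) = 0" if [simp]: "x \<in> carrier H" for x
    proof -
      have "\<phi> (x \<cdot> S ?k) = sweedler H h (\<lambda>a b. c i b * \<phi> (x \<cdot> S a))"
        by (subst sweedler_out[where g = "\<lambda>z. \<phi> (x \<cdot> S z)" and U = H and X = ground])
          (simp_all add: lin mem linear_onD(3)[OF linear_S] linear_onD(3)[OF phi] mult_scale)
      also have "\<dots> = c i (sweedler H h (\<lambda>a b. \<phi> (x \<cdot> S a) *s b))"
        by (subst sweedler_out[where g = "c i" and U = H and X = ground])
          (simp_all add: lin mem linear_onD(3)[OF c_linear] ac_simps)
      also have "\<dots> = 0" by (simp add: form_coideal h linear_on_0[OF c_linear])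
      finally show ?thesis .
    qed
    then have "\<epsilon> ?k = 0" by (intro form_counit) (simp_all add: mem)
    moreover have "\<epsilon> ?k = sweedler H h (\<lambda>a b. \<epsilon> a * c i b)"
      by (subst sweedler_out[where g = "counit H" and U = H and X = ground])
        (simp_all add: lin mem coalgebraD(3) linear_onD(3)[OF coalgebraD(3)] ac_simps)
    moreover have "\<dots> = c i h"
      using counit_left[where U = ground and f = "c i" and C = H and c = h] by (simp add: lin)
    ultimately show ?thesis by simp
  qed
  then show ?thesis using expand[of h] by simp
qed

lemma finite_dim_H: "finite_dim H"
proof -
  interpret vector_space "scale H" using algebraD(1)[OF bialgebraD(1)[OF bialgebra]] by (simp add: vspace_def)
  have sub: "subspace (carrier H)" using algebraD(1)[OF bialgebraD(1)[OF bialgebra]] by (simp add: vspace_def)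
  have "span I = carrier H"
  proof
    show "span I \<subseteq> carrier H" using sub I_in by (intro span_minimal) auto
    show "carrier H \<subseteq> span I"
    proof
      fix x assume "x \<in> carrier H"
      then have "x = (\<Sum>i\<in>I. c i x *s i)" by (simp add: expand)
      also have "\<dots> \<in> span I" by (intro span_sum span_scale span_base)
      finally show "x \<in> span I" .
    qed
  qed
  then show ?thesis using I_in by (auto simp: finite_dim_def intro!: exI[of _ I])
qed

lemma S_inj: "h \<in> carrier H \<Longrightarrow> S h = 0 \<Longrightarrow> h = 0"
  by (rule form_nondegenerate)
    (simp_all add: linear_on_0[OF phi] linear_on_0[OF linear_on_mult_left])

lemma S_surj: "S ` carrier H = carrier H"
  by (rule linear_inj_imp_surj) (simp_all add: finite_dim_H linear_S S_inj)

text \<open>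
By nondegeneracy and a dimension count, the functional \<open>\<epsilon>\<close> is of the form \<open>\<phi> (x S h)\<close> for some \<open>h\<close>.
Then \<open>S h\<close> is the left integral: \<open>y S(h) - \<epsilon>(y) S(h)\<close> is itself a value \<open>S k\<close>, and \<open>\<phi> (x S k) = 0\<close>
for all \<open>x\<close>.
\<close>
lemma exists_dual_left_integral: "\<exists>t \<in> left_integrals H. \<phi> t = 1"
proof -
  let ?P = "\<lambda>h. \<Sum>i\<in>I. \<phi> (i \<cdot> S h) *s i"
  have P: "linear_on H H ?P" by (simp add: lin mem)
  have cP: "c j (\<Sum>i\<in>I. r i *s i) = r j" if j: "j \<in> I" for j r
  proof -
    have "c j (\<Sum>i\<in>I. r i *s i) = (\<Sum>i\<in>I. r i * c j i)"
      by (subst sum_out[OF c_linear]) (simp_all add: mem linear_onD(3)[OF c_linear])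
    also have "\<dots> = (\<Sum>i\<in>I. if j = i then r i else 0)"
      using j by (intro sum.cong refl) (auto simp: c_basis)
    finally show ?thesis using j by simp
  qed
  have ext: "\<phi> (x \<cdot> S h) = f x" if "\<And>i. i \<in> I \<Longrightarrow> \<phi> (i \<cdot> S h) = f i" "h \<in> carrier H" "x \<in> carrier H"
    "linear_on H ground f" for f h x
    using that expand_form[of f x] expand_form[of "\<lambda>x. \<phi> (x \<cdot> S h)" x] by (simp add: lin mem)
  have "?P ` carrier H = carrier H"
  proof (rule linear_inj_imp_surj[OF _ finite_dim_H P])
    fix h assume [simp]: "h \<in> carrier H" and "?P h = 0"
    then have "\<phi> (i \<cdot> S h) = 0" if "i \<in> I" for i
      using cP[OF that, of "\<lambda>i. \<phi> (i \<cdot> S h)"] linear_on_0[OF c_linear] by simp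
    then have "\<phi> (x \<cdot> S h) = 0" if "x \<in> carrier H" for x
      using ext[of h "\<lambda>_. 0" x] that by (simp add: linear_on_def)
    then show "h = 0" by (intro form_nondegenerate) simp_all
  qed simp
  moreover have "(\<Sum>i\<in>I. \<epsilon> i *s i) \<in> carrier H" by (simp add: mem)
  ultimately obtain h where [simp]: "h \<in> carrier H" and h: "?P h = (\<Sum>i\<in>I. \<epsilon> i *s i)" by force
  have "\<phi> (i \<cdot> S h) = \<epsilon> i" if "i \<in> I" for i
    using cP[OF that, of "\<lambda>i. \<phi> (i \<cdot> S h)"] cP[OF that, of "counit H"] h by simp
  then have e: "\<phi> (x \<cdot> S h) = \<epsilon> x" if "x \<in> carrier H" for x
    using ext[of h "counit H"] that by (simp add: coalgebraD(3))
  have "y \<cdot> S h = \<epsilon> y *s S h" if [simp]: "y \<in> carrier H" for y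
  proof -
    let ?u = "y \<cdot> S h - \<epsilon> y *s S h"
    have "?u \<in> S ` carrier H" by (simp add: S_surj mem)
    then obtain k where [simp]: "k \<in> carrier H" and k: "?u = S k" by blast
    have "\<phi> (x \<cdot> S k) = 0" if [simp]: "x \<in> carrier H" for x
    proof -
      have "\<phi> (x \<cdot> ?u) = \<phi> ((x \<cdot> y) \<cdot> S h) - \<epsilon> y * \<phi> (x \<cdot> S h)"
        using linear_on_diff[of H ground "\<lambda>z. \<phi> (x \<cdot> z)" "y \<cdot> S h" "\<epsilon> y *s S h"]
        by (simp add: lin mem mult_scale linear_onD(3)[OF phi] algebraD(5))
      then show ?thesis by (simp add: e mem k)
    qed
    then have "k = 0" by (intro form_nondegenerate) simp_all
    then show ?thesis using k by (simp add: linear_on_0[OF linear_S])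
  qed
  then have "S h \<in> left_integrals H" by (simp add: left_integrals_def mem)
  moreover have "\<phi> (S h) = 1" using e[of "\<one>"] by (simp add: mem)
  ultimately show ?thesis by blast
qed

end

section \<open>Comultiplicative images of coalgebras\<close>

lemma vspace_image:
  assumes "vspace V" "vspace W" "linear_on V W f" "carrier X = f ` carrier V" "scale X = scale W"
  shows "vspace X"
proof -
  have m: "module (scale W)" using assms by (simp add: vspace_def module_iff_vector_space)
  have "module.subspace (scale W) (f ` carrier V)"
    unfolding module.subspace_def[OF m]
  proof (intro conjI ballI allI)
    show "0 \<in> f ` carrier V" using linear_on_0[OF assms(3,1,2)] vspaceD(1)[OF assms(1)] by force
  next
    fix x y assume "x \<in> f ` carrier V" "y \<in> f ` carrier V"
    then obtain v w where vw: "v \<in> carrier V" "w \<in> carrier V" "x = f v" "y = f w" by auto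
    then have "x + y = f (v + w)" by (simp add: linear_onD(2)[OF assms(3)])
    then show "x + y \<in> f ` carrier V" using vw assms(1) by (simp add: mem)
  next
    fix c x assume "x \<in> f ` carrier V"
    then obtain v where v: "v \<in> carrier V" "x = f v" by auto
    then have "c *s\<^bsub>W\<^esub> x = f (c *s\<^bsub>V\<^esub> v)" by (simp add: linear_onD(3)[OF assms(3)])
    then show "c *s\<^bsub>W\<^esub> x \<in> f ` carrier V" using v assms(1) by (simp add: mem)
  qed
  then show ?thesis using assms by (simp add: vspace_def)
qed

lemma linear_on_subspace:
  assumes "linear_on V W f" "carrier X \<subseteq> carrier V" "scale X = scale V"
  shows "linear_on X W f"
  using assms by (auto simp: linear_on_def subset_iff)

text \<open>
A surjection \<open>\<pi>\<close> that commutes with the comultiplications. It need not respect the counits: for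
\<open>E\<close> from \<open>H\<close> onto the \<open>\<lambda>\<close>-invariants, \<open>\<epsilon> \<circ> E = \<lambda>\<close>.
\<close>
locale coalgebra_image =
  fixes C :: "('k::field, 'v::ab_group_add, 'x) hopf_data_scheme"
    and Q :: "('k, 'w::ab_group_add, 'y) hopf_data_scheme" and \<pi>
  assumes C [simp]: "coalgebra C" and Q [simp]: "vspace Q" and pi: "linear_on C Q \<pi>"
    and surj: "carrier Q = \<pi> ` carrier C"
    and comult_pi: "c \<in> carrier C \<Longrightarrow> \<Delta>\<^bsub>Q\<^esub> (\<pi> c) = sweedler C c (\<lambda>a b. \<pi> a \<otimes>\<^bsub>Q,Q\<^esub> \<pi> b)"
begin

lemmas pi_linear' [lin] = pi linear_on_compose[OF pi]
lemmas pi_in [mem] = linear_onD(1)[OF pi]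

lemma sweedler_pi:
  assumes [simp]: "c \<in> carrier C" "vspace U" and f: "bilinear_on Q Q U f"
  shows "sweedler Q (\<pi> c) f = sweedler C c (\<lambda>a b. f (\<pi> a) (\<pi> b))"
  unfolding sweedler_def[of Q] comult_pi[OF assms(1)]
  by (simp add: sweedler_out[OF tensor_universal_property(1)[OF _ _ _ f]] tlift_tens[where U = U] f mem)

lemma coalgebra:
  assumes "linear_on Q (Q \<Otimes> Q) (comult Q)" "linear_on Q ground (counit Q)"
    and l: "\<And>c. c \<in> carrier C \<Longrightarrow> sweedler C c (\<lambda>a b. \<epsilon>\<^bsub>Q\<^esub> (\<pi> a) *s\<^bsub>Q\<^esub> \<pi> b) = \<pi> c"
    and r: "\<And>c. c \<in> carrier C \<Longrightarrow> sweedler C c (\<lambda>a b. \<epsilon>\<^bsub>Q\<^esub> (\<pi> b) *s\<^bsub>Q\<^esub> \<pi> a) = \<pi> c"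
  shows "coalgebra Q"
proof -
  note [lin] = linear_on_compose[OF assms(1)] linear_on_compose[OF assms(2)] assms(2)
  note [mem] = linear_onD(1)[OF assms(1)]
  have slin: "linear_on X U (\<lambda>x. sweedler Q (g x) f)"
    if "vspace U" "linear_on X Q g" "\<And>w. w \<in> carrier Q \<Longrightarrow> linear_on Q U (\<lambda>v. f v w)"
      "\<And>v. v \<in> carrier Q \<Longrightarrow> linear_on Q U (f v)"
    for X g f and U :: "('k, 'u::ab_group_add, 'z) vspace_scheme"
    unfolding sweedler_def by (rule linear_on_tlift_arg) (use that in \<open>simp_all add: lin\<close>)
  have sfun: "linear_on X U (\<lambda>x. sweedler Q c (\<lambda>v w. f x v w))"
    if "vspace U" "c \<in> carrier Q" "\<And>v w. v \<in> carrier Q \<Longrightarrow> w \<in> carrier Q \<Longrightarrow> linear_on X U (\<lambda>x. f x v w)"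
    for X f c and U :: "('k, 'u::ab_group_add, 'z) vspace_scheme"
    unfolding sweedler_def by (rule linear_on_tlift_fun) (use that in \<open>simp_all add: mem\<close>)
  have coass: "sweedler Q q (\<lambda>a b. sweedler Q a (\<lambda>a1 a2. a1 \<otimes>\<^bsub>Q, Q \<Otimes> Q\<^esub> (a2 \<otimes>\<^bsub>Q,Q\<^esub> b))) =
        sweedler Q q (\<lambda>a b. sweedler Q b (\<lambda>b1 b2. a \<otimes>\<^bsub>Q, Q \<Otimes> Q\<^esub> (b1 \<otimes>\<^bsub>Q,Q\<^esub> b2)))"
    if "q \<in> carrier Q" for q
  proof -
    obtain c where [simp]: "c \<in> carrier C" and q: "q = \<pi> c" using \<open>q \<in> carrier Q\<close> by (auto simp: surj)
    show ?thesis unfolding q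
      by (simp add: sweedler_pi[where U = "Q \<Otimes> Q \<Otimes> Q"] coassoc[where U = "Q \<Otimes> Q \<Otimes> Q"] lin mem slin sfun)
  qed
  have "sweedler Q q (\<lambda>a b. \<epsilon>\<^bsub>Q\<^esub> a *s\<^bsub>Q\<^esub> b) = q \<and> sweedler Q q (\<lambda>a b. \<epsilon>\<^bsub>Q\<^esub> b *s\<^bsub>Q\<^esub> a) = q"
    if "q \<in> carrier Q" for q
  proof -
    obtain c where [simp]: "c \<in> carrier C" and q: "q = \<pi> c" using \<open>q \<in> carrier Q\<close> by (auto simp: surj)
    show ?thesis unfolding q by (simp add: sweedler_pi[where U = Q] l r lin)
  qed
  with coass show ?thesis unfolding coalgebra_def using assms(1,2) by simp
qed

end

section \<open>The Hopf subalgebra of \<open>\<lambda>\<close>-invariants\<close>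

text \<open>
The last assumption, \<open>\<lambda>(h\<^sub>1) h\<^sub>2 \<lambda>(h\<^sub>3) = \<lambda>(h\<^sub>1) h\<^sub>2\<close>, is what the compatibility condition of a
matched pair says about \<open>\<lambda>\<close>; it makes the map \<open>E\<close> below comultiplicative.
\<close>
locale partial_action = hopf H S for H :: "('k::field, 'v::ab_group_add, 'x) hopf_data_scheme" (structure) and S +
  fixes lam :: "'v \<Rightarrow> 'k"
  assumes lam: "linear_on H ground lam" and lam_one: "lam \<one> = 1"
    and lam_mult: "h \<in> carrier H \<Longrightarrow> g \<in> carrier H \<Longrightarrow>
           sweedler H h (\<lambda>h1 h2. lam h1 * lam (h2 \<cdot> g)) = lam h * lam g"
    and lam_absorb: "h \<in> carrier H \<Longrightarrow>
      sweedler H h (\<lambda>a r. sweedler H r (\<lambda>b d. (lam d * lam a) *s b)) = sweedler H h (\<lambda>a b. lam a *s b)"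
begin

lemmas lam_linear' [lin] = lam linear_on_compose[OF lam]

lemma lam_idem: "h \<in> carrier H \<Longrightarrow> sweedler H h (\<lambda>h1 h2. lam h1 * lam h2) = lam h"
  using lam_mult[of h "\<one>"] by (simp add: mem lam_one)

definition E where "E h = sweedler H h (\<lambda>a b. lam a *s b)"

lemma E_linear: "linear_on H H E" unfolding E_def by (simp add: lin)
lemmas E_linear' [lin] = E_linear linear_on_compose[OF E_linear]
lemmas E_in [mem] = linear_onD(1)[OF E_linear]

lemma E_one: "E \<one> = \<one>"
  unfolding E_def by (simp add: sweedler_one[where U = H] lin lam_one)

lemma sweedler_E:
  assumes [simp]: "h \<in> carrier H" "vspace U" and f: "bilinear_on H H U f"
  shows "sweedler H (E h) f = sweedler H h (\<lambda>a b. f (E a) b)"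
proof -
  note [lin] = bilinear_on_compose[OF f]
  note [mem] = bilinear_onD(3)[OF f]
  have "sweedler H (E h) f = sweedler H h (\<lambda>a b. sweedler H b (\<lambda>p q. lam a *s\<^bsub>U\<^esub> f p q))"
    unfolding E_def
    by (simp add: sweedler_out[OF linear_on_sweedler[OF _ _ f]] linear_onD(3)[OF linear_on_sweedler[OF _ _ f]] mem
        sweedler_out[OF linear_on_scale_const[OF _ linear_on_id]])
  also have "\<dots> = sweedler H h (\<lambda>r q. sweedler H r (\<lambda>a p. lam a *s\<^bsub>U\<^esub> f p q))"
    by (rule coassoc[symmetric, where U = U]) (simp_all add: lin mem)
  also have "\<dots> = sweedler H h (\<lambda>a b. f (E a) b)"
  proof -
    have "f (E a) b = sweedler H a (\<lambda>x y. lam x *s\<^bsub>U\<^esub> f y b)" if [simp]: "a \<in> carrier H" "b \<in> carrier H" for a b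
      unfolding E_def by (simp add: sweedler_out[OF bilinear_onD(1)[OF f]] linear_onD(3)[OF bilinear_onD(1)[OF f]] mem)
    then show ?thesis by simp
  qed
  finally show ?thesis .
qed

lemma E_absorb:
  assumes [simp]: "h \<in> carrier H"
  shows "sweedler H h (\<lambda>a b. lam b *s E a) = E h"
proof -
  have "sweedler H h (\<lambda>a b. lam b *s E a) = sweedler H h (\<lambda>r d. sweedler H r (\<lambda>a b. (lam d * lam a) *s b))"
    unfolding E_def by (simp add: sweedler_out[OF linear_on_scale_const[OF _ linear_on_id]] mem)
  also have "\<dots> = sweedler H h (\<lambda>a r. sweedler H r (\<lambda>b d. (lam d * lam a) *s b))"
    by (rule coassoc[where U = H]) (simp_all add: lin mem)
  finally show ?thesis by (simp add: lam_absorb E_def)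
qed

text \<open>
The first leg of \<open>\<Delta> (E h) = \<lambda>(h\<^sub>1) h\<^sub>2 \<otimes> h\<^sub>3\<close> is visibly in the image of \<open>E\<close>. For the second leg replace
\<open>\<lambda>(h\<^sub>1) h\<^sub>2\<close> by \<open>\<lambda>(h\<^sub>1) h\<^sub>2 \<lambda>(h\<^sub>3)\<close>; the new factor turns the remaining leg into a value of \<open>E\<close>.
\<close>
lemma sweedler_E_E:
  assumes [simp]: "h \<in> carrier H" "vspace U" and f: "bilinear_on H H U f"
  shows "sweedler H (E h) f = sweedler H h (\<lambda>a b. f (E a) (E b))"
proof -
  note [lin] = bilinear_on_compose[OF f]
  note [mem] = bilinear_onD(3)[OF f]
  have 1: "f (E a) (E b) = sweedler H b (\<lambda>p q. lam p *s\<^bsub>U\<^esub> f (E a) q)" if [simp]: "a \<in> carrier H" "b \<in> carrier H" for a b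
    unfolding E_def[of b] by (simp add: sweedler_out[OF bilinear_onD(2)[OF f]] linear_onD(3)[OF bilinear_onD(2)[OF f]] mem)
  have 2: "sweedler H r (\<lambda>a p. lam p *s\<^bsub>U\<^esub> f (E a) q) = f (E r) q" if [simp]: "r \<in> carrier H" "q \<in> carrier H" for r q
  proof -
    have "f (E r) q = f (sweedler H r (\<lambda>a b. lam b *s E a)) q" by (simp add: E_absorb)
    also have "\<dots> = sweedler H r (\<lambda>a p. lam p *s\<^bsub>U\<^esub> f (E a) q)"
      by (simp add: sweedler_out[OF bilinear_onD(1)[OF f]] linear_onD(3)[OF bilinear_onD(1)[OF f]] mem)
    finally show ?thesis ..
  qed
  have "sweedler H h (\<lambda>a b. f (E a) (E b)) = sweedler H h (\<lambda>a b. sweedler H b (\<lambda>p q. lam p *s\<^bsub>U\<^esub> f (E a) q))"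
    by (simp add: 1)
  also have "\<dots> = sweedler H h (\<lambda>r q. sweedler H r (\<lambda>a p. lam p *s\<^bsub>U\<^esub> f (E a) q))"
    by (rule coassoc[symmetric, where U = U]) (simp_all add: lin mem)
  also have "\<dots> = sweedler H (E h) f"
    by (simp add: 2 sweedler_E[OF _ _ f])
  finally show ?thesis ..
qed

lemma lam_E: "h \<in> carrier H \<Longrightarrow> lam (E h) = lam h"
  unfolding E_def
  by (subst sweedler_out[OF lam]) (simp_all add: mem linear_onD(3)[OF lam] lam_idem)

lemma E_E: "h \<in> carrier H \<Longrightarrow> E (E h) = E h"
  unfolding E_def[of "E h"] by (simp add: sweedler_E[where U = H] lin lam_E) (simp add: E_def)

lemma counit_E:
  assumes [simp]: "h \<in> carrier H"
  shows "\<epsilon> (E h) = lam h"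
proof -
  have "\<epsilon> (E h) = sweedler H h (\<lambda>a b. \<epsilon> b * lam a)"
    unfolding E_def
    by (subst sweedler_out[of H ground "counit H"]) (simp_all add: mem coalgebraD(3) linear_onD(3)[OF coalgebraD(3)] ac_simps)
  also have "\<dots> = lam h"
    using counit_right[where U = ground and f = lam and C = H and c = h] by (simp add: lam)
  finally show ?thesis .
qed

lemma lam_E_mult:
  assumes [simp]: "h \<in> carrier H" "g \<in> carrier H"
  shows "lam (E h \<cdot> g) = lam h * lam g"
proof -
  have "lam (E h \<cdot> g) = sweedler H h (\<lambda>h1 h2. lam h1 * lam (h2 \<cdot> g))"
    unfolding E_def
    by (subst sweedler_out[of H ground "\<lambda>x. lam (x \<cdot> g)"]) (simp_all add: lin mem mult_scale linear_onD(3)[OF lam])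
  then show ?thesis by (simp add: lam_mult)
qed

text \<open>
Expanding the left side gives \<open>\<lambda> (E h\<^sub>1 g\<^sub>1) h\<^sub>2 g\<^sub>2\<close>, and \<open>\<lambda> (E h g) = \<lambda>(h) \<lambda>(g)\<close> is the
multiplicative axiom of \<open>\<lambda>\<close>.
\<close>
lemma E_mult:
  assumes [simp]: "h \<in> carrier H" "g \<in> carrier H"
  shows "E (E h \<cdot> g) = E h \<cdot> E g"
proof -
  have "E (E h \<cdot> g) = sweedler H (E h) (\<lambda>p q. sweedler H g (\<lambda>g1 g2. lam (p \<cdot> g1) *s (q \<cdot> g2)))"
    unfolding E_def[of "E h \<cdot> g"] by (simp add: sweedler_mult[where U = H] lin mem)
  also have "\<dots> = sweedler H h (\<lambda>p q. sweedler H g (\<lambda>g1 g2. (lam p *s q) \<cdot> (lam g1 *s g2)))"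
    by (simp add: sweedler_E[where U = H] lin mem lam_E_mult mult_scale mult.commute)
  also have "\<dots> = sweedler H g (\<lambda>g1 g2. sweedler H h (\<lambda>p q. (lam p *s q) \<cdot> (lam g1 *s g2)))"
    by (rule sweedler_swap)
  also have "\<dots> = E h \<cdot> E g"
    unfolding E_def
    by (simp add: sweedler_out[OF linear_on_mult(1)[OF _ _ linear_on_id]] sweedler_out[OF linear_on_mult_left] mem)
  finally show ?thesis .
qed

definition B where "B = H\<lparr>carrier := E ` carrier H\<rparr>"

lemma B_simps [simp]: "scale B = scale H" "mult B = mult H" "one B = one H" "comult B = comult H" "counit B = counit H"
  by (simp_all add: B_def)

lemma carrier_B: "carrier B = E ` carrier H" by (simp add: B_def)

lemma B_iff: "b \<in> carrier B \<longleftrightarrow> b \<in> carrier H \<and> E b = b"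
  unfolding carrier_B using E_E by (auto simp: mem) (metis image_eqI)

lemma E_in_B [mem]: "h \<in> carrier H \<Longrightarrow> E h \<in> carrier B" by (simp add: carrier_B)

lemma E_B: "b \<in> carrier B \<Longrightarrow> E b = b" by (simp add: B_iff)

lemma B_in_H: "b \<in> carrier B \<Longrightarrow> b \<in> carrier H" by (simp add: B_iff)

lemma vspace_B [simp]: "vspace B"
  by (rule vspace_image[OF _ _ E_linear]) (simp_all add: carrier_B)

lemma linear_on_B_I:
  assumes "linear_on H W f" shows "linear_on B W f"
  by (rule linear_on_subspace[OF assms]) (auto simp: B_in_H)

lemma linear_on_into_B:
  assumes "linear_on V H f" "\<And>v. v \<in> carrier V \<Longrightarrow> f v \<in> carrier B" shows "linear_on V B f"
  using assms by (auto simp: linear_on_def)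

lemma algebra_B: "algebra B"
proof -
  have m: "a \<cdot> b \<in> carrier B" if "a \<in> carrier B" "b \<in> carrier B" for a b
    using that E_mult[of a b] by (simp add: B_iff mem)
  have "bilinear_on B B B (mult H)"
    by (rule bilinear_onI; rule linear_on_into_B, rule linear_on_B_I) (simp_all add: lin m B_in_H)
  then show ?thesis
    unfolding algebra_def by (simp add: m B_in_H algebraD(5) E_one mem B_iff)
qed

lemma linear_on_E_B [lin]: "linear_on V H f \<Longrightarrow> linear_on V B (\<lambda>x. E (f x))"
  by (rule linear_on_into_B) (auto simp: lin mem dest: linear_onD(1))

lemma comult_E: "h \<in> carrier H \<Longrightarrow> \<Delta> (E h) = sweedler H h (\<lambda>a b. E a \<otimes>\<^bsub>B,B\<^esub> E b)"
proof -
  assume [simp]: "h \<in> carrier H"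
  have "\<Delta> (E h) = sweedler H h (\<lambda>a b. E a \<otimes> E b)"
    by (simp add: comult_sweedler[of "E h"] sweedler_E_E[where U = "H \<Otimes> H"] lin mem)
  also have "\<dots> = sweedler H h (\<lambda>a b. E a \<otimes>\<^bsub>B,B\<^esub> E b)"
    by (rule sweedler_cong[OF refl], rule tens_cong) simp_all
  finally show ?thesis .
qed

sublocale B: coalgebra_image H B E
  by unfold_locales (use linear_on_E_B[OF linear_on_id] in \<open>simp_all add: carrier_B comult_E\<close>)

lemma comult_in_B: "b \<in> carrier B \<Longrightarrow> \<Delta> b \<in> carrier (B \<Otimes> B)"
  by (auto simp: carrier_B comult_E mem)

lemma coalgebra_B: "coalgebra B"
proof (rule B.coalgebra)
  have "linear_on B (H \<Otimes> H) (comult H)" by (intro linear_on_B_I coalgebraD) simp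
  then show "linear_on B (B \<Otimes> B) (comult B)"
    by (auto simp: linear_on_def comult_in_B scale_tensor_space)
  show "linear_on B ground (counit B)" by (simp add: linear_on_B_I coalgebraD(3))
  fix h assume [simp]: "h \<in> carrier H"
  have "sweedler H h (\<lambda>a b. lam a *s E b) = E (E h)"
    unfolding E_def[of h] by (simp add: sweedler_out[OF E_linear] linear_onD(3)[OF E_linear] mem)
  then show "sweedler H h (\<lambda>a b. \<epsilon>\<^bsub>B\<^esub> (E a) *s\<^bsub>B\<^esub> E b) = E h" by (simp add: counit_E E_E)
  show "sweedler H h (\<lambda>a b. \<epsilon>\<^bsub>B\<^esub> (E b) *s\<^bsub>B\<^esub> E a) = E h" by (simp add: counit_E E_absorb)
qed

lemma bialgebra_B: "bialgebra B"
proof -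
  note [simp] = algebra_B coalgebra_B
  have m: "\<Delta> (b \<cdot> b') = tensor_mult B B (\<Delta> b) (\<Delta> b')"
    if b: "b \<in> carrier B" "b' \<in> carrier B" for b b'
  proof -
    obtain h g where [simp]: "h \<in> carrier H" "g \<in> carrier H" and eq: "b = E h" "b' = E g"
      using b by (auto simp: carrier_B)
    have m': "E a \<cdot>\<^bsub>B\<^esub> E b \<in> carrier B" if "a \<in> carrier H" "b \<in> carrier H" for a b
      by (rule algebraD(4)[OF algebra_B]) (use that in \<open>simp_all add: mem\<close>)
    have "\<Delta> (b \<cdot> b') = sweedler H (E h \<cdot> g) (\<lambda>a b. E a \<otimes>\<^bsub>B,B\<^esub> E b)"
      unfolding eq by (simp add: E_mult[symmetric] comult_E mem)
    also have "\<dots> = sweedler H h (\<lambda>h1 h2. sweedler H g (\<lambda>g1 g2. (E h1 \<cdot> E g1) \<otimes>\<^bsub>B,B\<^esub> (E h2 \<cdot> E g2)))"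
      by (simp add: sweedler_mult[where U = "B \<Otimes> B"] sweedler_E_E[where U = "B \<Otimes> B"] lin mem E_mult)
    also have "\<dots> = sweedler H g (\<lambda>g1 g2. sweedler H h (\<lambda>h1 h2. (E h1 \<cdot> E g1) \<otimes>\<^bsub>B,B\<^esub> (E h2 \<cdot> E g2)))"
      by (rule sweedler_swap)
    also have "\<dots> = tensor_mult B B (\<Delta> b) (\<Delta> b')"
      unfolding eq
      by (simp add: comult_E sweedler_out[OF linear_on_tensor_mult(1)[OF _ _ _ linear_on_id]]
        sweedler_out[OF linear_on_tensor_mult(2)[OF _ _ _ linear_on_id]] tensor_mult_tens mem)
    finally show ?thesis .
  qed
  have "\<Delta> \<one> = \<one> \<otimes>\<^bsub>B,B\<^esub> \<one>"
    by (simp, rule tens_cong) simp_all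
  then show ?thesis unfolding bialgebra_def using m by (simp add: B_in_H)
qed

lemma sweedler_B:
  assumes "b \<in> carrier B" "vspace U" "bilinear_on H H U f"
  shows "sweedler B b f = sweedler H b f"
  unfolding sweedler_def using assms
  by (simp, intro tlift_mono[symmetric, where U = U]) (auto simp: B_in_H comult_in_B)

text \<open>
By left linearity of \<open>E\<close> over \<open>B\<close>, \<open>b\<^sub>1 E(S b\<^sub>2) = E(b\<^sub>1 S b\<^sub>2) = \<epsilon>(b) 1\<close>. So \<open>S\<close> and \<open>E \<circ> S\<close> are both
convolution inverse to the inclusion of \<open>B\<close> in \<open>H\<close>, and \<open>S b = E (S b)\<close>.
\<close>
lemma S_B:
  assumes "b \<in> carrier B"
  shows "S b \<in> carrier B"
proof -
  have 1: "sweedler B b (\<lambda>x y. S x \<cdot> y) = \<epsilon>\<^bsub>B\<^esub> b *s \<one>" if "b \<in> carrier B" for b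
    using that by (simp add: sweedler_B[where U = H] lin mem B_in_H)
  have 2: "sweedler B b (\<lambda>x y. x \<cdot> E (S y)) = \<epsilon>\<^bsub>B\<^esub> b *s \<one>" if b: "b \<in> carrier B" for b
  proof -
    have "x \<cdot> E (S y) = E (x \<cdot> S y)" if "x \<in> carrier B" "y \<in> carrier B" for x y
      using E_mult[of x "S y"] that by (simp add: B_iff mem)
    then have "sweedler B b (\<lambda>x y. x \<cdot> E (S y)) = sweedler B b (\<lambda>x y. E (x \<cdot> S y))"
      using b by (simp add: coalgebra_B)
    also have "\<dots> = sweedler H b (\<lambda>x y. E (x \<cdot> S y))"
      using b by (simp add: sweedler_B[where U = H] lin mem)
    also have "\<dots> = \<epsilon> b *s \<one>"
      using b by (simp add: antipode_right[where U = H] lin E_one B_in_H)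
    finally show ?thesis by simp
  qed
  have "S b = E (S b)"
    by (rule convolution_inverse_unique[OF coalgebra_B, of H S "\<lambda>x. x" "\<lambda>x. E (S x)"])
      (use assms 1 2 in \<open>simp_all add: linear_on_B_I lin\<close>)
  then show ?thesis using assms by (simp add: B_iff mem)
qed

lemma hopf_B: "hopf B S"
proof
  show "bialgebra B" by (rule bialgebra_B)
  show "antipode B S"
    unfolding antipode_def
    using linear_on_into_B[OF linear_on_B_I[OF linear_S] S_B]
    by (simp add: sweedler_B[where U = H] lin mem B_in_H)
qed

lemma lam_B: "b \<in> carrier B \<Longrightarrow> lam b = \<epsilon> b"
  using counit_E[of b] by (simp add: B_iff)

lemma E_left_integral:
  assumes "t \<in> left_integrals H"
  shows "E t \<in> left_integrals B" "\<epsilon> (E t) = lam t"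
proof -
  have [simp]: "t \<in> carrier H" and t: "\<And>h. h \<in> carrier H \<Longrightarrow> h \<cdot> t = \<epsilon> h *s t"
    using assms by (auto simp: left_integrals_def)
  have "b \<cdot> E t = \<epsilon> b *s E t" if "b \<in> carrier B" for b
    using E_mult[of b t] that by (simp add: B_iff t linear_onD(3)[OF E_linear])
  then show "E t \<in> left_integrals B" by (simp add: left_integrals_def mem)
  show "\<epsilon> (E t) = lam t" by (simp add: counit_E)
qed

end

section \<open>Integrals of \<open>H\<close> and of its \<open>\<lambda>\<close>-invariants\<close>

locale partial_action_fd = hopf_integral_form H S I c \<phi> + partial_action H S lam
  for H :: "('k::field, 'v::ab_group_add, 'x) hopf_data_scheme" (structure) and S and I and c and \<phi> and lam
begin

lemma finite_dim_B: "finite_dim B"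
proof -
  interpret vector_space "scale H" using algebraD(1)[OF bialgebraD(1)[OF bialgebra]] by (simp add: vspace_def)
  have sub: "subspace (carrier B)" using vspace_B by (simp add: vspace_def)
  have "span (E ` I) = carrier B"
  proof
    show "span (E ` I) \<subseteq> carrier B" using sub I_in by (intro span_minimal) (auto simp: mem)
    show "carrier B \<subseteq> span (E ` I)"
    proof
      fix x assume "x \<in> carrier B"
      then obtain h where h: "h \<in> carrier H" "x = E h" by (auto simp: carrier_B)
      then have "x = (\<Sum>i\<in>I. c i h *s E i)" by (simp add: expand_linear[OF E_linear])
      also have "\<dots> \<in> span (E ` I)" by (intro span_sum span_scale span_base) simp
      finally show "x \<in> span (E ` I)" .
    qed
  qed
  moreover have "E ` I \<subseteq> carrier B" by (auto simp: mem)
  ultimately show ?thesis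
    unfolding finite_dim_def by (intro exI[of _ "E ` I"] conjI) simp_all
qed

lemma S_B_surj: "S ` carrier B = carrier B"
proof (rule linear_inj_imp_surj[OF vspace_B finite_dim_B])
  interpret B': hopf B S by (rule hopf_B)
  show "linear_on B B S" by (rule B'.linear_S)
qed (simp add: S_inj B_in_H)

text \<open>
The element \<open>G = h\<^sub>1 \<lambda>(S h\<^sub>2)\<close> satisfies \<open>S G = E (S h)\<close>, so it lies in \<open>B\<close> because \<open>S\<close> is injective and
maps \<open>B\<close> onto \<open>B\<close>. On \<open>B\<close> the functionals \<open>\<lambda>\<close> and \<open>\<epsilon>\<close> agree, and \<open>\<epsilon> G = \<lambda> (S h)\<close> while
\<open>\<lambda> G = \<lambda> (S (E h)) = \<epsilon> (S (E h)) = \<lambda> h\<close>.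
\<close>
lemma lam_S:
  assumes [simp]: "h \<in> carrier H"
  shows "lam (S h) = lam h"
proof -
  define G where "G = sweedler H h (\<lambda>a b. lam (S b) *s a)"
  have [simp]: "G \<in> carrier H" by (simp add: G_def mem)
  have "E (S h) = sweedler H h (\<lambda>a b. lam (S b) *s S a)"
    unfolding E_def by (simp add: sweedler_S[where U = H] lin)
  also have "\<dots> = S G"
    unfolding G_def by (simp add: sweedler_out[OF linear_S] linear_onD(3)[OF linear_S] mem)
  finally have "S G \<in> S ` carrier B" using S_B_surj E_in_B[of "S h"] by (simp add: mem)
  then obtain b where b: "b \<in> carrier B" "S G = S b" by auto
  have "G - b = 0"
    by (rule S_inj) (use b in \<open>simp_all add: B_in_H mem linear_on_diff[OF linear_S]\<close>)
  then have "lam G = \<epsilon> G" using b(1) by (simp add: lam_B)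
  moreover have "\<epsilon> G = lam (S h)"
  proof -
    have "\<epsilon> G = sweedler H h (\<lambda>a b. \<epsilon> a * lam (S b))"
      unfolding G_def
      by (subst sweedler_out[of H ground "counit H"]) (simp_all add: mem coalgebraD(3) linear_onD(3)[OF coalgebraD(3)] ac_simps)
    also have "\<dots> = lam (S h)"
      using counit_left[where U = ground and f = "\<lambda>x. lam (S x)" and C = H and c = h] by (simp add: lin)
    finally show ?thesis .
  qed
  moreover have "lam G = lam h"
  proof -
    have "lam G = sweedler H h (\<lambda>a b. lam a * lam (S b))"
      unfolding G_def
      by (subst sweedler_out[OF lam]) (simp_all add: mem linear_onD(3)[OF lam] ac_simps)
    also have "\<dots> = lam (S (E h))"
      unfolding E_def
      by (subst sweedler_out[of H ground "\<lambda>x. lam (S x)"])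
        (simp_all add: lin mem linear_onD(3)[OF lam] linear_onD(3)[OF linear_S])
    also have "\<dots> = lam h"
      by (simp add: lam_B S_B E_in_B counit_S mem counit_E)
    finally show ?thesis .
  qed
  ultimately show ?thesis by simp
qed

lemma S_right_integral:
  assumes t: "t \<in> right_integrals H"
  shows "S t \<in> left_integrals H"
proof -
  have [simp]: "t \<in> carrier H" and t: "\<And>h. h \<in> carrier H \<Longrightarrow> t \<cdot> h = \<epsilon> h *s t"
    using assms by (auto simp: right_integrals_def)
  have "h \<cdot> S t = \<epsilon> h *s S t" if "h \<in> carrier H" for h
  proof -
    obtain k where k: "k \<in> carrier H" "h = S k" using S_surj \<open>h \<in> carrier H\<close> by (metis imageE)
    then show ?thesis
      using S_mult[of t k] by (simp add: t linear_onD(3)[OF linear_S] counit_S)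
  qed
  then show ?thesis by (simp add: left_integrals_def mem)
qed

text \<open>
Take the left integral \<open>t\<close> of \<open>H\<close> with \<open>\<phi> t = 1\<close>. The product \<open>S l \<cdot> E t\<close> is \<open>\<epsilon> (S l) E t = E t\<close>, since
\<open>E t\<close> is a left integral of \<open>B\<close>, and it is \<open>\<epsilon> (E t) S l = \<lambda>(t) S l\<close>, since \<open>S l\<close> is a right integral
of \<open>S B = B\<close>.
\<close>
lemma exists_integral_lam_ne_0:
  assumes l: "l \<in> left_integrals B" and el: "\<epsilon> l = 1"
  shows "\<exists>t \<in> left_integrals H. lam t \<noteq> 0"
proof -
  have lB: "l \<in> carrier B" and lb: "\<And>b. b \<in> carrier B \<Longrightarrow> b \<cdot> l = \<epsilon> b *s l"
    using l by (auto simp: left_integrals_def)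
  have [simp]: "l \<in> carrier H" using lB by (rule B_in_H)
  obtain t where t: "t \<in> left_integrals H" "\<phi> t = 1" using exists_dual_left_integral by blast
  have [simp]: "t \<in> carrier H" using t(1) by (simp add: left_integrals_def)
  have Et: "E t \<noteq> 0"
  proof
    assume "E t = 0"
    have "\<phi> (E t) = sweedler H t (\<lambda>a b. lam a * \<phi> b)"
      unfolding E_def by (subst sweedler_out[OF phi]) (simp_all add: mem linear_onD(3)[OF phi])
    also have "\<dots> = lam (sweedler H t (\<lambda>a b. \<phi> b *s a))"
      by (subst sweedler_out[OF lam]) (simp_all add: mem linear_onD(3)[OF lam] ac_simps)
    also have "\<dots> = 1" by (simp add: phi_integral t(2) lam_one)
    finally show False using \<open>E t = 0\<close> by (simp add: linear_on_0[OF phi])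
  qed
  obtain b where b: "b \<in> carrier B" "E t = S b" using S_B_surj E_in_B[of t] by (metis \<open>t \<in> carrier H\<close> imageE)
  have "S l \<cdot> E t = S (b \<cdot> l)" using b by (simp add: S_mult B_in_H)
  also have "\<dots> = \<epsilon> (E t) *s S l"
    using b by (simp add: lb linear_onD(3)[OF linear_S] counit_S B_in_H)
  finally have "S l \<cdot> E t = lam t *s S l" by (simp add: counit_E)
  moreover have "S l \<cdot> E t = E t"
    using E_left_integral(1)[OF t(1)] S_B[OF lB] el by (simp add: left_integrals_def counit_S)
  ultimately have "lam t \<noteq> 0" using Et by auto
  then show ?thesis using t(1) by blast
qed

theorem integral_criterion:
  "(\<exists>l \<in> left_integrals B. \<epsilon> l = 1) \<longleftrightarrow>
     lam ` left_integrals H \<noteq> {0} \<or> lam ` right_integrals H \<noteq> {0}"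
proof
  have 0: "0 \<in> left_integrals H" "0 \<in> right_integrals H"
    by (simp_all add: left_integrals_def right_integrals_def mem linear_on_0[OF linear_on_mult_left]
        linear_on_0[OF linear_on_mult(1)[OF _ _ linear_on_id]])
  have l0: "lam 0 = 0" by (simp add: linear_on_0[OF lam])
  {
    assume "\<exists>l \<in> left_integrals B. \<epsilon> l = 1"
    then show "lam ` left_integrals H \<noteq> {0} \<or> lam ` right_integrals H \<noteq> {0}"
      using exists_integral_lam_ne_0 by blast
  next
    assume "lam ` left_integrals H \<noteq> {0} \<or> lam ` right_integrals H \<noteq> {0}"
    then have "(\<exists>t \<in> left_integrals H. lam t \<noteq> 0) \<or> (\<exists>t \<in> right_integrals H. lam t \<noteq> 0)"
      using 0 l0 by (metis (no_types, lifting) empty_iff image_eqI image_subsetI singletonI subset_singletonD)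
    moreover have "S t \<in> left_integrals H \<and> lam (S t) = lam t" if "t \<in> right_integrals H" for t
      using S_right_integral[OF that] lam_S[of t] that by (simp add: right_integrals_def)
    ultimately obtain t where t: "t \<in> left_integrals H" "lam t \<noteq> 0" by metis
    have E: "E t \<in> left_integrals B" "\<epsilon> (E t) = lam t" by (rule E_left_integral[OF t(1)])+
    let ?l = "inverse (lam t) *s E t"
    have EB: "E t \<in> carrier B" using E(1) by (simp add: left_integrals_def)
    have lB: "?l \<in> carrier B" using vspaceD(5)[OF vspace_B EB] by simp
    have "?l \<in> left_integrals B"
      using E(1) lB EB by (simp add: left_integrals_def B_in_H mult_scale ac_simps)
    moreover have "\<epsilon> ?l = 1"
      using E(2) t(2) EB linear_onD(3)[OF coalgebraD(3)[of H], of "E t"] by (simp add: B_in_H)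
    ultimately show "\<exists>l \<in> left_integrals B. \<epsilon> l = 1" by blast
  }
qed

end

section \<open>The quotient Hopf algebra \<open>Lz\<close>\<close>

locale partial_coaction = hopf L S for L :: "('k::field, 'v::ab_group_add, 'x) hopf_data_scheme" (structure) and S +
  fixes z :: 'v
  assumes z [simp]: "z \<in> carrier L" and counit_z: "\<epsilon> z = 1"
    and z_absorb: "x \<in> carrier L \<Longrightarrow> z \<cdot> (x \<cdot> z) = x \<cdot> z"
    and comult_z: "sweedler L z (\<lambda>a b. a \<otimes>\<^bsub>L,L\<^esub> (b \<cdot> z)) = z \<otimes>\<^bsub>L,L\<^esub> z"
begin

lemma sweedler_z:
  assumes [simp]: "vspace U" and f: "bilinear_on L L U f"
  shows "sweedler L z (\<lambda>a b. f a (b \<cdot> z)) = f z z"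
proof -
  have "f z z = tlift L L f (sweedler L z (\<lambda>a b. a \<otimes>\<^bsub>L,L\<^esub> (b \<cdot> z)))"
    by (simp add: comult_z tlift_tens[where U = U] f)
  also have "\<dots> = sweedler L z (\<lambda>a b. f a (b \<cdot> z))"
    by (simp add: sweedler_out[OF tensor_universal_property(1)[OF _ _ _ f]] tlift_tens[where U = U] f mem)
  finally show ?thesis ..
qed

lemma z_idem: "z \<cdot> z = z"
  using z_absorb[of "\<one>"] by (simp add: mem)

definition \<pi> where "\<pi> x = x \<cdot> z"

lemma pi_linear: "linear_on L L \<pi>" unfolding \<pi>_def by (simp add: lin)
lemmas pi_linear' [lin] = pi_linear linear_on_compose[OF pi_linear]
lemmas pi_in [mem] = linear_onD(1)[OF pi_linear]

lemma pi_one: "\<pi> \<one> = z" by (simp add: \<pi>_def)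

lemma pi_mult: "x \<in> carrier L \<Longrightarrow> y \<in> carrier L \<Longrightarrow> \<pi> x \<cdot> \<pi> y = \<pi> (x \<cdot> y)"
  unfolding \<pi>_def by (simp add: algebraD(5) z_absorb mem)

lemma pi_pi: "x \<in> carrier L \<Longrightarrow> \<pi> (\<pi> x) = \<pi> x"
  unfolding \<pi>_def by (simp add: algebraD(5) z_idem)

lemma counit_pi: "x \<in> carrier L \<Longrightarrow> \<epsilon> (\<pi> x) = \<epsilon> x"
  unfolding \<pi>_def by (simp add: counit_z)

text \<open>
The comultiplication is \<open>y \<mapsto> y\<^sub>1 \<otimes> y\<^sub>2 z\<close>, as in the smash product; on \<open>L z\<close> its first leg is in \<open>L z\<close>
as well, by \<open>comult_pi\<close>.
\<close>
definition M where
  "M = L\<lparr>carrier := \<pi> ` carrier L, one := z, comult := \<lambda>y. sweedler L y (\<lambda>a b. a \<otimes>\<^bsub>L,L\<^esub> (b \<cdot> z))\<rparr>"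

lemma M_simps [simp]: "scale M = scale L" "mult M = mult L" "one M = z" "counit M = counit L"
  by (simp_all add: M_def)

lemma carrier_M: "carrier M = \<pi> ` carrier L" by (simp add: M_def)

lemma M_iff: "y \<in> carrier M \<longleftrightarrow> y \<in> carrier L \<and> \<pi> y = y"
  unfolding carrier_M using pi_pi by (auto simp: mem) (metis image_eqI)

lemma pi_in_M [mem]: "x \<in> carrier L \<Longrightarrow> \<pi> x \<in> carrier M" by (simp add: carrier_M)

lemma M_in_L: "y \<in> carrier M \<Longrightarrow> y \<in> carrier L" by (simp add: M_iff)

lemma M_z: "y \<in> carrier M \<Longrightarrow> y \<cdot> z = y" by (simp add: M_iff \<pi>_def)

lemma z_M: "y \<in> carrier M \<Longrightarrow> z \<cdot> y = y" using z_absorb[of y] by (simp add: M_z M_in_L)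

lemma vspace_M [simp]: "vspace M"
  by (rule vspace_image[OF _ _ pi_linear]) (simp_all add: carrier_M)

lemma linear_on_M_I: "linear_on L W f \<Longrightarrow> linear_on M W f"
  by (erule linear_on_subspace) (auto simp: M_in_L)

lemma linear_on_into_M:
  assumes "linear_on V L f" "\<And>v. v \<in> carrier V \<Longrightarrow> f v \<in> carrier M" shows "linear_on V M f"
  using assms by (auto simp: linear_on_def)

lemma z_in_M [mem]: "z \<in> carrier M" by (simp add: M_iff \<pi>_def z_idem)

lemma mult_M: "a \<in> carrier L \<Longrightarrow> b \<in> carrier M \<Longrightarrow> a \<cdot> b \<in> carrier M"
  by (simp add: M_iff \<pi>_def mem algebraD(5))

lemma algebra_M: "algebra M"
proof -
  have "bilinear_on M M M (mult L)"
    by (rule bilinear_onI; rule linear_on_into_M, rule linear_on_M_I) (simp_all add: lin mult_M M_in_L)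
  then show ?thesis
    unfolding algebra_def by (simp add: mult_M M_in_L algebraD(5) M_z z_M mem)
qed

lemma linear_on_pi_M [lin]: "linear_on V L f \<Longrightarrow> linear_on V M (\<lambda>x. \<pi> (f x))"
  by (rule linear_on_into_M) (auto simp: lin mem dest: linear_onD(1))

lemma comult_M: "\<Delta>\<^bsub>M\<^esub> y = sweedler L y (\<lambda>a b. a \<otimes>\<^bsub>L,L\<^esub> \<pi> b)"
  by (simp add: M_def \<pi>_def)

text \<open>
\<open>\<Delta>(x z)\<close>, with \<open>z\<close> multiplied to the second leg, is \<open>x\<^sub>1 z\<^sub>1 \<otimes> x\<^sub>2 z\<^sub>2 z = x\<^sub>1 z \<otimes> x\<^sub>2 z\<close>.
\<close>
lemma comult_pi:
  assumes [simp]: "x \<in> carrier L"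
  shows "\<Delta>\<^bsub>M\<^esub> (\<pi> x) = sweedler L x (\<lambda>a b. \<pi> a \<otimes>\<^bsub>M,M\<^esub> \<pi> b)"
proof -
  have "\<Delta>\<^bsub>M\<^esub> (\<pi> x) = sweedler L x (\<lambda>x1 x2. sweedler L z (\<lambda>a b. (x1 \<cdot> a) \<otimes>\<^bsub>L,L\<^esub> (x2 \<cdot> (b \<cdot> z))))"
    unfolding comult_M \<pi>_def by (simp add: sweedler_mult[where U = "L \<Otimes> L"] lin mem algebraD(5))
  also have "\<dots> = sweedler L x (\<lambda>x1 x2. (x1 \<cdot> z) \<otimes>\<^bsub>L,L\<^esub> (x2 \<cdot> z))"
    by (simp add: sweedler_z[where U = "L \<Otimes> L" and f = "\<lambda>a b. (_ \<cdot> a) \<otimes>\<^bsub>L,L\<^esub> (_ \<cdot> b)"] lin mem)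
  also have "\<dots> = sweedler L x (\<lambda>x1 x2. (x1 \<cdot> z) \<otimes>\<^bsub>M,M\<^esub> (x2 \<cdot> z))"
    by (rule sweedler_cong[OF refl], rule tens_cong) simp_all
  finally show ?thesis by (simp add: \<pi>_def)
qed

sublocale M: coalgebra_image L M \<pi>
  by unfold_locales (use linear_on_pi_M[OF linear_on_id] in \<open>simp_all add: carrier_M comult_pi\<close>)

lemma comult_in_M: "y \<in> carrier M \<Longrightarrow> \<Delta>\<^bsub>M\<^esub> y \<in> carrier (M \<Otimes> M)"
  by (auto simp: carrier_M comult_pi mem)

lemma coalgebra_M: "coalgebra M"
proof (rule M.coalgebra)
  have "linear_on M (L \<Otimes> L) (comult M)"
    unfolding comult_M by (intro linear_on_M_I) (simp add: lin mem)
  then show "linear_on M (M \<Otimes> M) (comult M)"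
    by (auto simp: linear_on_def comult_in_M scale_tensor_space)
  show "linear_on M ground (counit M)" by (simp add: linear_on_M_I coalgebraD(3))
  fix x assume [simp]: "x \<in> carrier L"
  show "sweedler L x (\<lambda>a b. \<epsilon>\<^bsub>M\<^esub> (\<pi> a) *s\<^bsub>M\<^esub> \<pi> b) = \<pi> x"
    by (simp add: counit_pi counit_left lin)
  show "sweedler L x (\<lambda>a b. \<epsilon>\<^bsub>M\<^esub> (\<pi> b) *s\<^bsub>M\<^esub> \<pi> a) = \<pi> x"
    by (simp add: counit_pi counit_right lin)
qed

lemma bialgebra_M: "bialgebra M"
proof -
  note [simp] = algebra_M coalgebra_M
  have m: "\<Delta>\<^bsub>M\<^esub> (y \<cdot> y') = tensor_mult M M (\<Delta>\<^bsub>M\<^esub> y) (\<Delta>\<^bsub>M\<^esub> y')"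
    if y: "y \<in> carrier M" "y' \<in> carrier M" for y y'
  proof -
    obtain x x' where [simp]: "x \<in> carrier L" "x' \<in> carrier L" and eq: "y = \<pi> x" "y' = \<pi> x'"
      using y by (auto simp: carrier_M)
    have "\<Delta>\<^bsub>M\<^esub> (y \<cdot> y') = sweedler L x (\<lambda>x1 x2. sweedler L x' (\<lambda>y1 y2. (\<pi> x1 \<cdot> \<pi> y1) \<otimes>\<^bsub>M,M\<^esub> (\<pi> x2 \<cdot> \<pi> y2)))"
      unfolding eq by (simp add: pi_mult comult_pi mem sweedler_mult[where U = "M \<Otimes> M"] lin)
    also have "\<dots> = sweedler L x' (\<lambda>y1 y2. sweedler L x (\<lambda>x1 x2. (\<pi> x1 \<cdot> \<pi> y1) \<otimes>\<^bsub>M,M\<^esub> (\<pi> x2 \<cdot> \<pi> y2)))"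
      by (rule sweedler_swap)
    also have "\<dots> = tensor_mult M M (\<Delta>\<^bsub>M\<^esub> y) (\<Delta>\<^bsub>M\<^esub> y')"
      unfolding eq
      by (simp add: comult_pi sweedler_out[OF linear_on_tensor_mult(1)[OF _ _ _ linear_on_id]]
        sweedler_out[OF linear_on_tensor_mult(2)[OF _ _ _ linear_on_id]] tensor_mult_tens mem)
    finally show ?thesis .
  qed
  have "\<Delta>\<^bsub>M\<^esub> (\<pi> \<one>) = \<pi> \<one> \<otimes>\<^bsub>M,M\<^esub> \<pi> \<one>"
    by (simp add: comult_pi mem sweedler_one[where U = "M \<Otimes> M"] lin)
  then have "\<Delta>\<^bsub>M\<^esub> z = z \<otimes>\<^bsub>M,M\<^esub> z" unfolding pi_one .
  then show ?thesis unfolding bialgebra_def using m by (simp add: M_in_L counit_z)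
qed

lemma sweedler_M:
  assumes y: "y \<in> carrier M" and [simp]: "vspace U" and f: "bilinear_on L L U f"
  shows "sweedler M y f = sweedler L y (\<lambda>a b. f a (\<pi> b))"
proof -
  have [simp]: "y \<in> carrier L" using y by (rule M_in_L)
  have "sweedler M y f = tlift L L f (\<Delta>\<^bsub>M\<^esub> y)"
    unfolding sweedler_def using y f
    by (intro tlift_mono[symmetric, where U = U]) (auto simp: M_in_L comult_in_M)
  also have "\<dots> = sweedler L y (\<lambda>a b. f a (\<pi> b))"
    unfolding comult_M
    by (simp add: sweedler_out[OF tensor_universal_property(1)[OF _ _ _ f]] tlift_tens[where U = U] f mem)
  finally show ?thesis .
qed

text \<open>
That \<open>\<pi> \<circ> S\<close> is a left convolution inverse of the identity of \<open>M\<close> is a direct computation. Hence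
\<open>\<pi> \<circ> S \<circ> \<pi>\<close> and \<open>\<pi> \<circ> S\<close> are both inverse to \<open>\<pi>\<close>, as maps from \<open>L\<close> to \<open>M\<close>, and so coincide; from this
the right inverse property follows.
\<close>
lemma hopf_M: "hopf M (\<lambda>y. \<pi> (S y))"
proof
  show "bialgebra M" by (rule bialgebra_M)
  note [simp] = algebra_M coalgebra_M
  have l: "sweedler M y (\<lambda>a b. \<pi> (S a) \<cdot>\<^bsub>M\<^esub> b) = \<epsilon>\<^bsub>M\<^esub> y *s\<^bsub>M\<^esub> \<one>\<^bsub>M\<^esub>" if y: "y \<in> carrier M" for y
  proof -
    have [simp]: "y \<in> carrier L" using y by (rule M_in_L)
    have "sweedler M y (\<lambda>a b. \<pi> (S a) \<cdot>\<^bsub>M\<^esub> b) = sweedler L y (\<lambda>a b. \<pi> (S a \<cdot> b))"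
      using y by (simp add: sweedler_M[where U = L] lin mem pi_mult)
    also have "\<dots> = \<epsilon>\<^bsub>M\<^esub> y *s\<^bsub>M\<^esub> \<one>\<^bsub>M\<^esub>"
      by (simp add: antipode_left[where U = L] lin pi_one)
    finally show ?thesis .
  qed
  have S: "linear_on M M (\<lambda>y. \<pi> (S y))"
    by (rule linear_on_into_M, rule linear_on_M_I) (simp_all add: lin mem M_in_L)
  have SS: "\<pi> (S (\<pi> x)) = \<pi> (S x)" if [simp]: "x \<in> carrier L" for x
  proof (rule convolution_inverse_unique[of L M "\<lambda>x. \<pi> (S (\<pi> x))" \<pi> "\<lambda>x. \<pi> (S x)"])
    fix x assume [simp]: "x \<in> carrier L"
    have "bilinear_on M M M (\<lambda>a b. \<pi> (S a) \<cdot>\<^bsub>M\<^esub> b)"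
      using S linear_onD(1)[OF S] by (simp add: lin del: M_simps)
    from M.sweedler_pi[OF _ _ this, of x] l[of "\<pi> x"]
    show "sweedler L x (\<lambda>a b. \<pi> (S (\<pi> a)) \<cdot>\<^bsub>M\<^esub> \<pi> b) = \<epsilon> x *s\<^bsub>M\<^esub> \<one>\<^bsub>M\<^esub>"
      by (simp add: mem counit_pi)
    show "sweedler L x (\<lambda>a b. \<pi> a \<cdot>\<^bsub>M\<^esub> \<pi> (S b)) = \<epsilon> x *s\<^bsub>M\<^esub> \<one>\<^bsub>M\<^esub>"
      by (simp add: pi_mult mem antipode_right[where U = L] lin pi_one)
  qed (simp_all add: lin)
  have r: "sweedler M y (\<lambda>a b. a \<cdot>\<^bsub>M\<^esub> \<pi> (S b)) = \<epsilon>\<^bsub>M\<^esub> y *s\<^bsub>M\<^esub> \<one>\<^bsub>M\<^esub>" if y: "y \<in> carrier M" for y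
  proof -
    obtain x where [simp]: "x \<in> carrier L" and y: "y = \<pi> x" using y by (auto simp: carrier_M)
    have "bilinear_on M M M (\<lambda>a b. a \<cdot>\<^bsub>M\<^esub> \<pi> (S b))"
      using S linear_onD(1)[OF S] by (simp add: lin del: M_simps)
    from M.sweedler_pi[OF _ _ this, of x]
    show ?thesis unfolding y
      by (simp add: mem counit_pi SS pi_mult antipode_right[where U = L] lin pi_one)
  qed
  show "antipode M (\<lambda>y. \<pi> (S y))"
    unfolding antipode_def using S l r by blast
qed

lemma left_integral_M:
  assumes "t \<in> left_integrals L"
  shows "\<pi> t \<in> left_integrals M"
proof -
  have [simp]: "t \<in> carrier L" and t: "\<And>h. h \<in> carrier L \<Longrightarrow> h \<cdot> t = \<epsilon> h *s t"
    using assms by (auto simp: left_integrals_def)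
  have "y \<cdot> \<pi> t = \<epsilon> y *s \<pi> t" if "y \<in> carrier M" for y
    using that by (simp add: \<pi>_def algebraD(5)[symmetric] M_in_L t mult_scale)
  then show ?thesis by (simp add: left_integrals_def mem)
qed

text \<open>
For \<open>t\<close> in \<open>L z\<close>, \<open>(x z) t = x t\<close>, because \<open>z\<close> acts as a left unit on \<open>L z\<close>.
\<close>
lemma left_integral_L:
  assumes "t \<in> left_integrals M"
  shows "t \<in> left_integrals L"
proof -
  have tM: "t \<in> carrier M" and t: "\<And>y. y \<in> carrier M \<Longrightarrow> y \<cdot> t = \<epsilon> y *s t"
    using assms by (auto simp: left_integrals_def)
  have [simp]: "t \<in> carrier L" using tM by (rule M_in_L)
  have "x \<cdot> t = \<epsilon> x *s t" if [simp]: "x \<in> carrier L" for x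
    using t[of "\<pi> x"] counit_pi[of x] tM by (simp add: mem) (simp add: \<pi>_def algebraD(5) z_M)
  then show ?thesis by (simp add: left_integrals_def)
qed

end

section \<open>Hopf algebras with equal operations\<close>

lemma linear_on_cong:
  assumes "vspace V" "\<And>v. v \<in> carrier V \<Longrightarrow> f v = g v" "linear_on V W f"
  shows "linear_on V W g"
  using assms by (auto simp: linear_on_def mem)

lemma hopf_cong:
  fixes A :: "('k::field, 'v::ab_group_add, 'x) hopf_data_scheme"
    and A' :: "('k, 'v, 'y) hopf_data_scheme"
  assumes A: "hopf A S" and c: "carrier A' = carrier A" and s: "scale A' = scale A"
    and m: "\<And>a b. a \<in> carrier A \<Longrightarrow> b \<in> carrier A \<Longrightarrow> a \<cdot>\<^bsub>A'\<^esub> b = a \<cdot>\<^bsub>A\<^esub> b"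
    and o: "\<one>\<^bsub>A'\<^esub> = \<one>\<^bsub>A\<^esub>"
    and d: "\<And>a. a \<in> carrier A \<Longrightarrow> \<Delta>\<^bsub>A'\<^esub> a = \<Delta>\<^bsub>A\<^esub> a"
    and e: "\<And>a. a \<in> carrier A \<Longrightarrow> \<epsilon>\<^bsub>A'\<^esub> a = \<epsilon>\<^bsub>A\<^esub> a"
  shows "hopf A' S"
proof -
  interpret hopf A S by fact
  note tr = vspace_eq_transfer[of A' A, OF c s]
  have alg: "algebra A'"
  proof -
    have "bilinear_on A A A (mult A')"
    proof (rule bilinear_onI)
      fix b assume b: "b \<in> carrier A"
      show "linear_on A A (\<lambda>a. a \<cdot>\<^bsub>A'\<^esub> b)"
        by (rule linear_on_cong[where f = "\<lambda>a. a \<cdot>\<^bsub>A\<^esub> b"]) (simp_all add: b m lin)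
      show "linear_on A A (mult A' b)"
        by (rule linear_on_cong[where f = "mult A b"]) (simp_all add: b m lin)
    qed
    then show ?thesis unfolding algebra_def by (simp add: tr c m o mem algebraD(5))
  qed
  have sw: "sweedler A' a f = sweedler A a f" if "a \<in> carrier A" for a f
    unfolding sweedler_def tr by (simp add: d that)
  have coalg: "coalgebra A'"
  proof -
    have "linear_on A (A \<Otimes> A) (comult A')" "linear_on A ground (counit A')"
      by (rule linear_on_cong[OF _ _ coalgebraD(2)], simp_all add: d)
        (rule linear_on_cong[OF _ _ coalgebraD(3)], simp_all add: e)
    moreover have "sweedler A c (\<lambda>a b. sweedler A a (\<lambda>a1 a2. a1 \<otimes>\<^bsub>A, A \<Otimes> A\<^esub> (a2 \<otimes>\<^bsub>A,A\<^esub> b))) =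
        sweedler A c (\<lambda>a b. sweedler A b (\<lambda>b1 b2. a \<otimes>\<^bsub>A, A \<Otimes> A\<^esub> (b1 \<otimes>\<^bsub>A,A\<^esub> b2)))" if "c \<in> carrier A" for c
      using that by (intro coassoc[where U = "A \<Otimes> A \<Otimes> A"]) (simp_all add: lin mem)
    ultimately show ?thesis
      unfolding coalgebra_def tr c s by (simp add: sw e counit_left counit_right lin)
  qed
  have tm: "tensor_mult A' A' x y = tensor_mult A A x y" if "x \<in> carrier (A \<Otimes> A)" "y \<in> carrier (A \<Otimes> A)" for x y
    unfolding tensor_mult_def tr using that by (simp add: m cong: tlift_cong)
  have "\<Delta>\<^bsub>A\<^esub> (a \<cdot>\<^bsub>A\<^esub> b) = tensor_mult A A (\<Delta>\<^bsub>A\<^esub> a) (\<Delta>\<^bsub>A\<^esub> b)" if "a \<in> carrier A" "b \<in> carrier A" for a b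
    using bialgebra that unfolding bialgebra_def by metis
  then have "bialgebra A'"
    unfolding bialgebra_def tr c o using alg coalg by (simp add: m d e tm mem)
  moreover have "antipode A' S"
    unfolding antipode_def tr c s o by (simp add: sw linear_S m e mem)
  ultimately show ?thesis by (simp add: hopf_def)
qed

lemma (in hopf) semisimple_separable_integral:
  "semisimple H \<longleftrightarrow> (\<exists>t \<in> left_integrals H. \<epsilon> t = 1)"
  "separable H \<longleftrightarrow> (\<exists>t \<in> left_integrals H. \<epsilon> t = 1)"
  using semisimple_imp_normalized_integral[of H] normalized_integral_imp_separable
    separable_imp_semisimple[of H] by auto

section \<open>The partial smash product as a tensor product\<close>

locale partial_smash_product =
  L: partial_coaction L SL z + H: partial_action H SH lam
  for L :: "('k::field, 'l::ab_group_add) hopf_data" (structure) and SL and z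
    and H :: "('k, 'h::ab_group_add) hopf_data" and SH and lam
begin

abbreviation (input) tens_LH (infix \<open>\<odot>\<close> 65) where "x \<odot> h \<equiv> x \<otimes>\<^bsub>L,H\<^esub> h"
abbreviation "P \<equiv> partial_smash L H lam z"
abbreviation "T \<equiv> tensor_hopf L.M H.B"

text \<open>
Moving the scalar \<open>\<lambda>(h\<^sub>1)\<close> across the tensor sign turns the second factor into a value of \<open>E\<close>. This
identifies both the spanning set and the multiplication of the smash product.
\<close>
lemma sweedler_lam:
  assumes [simp]: "x \<in> carrier L" "h \<in> carrier H" and g: "linear_on H H g"
  shows "sweedler H h (\<lambda>h1 h2. (lam h1 *s x) \<odot> g h2) = x \<odot> g (H.E h)"
proof -
  note [mem] = linear_onD(1)[OF g]
  have "x \<odot> g (H.E h) = sweedler H h (\<lambda>h1 h2. x \<odot> g (lam h1 *s\<^bsub>H\<^esub> h2))"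
    unfolding H.E_def
    by (rule sweedler_out[where U = H and X = "L \<Otimes> H"]) (simp_all add: lin mem linear_on_compose[OF g linear_on_id] g)
  also have "\<dots> = sweedler H h (\<lambda>h1 h2. (lam h1 *s x) \<odot> g h2)"
  proof -
    have "(k *s x) \<odot> g y = x \<odot> g (k *s\<^bsub>H\<^esub> y)" if [simp]: "y \<in> carrier H" for k y
      using linear_onD(3)[OF linear_on_tens(1)[OF _ _ _ linear_on_id, of L H "g y"], of x k]
        linear_onD(3)[OF linear_on_tens_left[of L H x], of "g y" k]
      by (simp add: linear_onD(3)[OF g] mem)
    then show ?thesis by simp
  qed
  finally show ?thesis ..
qed

lemma carrier_P: "carrier P = carrier (L.M \<Otimes> H.B)"
proof -
  have "{sweedler H h (\<lambda>h1 h2. (lam h1 *s (x \<cdot> z)) \<odot> h2) | x h. x \<in> carrier L \<and> h \<in> carrier H} =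
    {v \<otimes>\<^bsub>L.M,H.B\<^esub> w | v w. v \<in> carrier L.M \<and> w \<in> carrier H.B}" (is "?A = ?B")
  proof -
    have eq: "sweedler H h (\<lambda>h1 h2. (lam h1 *s (x \<cdot> z)) \<odot> h2) = L.\<pi> x \<otimes>\<^bsub>L.M,H.B\<^esub> H.E h"
      if "x \<in> carrier L" "h \<in> carrier H" for x h
    proof -
      have "sweedler H h (\<lambda>h1 h2. (lam h1 *s (x \<cdot> z)) \<odot> h2) = L.\<pi> x \<odot> H.E h"
        using that sweedler_lam[of "x \<cdot> z" h "\<lambda>x. x"] by (simp add: lin mem L.\<pi>_def)
      also have "\<dots> = L.\<pi> x \<otimes>\<^bsub>L.M,H.B\<^esub> H.E h" by (rule tens_cong) simp_all
      finally show ?thesis .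
    qed
    show ?thesis
    proof (intro equalityI subsetI)
      fix t assume "t \<in> ?A"
      then obtain x h where "x \<in> carrier L" "h \<in> carrier H" "t = L.\<pi> x \<otimes>\<^bsub>L.M,H.B\<^esub> H.E h"
        using eq by auto
      then show "t \<in> ?B" using L.pi_in_M H.E_in_B by blast
    next
      fix t assume "t \<in> ?B"
      then obtain x h where "x \<in> carrier L" "h \<in> carrier H" "t = L.\<pi> x \<otimes>\<^bsub>L.M,H.B\<^esub> H.E h"
        unfolding L.carrier_M H.carrier_B by blast
      then show "t \<in> ?A" using eq[of x h, symmetric] by blast
    qed
  qed
  then show ?thesis by (simp add: partial_smash_def tensor_space_def)
qed

lemma tens_MB: "v \<otimes>\<^bsub>L.M,H.B\<^esub> w = v \<odot> w"
  by (rule tens_cong) simp_all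

lemma tlift_MB:
  assumes "vspace U" "bilinear_on L H U f" "t \<in> carrier (L.M \<Otimes> H.B)"
  shows "tlift L H f t = tlift L.M H.B f t"
  using assms by (intro tlift_mono) (auto simp: L.M_in_L H.B_in_H)

lemma mult_P:
  assumes [simp]: "s \<in> carrier (L.M \<Otimes> H.B)" "t \<in> carrier (L.M \<Otimes> H.B)"
  shows "s \<cdot>\<^bsub>P\<^esub> t = s \<cdot>\<^bsub>T\<^esub> t"
proof -
  have tLH: "t \<in> carrier (L \<Otimes> H)"
  proof -
    have "tlift L.M H.B (\<lambda>v w. v \<odot> w) t = t"
      using tlift_ident[of L.M H.B t] by (simp add: tens_MB)
    moreover have "tlift L.M H.B (\<lambda>v w. v \<odot> w) t \<in> carrier (L \<Otimes> H)"
      by (rule tlift_in) (simp_all add: mem L.M_in_L H.B_in_H)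
    ultimately show ?thesis by simp
  qed
  let ?F = "\<lambda>x h y g. sweedler H h (\<lambda>h1 h2. (lam h1 *s (x \<cdot> y)) \<odot> (h2 \<cdot>\<^bsub>H\<^esub> g))"
  let ?G = "\<lambda>x h y g. (x \<cdot> y) \<odot> (H.E h \<cdot>\<^bsub>H\<^esub> g)"
  have "s \<cdot>\<^bsub>P\<^esub> t = tlift L H (\<lambda>x h. tlift L H (?F x h) t) s"
    by (simp add: partial_smash_def)
  also have "\<dots> = tlift L.M H.B (\<lambda>x h. tlift L H (?F x h) t) s"
    by (rule tlift_MB[where U = "L \<Otimes> H"]) (simp_all add: lin mem tLH)
  also have "\<dots> = tlift L.M H.B (\<lambda>x h. tlift L H (?G x h) t) s"
    by (simp add: sweedler_lam lin mem L.M_in_L H.B_in_H tLH cong: tlift_cong)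
  also have "\<dots> = tlift L.M H.B (\<lambda>x h. tlift L.M H.B (?G x h) t) s"
    by (simp add: tlift_MB[where U = "L \<Otimes> H"] lin mem L.M_in_L H.B_in_H cong: tlift_cong)
  also have "\<dots> = s \<cdot>\<^bsub>T\<^esub> t"
    by (simp add: tensor_mult_def tens_MB H.E_B cong: tlift_cong)
  finally show ?thesis .
qed

lemma comult_P:
  assumes [simp]: "t \<in> carrier (L.M \<Otimes> H.B)"
  shows "\<Delta>\<^bsub>P\<^esub> t = \<Delta>\<^bsub>T\<^esub> t"
proof -
  let ?W = "(L \<Otimes> H) \<Otimes> (L \<Otimes> H)"
  have tt: "x \<otimes>\<^bsub>L.M \<Otimes> H.B, L.M \<Otimes> H.B\<^esub> y = x \<otimes>\<^bsub>L \<Otimes> H, L \<Otimes> H\<^esub> y" for x y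
    by (rule tens_cong) (simp_all add: scale_tensor_space)
  let ?G = "\<lambda>x1 h1 x2 h2. (x1 \<odot> h1) \<otimes>\<^bsub>L \<Otimes> H, L \<Otimes> H\<^esub> (x2 \<odot> h2)"
  let ?F = "\<lambda>x h. sweedler L x (\<lambda>x1 x2. sweedler H h (\<lambda>h1 h2. ?G x1 h1 (L.\<pi> x2) h2))"
  have F: "?F x h = sweedler L.M x (\<lambda>x1 x2. sweedler H.B h (\<lambda>h1 h2. ?G x1 h1 x2 h2))"
    if [simp]: "x \<in> carrier L.M" "h \<in> carrier H.B" for x h
  proof -
    have [simp]: "h \<in> carrier H" using that by (simp add: H.B_in_H)
    have "sweedler L.M x (\<lambda>x1 x2. sweedler H.B h (\<lambda>h1 h2. ?G x1 h1 x2 h2)) =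
      sweedler L.M x (\<lambda>x1 x2. sweedler H h (\<lambda>h1 h2. ?G x1 h1 x2 h2))"
      by (simp add: H.sweedler_B[where U = ?W] lin mem L.coalgebra_M L.M_in_L)
    also have "\<dots> = ?F x h"
      by (simp add: L.sweedler_M[where U = ?W] lin mem)
    finally show ?thesis ..
  qed
  have "\<Delta>\<^bsub>P\<^esub> t = tlift L H ?F t"
    by (simp add: partial_smash_def L.\<pi>_def)
  also have "\<dots> = tlift L.M H.B ?F t"
    by (rule tlift_MB[where U = ?W]) (simp_all add: lin mem)
  also have "\<dots> = tlift L.M H.B (\<lambda>x h. sweedler L.M x (\<lambda>x1 x2. sweedler H.B h (\<lambda>h1 h2. ?G x1 h1 x2 h2))) t"
    by (intro tlift_cong[OF refl]) (simp add: F)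
  also have "\<dots> = \<Delta>\<^bsub>T\<^esub> t" by (simp add: comult_tensor_hopf tens_MB tt)
  finally show ?thesis .
qed

lemma counit_P:
  assumes [simp]: "t \<in> carrier (L.M \<Otimes> H.B)"
  shows "\<epsilon>\<^bsub>P\<^esub> t = \<epsilon>\<^bsub>T\<^esub> t"
  by (simp add: partial_smash_def counit_tensor_hopf tlift_MB[where U = ground] lin)

lemma P_simps: "scale P = scale T" "one P = one T"
  by (simp_all add: partial_smash_def scale_tensor_space tens_MB)

lemma hopf_P: "hopf P (tlift L.M H.B (\<lambda>a b. L.\<pi> (SL a) \<otimes>\<^bsub>L.M,H.B\<^esub> SH b))"
proof (rule hopf_cong)
  show "hopf T (tlift L.M H.B (\<lambda>a b. L.\<pi> (SL a) \<otimes>\<^bsub>L.M,H.B\<^esub> SH b))"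
    by (rule hopf_tensor_hopf[OF L.hopf_M H.hopf_B])
qed (simp_all only: carrier_P tensor_hopf_simps(1) mult_P comult_P counit_P P_simps)

theorem integral_P:
  "(\<exists>t \<in> left_integrals P. \<epsilon>\<^bsub>P\<^esub> t = 1) \<longleftrightarrow>
     (\<exists>x \<in> left_integrals L. \<epsilon> x = 1) \<and> (\<exists>b \<in> left_integrals H.B. \<epsilon>\<^bsub>H\<^esub> b = 1)"
proof -
  have "left_integrals P = left_integrals T"
    unfolding left_integrals_def by (auto simp only: carrier_P tensor_hopf_simps(1) mult_P counit_P P_simps)
  moreover have "t \<in> left_integrals T \<Longrightarrow> \<epsilon>\<^bsub>P\<^esub> t = \<epsilon>\<^bsub>T\<^esub> t" for t
    by (simp only: left_integrals_def counit_P tensor_hopf_simps(1) mem_Collect_eq)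
  ultimately have "(\<exists>t \<in> left_integrals P. \<epsilon>\<^bsub>P\<^esub> t = 1) \<longleftrightarrow> (\<exists>t \<in> left_integrals T. \<epsilon>\<^bsub>T\<^esub> t = 1)"
    by (metis (no_types, lifting))
  also have "\<dots> \<longleftrightarrow> (\<exists>x \<in> left_integrals L.M. \<epsilon>\<^bsub>L.M\<^esub> x = 1) \<and> (\<exists>b \<in> left_integrals H.B. \<epsilon>\<^bsub>H.B\<^esub> b = 1)"
    by (rule tensor_hopf_normalized_integral[OF L.bialgebra_M H.bialgebra_B])
  also have "(\<exists>x \<in> left_integrals L.M. \<epsilon>\<^bsub>L.M\<^esub> x = 1) \<longleftrightarrow> (\<exists>x \<in> left_integrals L. \<epsilon> x = 1)"
  proof -
    have "\<epsilon> (L.\<pi> x) = \<epsilon> x" if "x \<in> left_integrals L" for x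
      using that by (simp add: left_integrals_def L.counit_pi)
    then show ?thesis using L.left_integral_M L.left_integral_L by (metis L.M_simps(4))
  qed
  finally show ?thesis by simp
qed

end

section \<open>The compatibility condition of the matched pair\<close>

text \<open>
Two specialisations of the compatibility condition of the pair are used: \<open>z_absorb\<close> and \<open>lam_absorb\<close>.
\<close>
locale trivial_matched_pair =
  H: hopf H SH + L: hopf L SL
  for H :: "('k::field, 'h::ab_group_add) hopf_data" and SH
    and L :: "('k, 'l::ab_group_add) hopf_data" (structure) and SL +
  fixes lam :: "'h \<Rightarrow> 'k" and z :: 'l
  assumes lam: "linear_on H ground lam" and lam_one: "lam \<one>\<^bsub>H\<^esub> = 1"
    and lam_mult: "h \<in> carrier H \<Longrightarrow> g \<in> carrier H \<Longrightarrow>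
           sweedler H h (\<lambda>h1 h2. lam h1 * lam (h2 \<cdot>\<^bsub>H\<^esub> g)) = lam h * lam g"
    and z [simp]: "z \<in> carrier L" and counit_z: "\<epsilon> z = 1"
    and z_tens: "z \<otimes>\<^bsub>L,L\<^esub> z = tensor_mult L L (\<Delta> z) (\<one> \<otimes>\<^bsub>L,L\<^esub> z)"
    and pair: "partial_matched_pair H L (\<lambda>h x. lam h *s x) (\<lambda>h. h \<otimes>\<^bsub>H,L\<^esub> z)"
begin

abbreviation (input) triple where "triple u y w \<equiv> (u \<otimes>\<^bsub>H,L\<^esub> y) \<otimes>\<^bsub>H \<Otimes> L, L\<^esub> w"

lemmas lam_linear [lin] = lam linear_on_compose[OF lam]

lemma comult_z: "sweedler L z (\<lambda>a b. a \<otimes>\<^bsub>L,L\<^esub> (b \<cdot> z)) = z \<otimes>\<^bsub>L,L\<^esub> z"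
  unfolding z_tens
  by (simp add: L.comult_sweedler sweedler_out[OF linear_on_tensor_mult(1)[OF _ _ _ linear_on_id]] tensor_mult_tens mem)

lemma z_idem: "z \<cdot> z = z"
proof -
  let ?f = "tlift L L (\<lambda>a b. \<epsilon> a *s b)"
  have f: "linear_on (L \<Otimes> L) L ?f" by (simp add: tensor_universal_property(1) lin)
  have "?f (sweedler L z (\<lambda>a b. a \<otimes>\<^bsub>L,L\<^esub> (b \<cdot> z))) = sweedler L z (\<lambda>a b. \<epsilon> a *s (b \<cdot> z))"
    by (simp add: sweedler_out[OF f] tlift_tens[where U = L] lin mem)
  also have "\<dots> = z \<cdot> z" by (simp add: counit_left lin)
  finally show ?thesis by (simp add: comult_z tlift_tens[where U = L] lin mem counit_z)
qed

lemma lam_idem: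
  assumes [simp]: "h \<in> carrier H"
  shows "sweedler H h (\<lambda>h1 h2. lam h1 * lam h2) = lam h"
  using lam_mult[of h "\<one>\<^bsub>H\<^esub>"] by (simp add: mem lam_one)

lemma compatibility:
  assumes [simp]: "h \<in> carrier H" "g \<in> carrier H" "x \<in> carrier L"
  shows "sweedler H h (\<lambda>h1 h2. sweedler L (lam h1 *s x) (\<lambda>y1 y2.
          triple (h2 \<cdot>\<^bsub>H\<^esub> g) y1 (y2 \<cdot> z))) =
    sweedler H h (\<lambda>h1 r. sweedler H r (\<lambda>h2 r. sweedler H r (\<lambda>h3 h4. sweedler L x (\<lambda>x1 x2.
          triple (h3 \<cdot>\<^bsub>H\<^esub> g) (lam h1 *s x1) (z \<cdot> (lam h2 *s x2) \<cdot> z \<cdot> (lam h4 *s z))))))"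
proof -
  have "sweedler H h (\<lambda>h1 h2. sweedler L (lam h1 *s x) (\<lambda>y1 y2. tlift H L (\<lambda>u0 u1.
          triple u0 y1 (y2 \<cdot> u1)) ((h2 \<cdot>\<^bsub>H\<^esub> g) \<otimes>\<^bsub>H,L\<^esub> z))) =
        sweedler4 H h (\<lambda>h1 h2 h3 h4. sweedler L x (\<lambda>x1 x2.
          tlift H L (\<lambda>h10 h11. tlift H L (\<lambda>h30 h31. tlift H L (\<lambda>g0 g1.
            triple (h30 \<cdot>\<^bsub>H\<^esub> g0) (lam h10 *s x1) (h11 \<cdot> (lam h2 *s x2) \<cdot> h31 \<cdot> (lam h4 *s g1))) (g \<otimes>\<^bsub>H,L\<^esub> z)) (h3 \<otimes>\<^bsub>H,L\<^esub> z)) (h1 \<otimes>\<^bsub>H,L\<^esub> z)))"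
    using pair assms unfolding partial_matched_pair_def by blast
  then show ?thesis
    unfolding sweedler4_def
    by (simp add: tlift_tens[where U = "(H \<Otimes> L) \<Otimes> L"] lin mem)
qed

text \<open>
The compatibility condition at \<open>h = g = 1\<close>, with \<open>\<epsilon>\<close> applied to the first two tensor factors.
\<close>
lemma z_absorb:
  assumes [simp]: "x \<in> carrier L"
  shows "z \<cdot> (x \<cdot> z) = x \<cdot> z"
proof -
  let ?U = "(H \<Otimes> L) \<Otimes> L"
  let ?q = "tlift H L (\<lambda>u y. \<epsilon>\<^bsub>H\<^esub> u * \<epsilon> y)"
  have q: "linear_on (H \<Otimes> L) ground ?q" by (simp add: tensor_universal_property(1) lin)
  let ?Q = "tlift (H \<Otimes> L) L (\<lambda>t w. ?q t *s w)"
  have Q: "linear_on ?U L ?Q"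
    by (simp add: tensor_universal_property(1) lin q)
  have pure: "?Q (triple u y w) = (\<epsilon>\<^bsub>H\<^esub> u * \<epsilon> y) *s w"
    if "u \<in> carrier H" "y \<in> carrier L" "w \<in> carrier L" for u y w
    using that by (simp add: tlift_tens[where U = L] tlift_tens[where U = ground] lin mem q)
  have "sweedler L x (\<lambda>x1 x2. triple \<one>\<^bsub>H\<^esub> x1 (x2 \<cdot> z)) =
    sweedler L x (\<lambda>x1 x2. triple \<one>\<^bsub>H\<^esub> x1 (z \<cdot> x2 \<cdot> z \<cdot> z))"
    using compatibility[of "\<one>\<^bsub>H\<^esub>" "\<one>\<^bsub>H\<^esub>" x]
    by (simp add: sweedler_one[where U = ?U] lin mem lam_one)
  then have "?Q (sweedler L x (\<lambda>x1 x2. triple \<one>\<^bsub>H\<^esub> x1 (x2 \<cdot> z))) =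
    ?Q (sweedler L x (\<lambda>x1 x2. triple \<one>\<^bsub>H\<^esub> x1 (z \<cdot> x2 \<cdot> z \<cdot> z)))"
    by simp
  then have "sweedler L x (\<lambda>x1 x2. \<epsilon> x1 *s (x2 \<cdot> z)) =
    sweedler L x (\<lambda>x1 x2. \<epsilon> x1 *s (z \<cdot> x2 \<cdot> z \<cdot> z))"
    by (simp add: sweedler_out[OF Q] pure mem)
  then show ?thesis
    by (simp add: counit_left lin mem) (simp add: algebraD(5) z_idem mem)
qed

text \<open>
The compatibility condition at \<open>g = 1\<close>, \<open>x = 1\<close>, with \<open>\<epsilon>\<close> applied to the last two tensor factors,
which gives \<open>\<lambda>(h\<^sub>1) h\<^sub>2 = \<lambda>(h\<^sub>1) \<lambda>(h\<^sub>2) h\<^sub>3 \<lambda>(h\<^sub>4)\<close>; then \<open>\<lambda>(h\<^sub>1) \<lambda>(h\<^sub>2) = \<lambda>(h)\<close>.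
\<close>
lemma lam_absorb:
  assumes [simp]: "h \<in> carrier H"
  shows "sweedler H h (\<lambda>a r. sweedler H r (\<lambda>b d. (lam d * lam a) *s\<^bsub>H\<^esub> b)) = sweedler H h (\<lambda>a b. lam a *s\<^bsub>H\<^esub> b)"
proof -
  let ?U = "(H \<Otimes> L) \<Otimes> L"
  let ?q = "\<lambda>w. tlift H L (\<lambda>u y. (\<epsilon> y * \<epsilon> w) *s\<^bsub>H\<^esub> u)"
  let ?Q = "tlift (H \<Otimes> L) L (\<lambda>t w. ?q w t)"
  have Q: "linear_on ?U H ?Q"
    by (simp add: tensor_universal_property(1) lin)
  have pure: "?Q (triple u y w) = (\<epsilon> y * \<epsilon> w) *s\<^bsub>H\<^esub> u"
    if "u \<in> carrier H" "y \<in> carrier L" "w \<in> carrier L" for u y w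
    using that by (simp add: tlift_tens[where U = H] lin mem)
  have e: "\<epsilon> (k *s y) = k * \<epsilon> y" if "y \<in> carrier L" for k y
    using linear_onD(3)[OF coalgebraD(3)[of L]] that by simp
  have "sweedler H h (\<lambda>h1 h2. triple h2 (lam h1 *s \<one>) z) =
    sweedler H h (\<lambda>h1 r. sweedler H r (\<lambda>h2 r. sweedler H r (\<lambda>h3 h4.
          triple h3 (lam h1 *s \<one>) (z \<cdot> (lam h2 *s \<one>) \<cdot> z \<cdot> (lam h4 *s z)))))"
  proof -
    have "sweedler L (k *s \<one>) (\<lambda>y1 y2. triple u y1 (y2 \<cdot> z)) =
        triple u (k *s \<one>) z" if [simp]: "u \<in> carrier H" for k u
    proof -
      have "sweedler L (k *s \<one>) (\<lambda>y1 y2. triple u y1 (y2 \<cdot> z)) =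
        k *s\<^bsub>?U\<^esub> sweedler L \<one> (\<lambda>y1 y2. triple u y1 (y2 \<cdot> z))"
        by (rule linear_onD(3)[OF linear_on_sweedler]) (simp_all add: lin mem)
      also have "\<dots> = k *s\<^bsub>?U\<^esub> (triple u \<one> z)"
        by (simp add: sweedler_one[where U = ?U] lin mem)
      also have "\<dots> = triple u (k *s \<one>) z"
        by (rule linear_onD(3)[symmetric, of L ?U "\<lambda>y. triple u y z"]) (simp_all add: lin mem)
      finally show ?thesis .
    qed
    then show ?thesis
      using compatibility[of h "\<one>\<^bsub>H\<^esub>" "\<one>"] by (simp add: sweedler_one[where U = ?U] lin mem)
  qed
  then have "?Q (sweedler H h (\<lambda>h1 h2. triple h2 (lam h1 *s \<one>) z)) =
    ?Q (sweedler H h (\<lambda>h1 r. sweedler H r (\<lambda>h2 r. sweedler H r (\<lambda>h3 h4.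
          triple h3 (lam h1 *s \<one>) (z \<cdot> (lam h2 *s \<one>) \<cdot> z \<cdot> (lam h4 *s z))))))"
    by (rule arg_cong)
  then have "sweedler H h (\<lambda>a b. lam a *s\<^bsub>H\<^esub> b) =
    sweedler H h (\<lambda>h1 r. sweedler H r (\<lambda>h2 r. sweedler H r (\<lambda>h3 h4. (lam h1 * lam h2 * lam h4) *s\<^bsub>H\<^esub> h3)))"
    by (simp add: sweedler_out[OF Q] pure mem e counit_z mult.assoc)
  also have "\<dots> = sweedler H h (\<lambda>m r. sweedler H m (\<lambda>h1 h2. sweedler H r (\<lambda>h3 h4. (lam h1 * lam h2 * lam h4) *s\<^bsub>H\<^esub> h3)))"
    by (rule coassoc[symmetric, where U = H]) (simp_all add: lin mem)
  also have "\<dots> = sweedler H h (\<lambda>m r. sweedler H r (\<lambda>h3 h4. (lam h4 * lam m) *s\<^bsub>H\<^esub> h3))"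
  proof -
    have "sweedler H m (\<lambda>h1 h2. sweedler H r (\<lambda>h3 h4. (lam h1 * lam h2 * lam h4) *s\<^bsub>H\<^esub> h3)) =
      sweedler H r (\<lambda>h3 h4. (lam h4 * lam m) *s\<^bsub>H\<^esub> h3)" if [simp]: "m \<in> carrier H" "r \<in> carrier H" for m r
    proof -
      have "(lam h4 * lam m) *s\<^bsub>H\<^esub> h3 = sweedler H m (\<lambda>h1 h2. (lam h1 * lam h2 * lam h4) *s\<^bsub>H\<^esub> h3)"
        if [simp]: "h3 \<in> carrier H" for h3 h4
        unfolding lam_idem[OF \<open>m \<in> carrier H\<close>, symmetric]
        by (subst sweedler_out[of ground H "\<lambda>k. (lam h4 * k) *s\<^bsub>H\<^esub> h3"]) (simp_all add: lin ac_simps)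
      then show ?thesis by (simp add: sweedler_swap[of H m H r])
    qed
    then show ?thesis by simp
  qed
  finally show ?thesis ..
qed

lemma partial_action: "partial_action H SH lam"
  by unfold_locales (use lam lam_one lam_mult lam_absorb in auto)

lemma partial_coaction: "partial_coaction L SL z"
  by unfold_locales (use z counit_z z_absorb comult_z in auto)

end

theorem corollary4p11:
  fixes H :: "('k::field, 'h::ab_group_add) hopf_data"
    and L :: "('k, 'l::ab_group_add) hopf_data"
    and lam :: "'h \<Rightarrow> 'k" and z :: 'l
  assumes "hopf_algebra H" and "finite_dim H"
    and "hopf_algebra L" and "finite_dim L"
    and "linear_on H ground lam" and "lam \<one>\<^bsub>H\<^esub> = 1"
    and "\<forall>h \<in> carrier H. \<forall>g \<in> carrier H.
           lam h * lam g = sweedler H h (\<lambda>h1 h2. lam h1 * lam (h2 \<cdot>\<^bsub>H\<^esub> g))"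
    and "z \<in> carrier L" and "\<epsilon>\<^bsub>L\<^esub> z = 1"
    and "z \<otimes>\<^bsub>L,L\<^esub> z = tensor_mult L L (\<Delta>\<^bsub>L\<^esub> z) (\<one>\<^bsub>L\<^esub> \<otimes>\<^bsub>L,L\<^esub> z)"
    and "partial_matched_pair H L (\<lambda>h x. lam h *s\<^bsub>L\<^esub> x) (\<lambda>h. h \<otimes>\<^bsub>H,L\<^esub> z)"
  shows "hopf_algebra (partial_smash L H lam z) \<and>
    (semisimple (partial_smash L H lam z) \<longleftrightarrow> separable (partial_smash L H lam z)) \<and>
    (separable (partial_smash L H lam z) \<longleftrightarrow>
       semisimple L \<and> (lam ` left_integrals H \<noteq> {0} \<or> lam ` right_integrals H \<noteq> {0}))"
proof -
  obtain SH where SH: "hopf H SH" using assms(1) by (auto simp: hopf_algebra_iff hopf_def)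
  obtain SL where SL: "hopf L SL" using assms(3) by (auto simp: hopf_algebra_iff hopf_def)
  interpret H: hopf H SH by fact
  interpret L: hopf L SL by fact
  interpret pair: trivial_matched_pair H SH L SL lam z
    by unfold_locales (use assms in auto)
  interpret P: partial_smash_product L SL z H SH lam
    by (intro partial_smash_product.intro pair.partial_action pair.partial_coaction)
  obtain I c where basis: "coord_basis H I c"
    using finite_dim_coord_basis[of H] assms(2) by auto
  interpret Hb: hopf_basis H SH I c by unfold_locales (rule basis)
  obtain \<phi> where phi: "linear_on H ground \<phi>" "\<exists>x \<in> carrier H. \<phi> x \<noteq> 0"
    "\<forall>x \<in> carrier H. sweedler H x (\<lambda>x1 x2. \<phi> x2 *s\<^bsub>H\<^esub> x1) = \<phi> x *s\<^bsub>H\<^esub> \<one>\<^bsub>H\<^esub>"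
    using Hb.exists_left_integral_form by blast
  interpret Hf: partial_action_fd H SH I c \<phi> lam
    by (intro partial_action_fd.intro hopf_integral_form.intro hopf_integral_form_axioms.intro
        pair.partial_action Hb.hopf_basis_axioms) (use phi in auto)
  interpret P': hopf "partial_smash L H lam z" "tlift P.L.M P.H.B (\<lambda>a b. P.L.\<pi> (SL a) \<otimes>\<^bsub>P.L.M,P.H.B\<^esub> SH b)"
    by (rule P.hopf_P)
  have "hopf_algebra (partial_smash L H lam z)"
    using P'.bialgebra P'.antipode by (auto simp: hopf_algebra_iff)
  then show ?thesis
    using P'.semisimple_separable_integral L.semisimple_separable_integral P.integral_P Hf.integral_criterion
    by metis
qed

end
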